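(* Let $(X,d)$ be a separable ultra-metric space in which all closed balls are compact, let $\mu$ be a Radon measure on $X$ with full support, let $\sigma$ be a distance distribution function, and let $\mathcal{L}$ be the isotropic Laplacian associated with $(d,\mu,\sigma)$, with domain $\operatorname{dom}_{\mathcal{L}}\subset L^2(X,\mu)$. For $r>0$ let $\mathcal{V}_r$ be the space of all functions in $L^2(X,\mu)$ that are constant on each $d_*$-ball of radius $r$, and let $\mathcal{V}=\bigcup_{r>0}\mathcal{V}_r$. Then the space $\mathcal{V}$ is dense in $L^2(X,\mu)$, it is a subset of $\operatorname{dom}_{\mathcal{L}}$ and, for any $f\in\mathcal{V}$, $$\mathcal{L}f(x)=\int_X\left(f(x)-f(y)\right)J(x,y)\,d\mu(y)$$ (for $\mu$-almost all $x\in X$), where $$J(x,y)=\int_0^{1/d_*(x,y)}N(x,\tau)\,d\tau=\int_{d_*(x,y)}^\infty\frac1{\mu(B_s^*(x))}\,\frac{ds}{s^2}.$$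
   Context: Closed balls: $B_r(x)=\{y:d(x,y)\le r\}$; $\mathrm{Q}_rf(x)=\frac1{\mu(B_r(x))}\int_{B_r(x)}f\,d\mu$. A distance distribution function is a strictly increasing left-continuous function $\sigma:[0,\infty]\to[0,1]$ with $\sigma(0+)=0$, $\sigma(\infty)=1$. The isotropic Markov operator associated with $(d,\mu,\sigma)$ is $P=\int_{[0,\infty)}\mathrm{Q}_r\,d\sigma(r)$, self-adjoint in $L^2(X,\mu)$ with spectrum in $[0,1]$; the isotropic Laplacian is the non-negative definite self-adjoint operator $\mathcal{L}=\log\frac1P$ (functional calculus), so that $P^t=\exp(-t\mathcal{L})$. Intrinsic ultra-metric: $\frac1{d_*(x,y)}=\log\frac1{\sigma(d(x,y))}$ (with $d_*(x,x)=0$); $B^*_s(x)=\{y:d_*(x,y)\le s\}$; $N(x,\tau)=1/\mu(B^*_{1/\tau}(x))$. Here $J(x,x)=\infty$, and the integrand $(f(x)-f(y))J(x,y)$ is taken to be $0$ whenever $f(x)=f(y)$. *)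

theory Defs
  imports "HOL-Analysis.Analysis"
begin

section \<open>Measures and distance distribution functions\<close>

definition radon_measure :: "'a::topological_space measure \<Rightarrow> bool" where
  "radon_measure M \<longleftrightarrow>
     sets M = sets borel \<and>
     (\<forall>K. compact K \<longrightarrow> emeasure M K < \<infinity>) \<and>
     (\<forall>A\<in>sets borel. emeasure M A = (INF U\<in>{U. open U \<and> A \<subseteq> U}. emeasure M U)) \<and>
     (\<forall>U. open U \<longrightarrow> emeasure M U = (SUP K\<in>{K. compact K \<and> K \<subseteq> U}. emeasure M K))"

definition full_support :: "'a::topological_space measure \<Rightarrow> bool" where
  "full_support M \<longleftrightarrow> (\<forall>U. open U \<and> U \<noteq> {} \<longrightarrow> emeasure M U > 0)"

text \<open>The half-line with its end point infinity is the type of extended nonnegative reals; left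
  continuity is also required at infinity.\<close>

definition distance_distribution_function :: "(ennreal \<Rightarrow> real) \<Rightarrow> bool" where
  "distance_distribution_function \<sigma> \<longleftrightarrow>
     range \<sigma> \<subseteq> {0..1} \<and>
     strict_mono \<sigma> \<and>
     (\<forall>r. (\<sigma> \<longlongrightarrow> \<sigma> r) (at_left r)) \<and>
     (\<sigma> \<longlongrightarrow> 0) (at_right 0) \<and>
     \<sigma> \<infinity> = 1"

text \<open>The Lebesgue-Stieltjes measure of the left-continuous function \<open>\<sigma>\<close>, which gives
  \<open>{a..<b}\<close> the mass \<open>\<sigma> b - \<sigma> a\<close>. The library constant \<open>interval_measure\<close> is meant for
  right-continuous functions, so \<open>\<sigma>\<close> is reflected at the origin and the measure reflected back.\<close>

definition stieltjes :: "(ennreal \<Rightarrow> real) \<Rightarrow> real measure" where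
  "stieltjes \<sigma> = distr (interval_measure (\<lambda>t. - \<sigma> (ennreal (- t)))) borel uminus"

lemma emeasure_stieltjes:
  assumes \<sigma>: "distance_distribution_function \<sigma>" and ab: "a \<le> b"
  shows "emeasure (stieltjes \<sigma>) {a..<b} = ennreal (\<sigma> (ennreal b) - \<sigma> (ennreal a))"
proof -
  let ?F = "\<lambda>t. - \<sigma> (ennreal (- t))"
  have mono: "?F x \<le> ?F y" if "x \<le> y" for x y
    using \<sigma> that unfolding distance_distribution_function_def
    by (simp add: strict_mono_less_eq ennreal_leI)
  have left: "((\<lambda>s. \<sigma> (ennreal s)) \<longlongrightarrow> \<sigma> (ennreal r)) (at_left r)" for r
  proof (cases "r \<le> 0")
    case True
    have "eventually (\<lambda>s. \<sigma> (ennreal s) = \<sigma> (ennreal r)) (at_left r)"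
      using True by (simp add: eventually_at_filter ennreal_neg)
    then show ?thesis
      by (rule tendsto_eventually)
  next
    case False
    have "(\<sigma> \<longlongrightarrow> \<sigma> (ennreal r)) (at_left (ennreal r))"
      using \<sigma> by (simp add: distance_distribution_function_def)
    moreover have "filterlim ennreal (at_left (ennreal r)) (at_left r)"
      unfolding filterlim_at
    proof
      show "(ennreal \<longlongrightarrow> ennreal r) (at_left r)"
        by (intro tendsto_ennrealI tendsto_ident_at)
      have "\<forall>\<^sub>F x in at_left r. x < r"
        by (simp add: eventually_at_filter)
      then show "\<forall>\<^sub>F x in at_left r. ennreal x \<in> {..<ennreal r} \<and> ennreal x \<noteq> ennreal r"
        by eventually_elim (use False in \<open>simp add: ennreal_lessI order.strict_implies_not_eq\<close>)
    qed
    ultimately show ?thesis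
      by (rule filterlim_compose)
  qed
  have rc: "continuous (at_right t) ?F" for t
  proof -
    have "filterlim uminus (at_left (- t)) (at_right t)"
      by (simp add: at_left_minus [of "- t"] filterlim_def filtermap_filtermap)
    from filterlim_compose [OF left this] show ?thesis
      by (simp add: continuous_within tendsto_minus)
  qed
  have *: "uminus -` {a..<b} = {- b <.. - a}"
    by (auto simp: less_le_not_le)
  have "emeasure (stieltjes \<sigma>) {a..<b} = emeasure (interval_measure ?F) {- b <.. - a}"
    unfolding stieltjes_def
    by (simp add: emeasure_distr *)
  also have "\<dots> = ennreal (?F (- a) - ?F (- b))"
    by (rule emeasure_interval_measure_Ioc) (use ab mono rc in auto)
  finally show ?thesis
    by simp
qed


section \<open>The Hilbert space of square-integrable functions\<close>

text \<open>Elements are represented by functions; identities between them hold almost everywhere.\<close>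

definition L2 :: "'a measure \<Rightarrow> ('a \<Rightarrow> real) set" where
  "L2 M = {f \<in> borel_measurable M. integrable M (\<lambda>x. (f x)\<^sup>2)}"

definition l2_inner :: "'a measure \<Rightarrow> ('a \<Rightarrow> real) \<Rightarrow> ('a \<Rightarrow> real) \<Rightarrow> real" where
  "l2_inner M f g = (LINT x|M. f x * g x)"

definition l2_norm :: "'a measure \<Rightarrow> ('a \<Rightarrow> real) \<Rightarrow> real" where
  "l2_norm M f = sqrt (l2_inner M f f)"

text \<open>Symmetry on the whole space already forces an operator to be linear and to respect
  almost-everywhere equality (both up to null sets).\<close>

definition orthogonal_projection :: "'a measure \<Rightarrow> (('a \<Rightarrow> real) \<Rightarrow> ('a \<Rightarrow> real)) \<Rightarrow> bool" where
  "orthogonal_projection M T \<longleftrightarrow>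
     (\<forall>f\<in>L2 M. T f \<in> L2 M) \<and>
     (\<forall>f\<in>L2 M. \<forall>g\<in>L2 M. l2_inner M (T f) g = l2_inner M f (T g)) \<and>
     (\<forall>f\<in>L2 M. AE x in M. T (T f) x = T f x)"


section \<open>Functional calculus of a self-adjoint operator\<close>

text \<open>A resolution of the identity, in the right-continuous normalization.\<close>

definition resolution_of_identity ::
  "'a measure \<Rightarrow> (real \<Rightarrow> ('a \<Rightarrow> real) \<Rightarrow> ('a \<Rightarrow> real)) \<Rightarrow> bool" where
  "resolution_of_identity M E \<longleftrightarrow>
     (\<forall>t. orthogonal_projection M (E t)) \<and>
     (\<forall>s t. s \<le> t \<longrightarrow> (\<forall>f\<in>L2 M. AE x in M. E s (E t f) x = E s f x)) \<and>
     (\<forall>f\<in>L2 M. \<forall>s. ((\<lambda>t. l2_norm M (\<lambda>x. E t f x - E s f x)) \<longlongrightarrow> 0) (at_right s)) \<and>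
     (\<forall>f\<in>L2 M. ((\<lambda>t. l2_norm M (E t f)) \<longlongrightarrow> 0) at_bot) \<and>
     (\<forall>f\<in>L2 M. ((\<lambda>t. l2_norm M (\<lambda>x. E t f x - f x)) \<longlongrightarrow> 0) at_top)"

text \<open>The measure \<open>d(E\<^sub>t f, f)\<close> on the real line.\<close>

definition spectral_distribution ::
  "'a measure \<Rightarrow> (real \<Rightarrow> ('a \<Rightarrow> real) \<Rightarrow> ('a \<Rightarrow> real)) \<Rightarrow> ('a \<Rightarrow> real) \<Rightarrow> real measure" where
  "spectral_distribution M E f = interval_measure (\<lambda>t. l2_inner M (E t f) f)"

text \<open>The domain of the operator \<open>\<integral> \<phi> dE\<close>.\<close>

definition spectral_domain ::
  "'a measure \<Rightarrow> (real \<Rightarrow> ('a \<Rightarrow> real) \<Rightarrow> ('a \<Rightarrow> real)) \<Rightarrow> (real \<Rightarrow> real) \<Rightarrow> ('a \<Rightarrow> real) set" where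
  "spectral_domain M E \<phi> =
     {f \<in> L2 M. integrable (spectral_distribution M E f) (\<lambda>t. (\<phi> t)\<^sup>2)}"

text \<open>\<open>spectral_integral M E \<phi> f g\<close> says that \<open>f\<close> belongs to the domain of \<open>\<integral> \<phi> dE\<close> and is mapped
  to \<open>g\<close>, that is, \<open>(g, h) = \<integral> \<phi>(t) d(E\<^sub>t f, h)\<close> for all \<open>h\<close> in the (dense) domain. The signed
  measure \<open>d(E\<^sub>t f, h)\<close> is written out by polarization.\<close>

definition spectral_integral ::
  "'a measure \<Rightarrow> (real \<Rightarrow> ('a \<Rightarrow> real) \<Rightarrow> ('a \<Rightarrow> real)) \<Rightarrow> (real \<Rightarrow> real) \<Rightarrow>
     ('a \<Rightarrow> real) \<Rightarrow> ('a \<Rightarrow> real) \<Rightarrow> bool" where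
  "spectral_integral M E \<phi> f g \<longleftrightarrow>
     f \<in> spectral_domain M E \<phi> \<and> g \<in> L2 M \<and>
     (\<forall>h\<in>spectral_domain M E \<phi>.
        l2_inner M g h =
          ((LINT t|spectral_distribution M E (\<lambda>x. f x + h x). \<phi> t) -
           (LINT t|spectral_distribution M E (\<lambda>x. f x - h x). \<phi> t)) / 4)"

text \<open>\<open>A = \<integral> t dE\<^sub>t\<close>, for an operator \<open>A\<close> defined on the whole space.\<close>

definition is_spectral_resolution_of ::
  "'a measure \<Rightarrow> (('a \<Rightarrow> real) \<Rightarrow> ('a \<Rightarrow> real)) \<Rightarrow> (real \<Rightarrow> ('a \<Rightarrow> real) \<Rightarrow> ('a \<Rightarrow> real)) \<Rightarrow> bool" where
  "is_spectral_resolution_of M A E \<longleftrightarrow>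
     resolution_of_identity M E \<and> (\<forall>f\<in>L2 M. spectral_integral M E (\<lambda>t. t) f (A f))"

text \<open>The choice is only one of representatives: for a bounded self-adjoint operator a spectral
  resolution exists and is unique up to null sets.\<close>

definition spectral_resolution ::
  "'a measure \<Rightarrow> (('a \<Rightarrow> real) \<Rightarrow> ('a \<Rightarrow> real)) \<Rightarrow> (real \<Rightarrow> ('a \<Rightarrow> real) \<Rightarrow> ('a \<Rightarrow> real))" where
  "spectral_resolution M A = (SOME E. is_spectral_resolution_of M A E)"

definition calculus_domain ::
  "'a measure \<Rightarrow> (real \<Rightarrow> real) \<Rightarrow> (('a \<Rightarrow> real) \<Rightarrow> ('a \<Rightarrow> real)) \<Rightarrow> ('a \<Rightarrow> real) set" where
  "calculus_domain M \<phi> A = spectral_domain M (spectral_resolution M A) \<phi>"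

definition calculus_op ::
  "'a measure \<Rightarrow> (real \<Rightarrow> real) \<Rightarrow> (('a \<Rightarrow> real) \<Rightarrow> ('a \<Rightarrow> real)) \<Rightarrow> ('a \<Rightarrow> real) \<Rightarrow> ('a \<Rightarrow> real)" where
  "calculus_op M \<phi> A f = (SOME g. spectral_integral M (spectral_resolution M A) \<phi> f g)"


section \<open>The isotropic Markov operator and the isotropic Laplacian\<close>

definition ball_average :: "'a::metric_space measure \<Rightarrow> real \<Rightarrow> ('a \<Rightarrow> real) \<Rightarrow> 'a \<Rightarrow> real" where
  "ball_average M r f x = 1 / measure M (cball x r) * (LINT y:cball x r|M. f y)"

text \<open>The value at \<open>r = 0\<close> of the average does not matter, as \<open>{0}\<close> has \<open>\<sigma>\<close>-mass
  \<open>\<sigma>(0+) - \<sigma>(0) = 0\<close>. For square-integrable \<open>f\<close> the integral converges at almost every \<open>x\<close>.\<close>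

definition isotropic_Markov ::
  "'a::metric_space measure \<Rightarrow> (ennreal \<Rightarrow> real) \<Rightarrow> ('a \<Rightarrow> real) \<Rightarrow> 'a \<Rightarrow> real" where
  "isotropic_Markov M \<sigma> f x = (LINT r:{0..}|stieltjes \<sigma>. ball_average M r f x)"

text \<open>\<open>\<L> = log (1/P)\<close>. The kernel of \<open>P\<close> is trivial, so its spectral measure does not charge
  \<open>{0}\<close> and the conventional value of \<open>ln (1 / 0)\<close> is irrelevant; so are the values
  outside \<open>[0,1]\<close>, which contains the spectrum of \<open>P\<close>.\<close>

definition dom_isotropic_Laplacian ::
  "'a::metric_space measure \<Rightarrow> (ennreal \<Rightarrow> real) \<Rightarrow> ('a \<Rightarrow> real) set" where
  "dom_isotropic_Laplacian M \<sigma> = calculus_domain M (\<lambda>s. ln (1 / s)) (isotropic_Markov M \<sigma>)"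

definition isotropic_Laplacian ::
  "'a::metric_space measure \<Rightarrow> (ennreal \<Rightarrow> real) \<Rightarrow> ('a \<Rightarrow> real) \<Rightarrow> ('a \<Rightarrow> real)" where
  "isotropic_Laplacian M \<sigma> = calculus_op M (\<lambda>s. ln (1 / s)) (isotropic_Markov M \<sigma>)"


section \<open>The intrinsic ultra-metric and the jump kernel\<close>

definition dstar :: "(ennreal \<Rightarrow> real) \<Rightarrow> 'a::metric_space \<Rightarrow> 'a \<Rightarrow> real" where
  "dstar \<sigma> x y = (if x = y then 0 else 1 / ln (1 / \<sigma> (ennreal (dist x y))))"

definition ball_star :: "(ennreal \<Rightarrow> real) \<Rightarrow> 'a::metric_space \<Rightarrow> real \<Rightarrow> 'a set" where
  "ball_star \<sigma> x s = {y. dstar \<sigma> x y \<le> s}"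

definition spectral_N ::
  "'a::metric_space measure \<Rightarrow> (ennreal \<Rightarrow> real) \<Rightarrow> 'a \<Rightarrow> real \<Rightarrow> ennreal" where
  "spectral_N M \<sigma> x \<tau> = 1 / emeasure M (ball_star \<sigma> x (1 / \<tau>))"

text \<open>The upper limit \<open>1 / dstar \<sigma> x y\<close> is formed in the extended nonnegative reals, so that it is
  infinite for \<open>x = y\<close>.\<close>

definition jump_kernel ::
  "'a::metric_space measure \<Rightarrow> (ennreal \<Rightarrow> real) \<Rightarrow> 'a \<Rightarrow> 'a \<Rightarrow> ennreal" where
  "jump_kernel M \<sigma> x y =
     (\<integral>\<^sup>+\<tau>\<in>{\<tau>. 0 < \<tau> \<and> ennreal \<tau> < 1 / ennreal (dstar \<sigma> x y)}. spectral_N M \<sigma> x \<tau> \<partial>lborel)"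

text \<open>\<open>(f x - f y) J(x, y)\<close>, understood as 0 whenever \<open>f x = f y\<close>; in all other cases \<open>x \<noteq> y\<close> and
  \<open>J(x, y)\<close> is finite.\<close>

definition jump_integrand ::
  "'a::metric_space measure \<Rightarrow> (ennreal \<Rightarrow> real) \<Rightarrow> ('a \<Rightarrow> real) \<Rightarrow> 'a \<Rightarrow> 'a \<Rightarrow> real" where
  "jump_integrand M \<sigma> f x y =
     (if f x = f y then 0 else (f x - f y) * enn2real (jump_kernel M \<sigma> x y))"

text \<open>Constancy is required of the function itself; as nonempty open sets have positive measure, an
  element of \<open>L\<^sup>2\<close> has at most one such representative.\<close>

definition V_space ::
  "'a::metric_space measure \<Rightarrow> (ennreal \<Rightarrow> real) \<Rightarrow> real \<Rightarrow> ('a \<Rightarrow> real) set" where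
  "V_space M \<sigma> r = {f \<in> L2 M. \<forall>x. f constant_on ball_star \<sigma> x r}"

definition V_union ::
  "'a::metric_space measure \<Rightarrow> (ennreal \<Rightarrow> real) \<Rightarrow> ('a \<Rightarrow> real) set" where
  "V_union M \<sigma> = (\<Union>r\<in>{0<..}. V_space M \<sigma> r)"

end

theory Submission
  imports Defs "HOL-Probability.Distribution_Functions"
begin

text \<open>Put \<open>u x y = \<sigma> (dist x y)\<close>, an ultra-metric with values in \<open>[0, 1)\<close>, and let \<open>A\<^sub>t\<close> be the
  averaging operator over the balls \<open>{u \<le> t}\<close>, \<open>0 < t < 1\<close>; the \<open>A\<^sub>t\<close> form a decreasing family of
  orthogonal projections. The Stieltjes measure of \<open>\<sigma>\<close> is the image of Lebesgue measure on \<open>(0, 1)\<close>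
  under the quantile function of \<open>\<sigma>\<close>, so that \<open>P = \<integral> A\<^sub>t dt\<close>. Hence the spectral projections of \<open>P\<close> are
  \<open>I - A\<^sub>t\<close>. Any other resolution of the identity belonging to \<open>P\<close> agrees with this one, because the
  range of its projection at \<open>t\<close> is characterized by \<open>\<parallel>P\<^sup>n f\<parallel> = O(t\<^sup>n)\<close>. Since
  \<open>ln (1 / t) = |{\<tau> > 0. t \<le> exp (- \<tau>)}|\<close>, one gets \<open>\<L> f = \<integral> (f - A\<^sub>t f) d\<tau>\<close> with \<open>t = exp (- \<tau>)\<close>, and
  for locally constant \<open>f\<close> Fubini's theorem turns this into the integral against the jump kernel.\<close>

text \<open>Both the resolution of P and the value of \<open>calculus_op\<close> are picked by
  \<open>SOME\<close>, so only their defining properties are available. Uniqueness of the resolution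
  is therefore indispensable, and so is density of the domain of the logarithm: the image of f is
  described only through its pairings with that domain. Density thus serves beyond the first claim;
  it also gives the right-continuity at 0 of the explicit resolution, where I - A_t has to tend to
  0. Averages are restricted to 0 < t < 1. For t = 0 the ball is a point and may be null, for t = 1
  it is the whole space and may have infinite measure. Two continuity properties have to fit
  together. Balls \<open>{u \<le> t}\<close> shrink to \<open>{u \<le> s}\<close> as t decreases to
  s, which is the right-continuity required of a resolution; left-continuity of \<sigma> makes each
  of these balls a closed ball of the original metric. Integrals of operators are handled weakly,
  through inner products and Fubini over finite measures. For the logarithm this works because f is
  constant on the balls of radius exp (-T) for some T, so that f - A_t f vanishes for t = exp
  (-\<tau>), \<tau> \<ge> T.\<close>

lemma discriminant_le_zero:
  fixes a b c :: real
  assumes nonneg: "\<And>t. 0 \<le> a + 2 * t * b + t\<^sup>2 * c" and "0 \<le> c"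
  shows "b\<^sup>2 \<le> a * c"
proof (cases "c = 0")
  case True
  have "b = 0"
  proof (rule ccontr)
    assume "b \<noteq> 0"
    \<comment> \<open>With \<open>c = 0\<close> the expression is affine in t, and this t gives it
      the value -1.\<close>
    then have "a + 2 * (- (a + 1) / (2 * b)) * b = - 1"
      by (simp add: field_simps)
    then show False
      using nonneg [of "- (a + 1) / (2 * b)"] True by simp
  qed
  then show ?thesis
    using True by simp
next
  case False
  then have "0 < c"
    using \<open>0 \<le> c\<close> by simp
  \<comment> \<open>\<open>- b / c\<close> is the minimizer of the quadratic.\<close>
  then show ?thesis
    using nonneg [of "- b / c"] by (simp add: field_simps power2_eq_square)
qed

section \<open>Square-integrable functions\<close>

lemma L2_measurable [measurable_dest]: "f \<in> L2 M \<Longrightarrow> f \<in> borel_measurable M"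
  by (simp add: L2_def)

lemma L2_square_integrable: "f \<in> L2 M \<Longrightarrow> integrable M (\<lambda>x. (f x)\<^sup>2)"
  by (simp add: L2_def)

lemma L2_mult_integrable:
  assumes f: "f \<in> L2 M" and g: "g \<in> L2 M"
  shows "integrable M (\<lambda>x. f x * g x)"
proof (rule Bochner_Integration.integrable_bound)
  show "integrable M (\<lambda>x. (f x)\<^sup>2 + (g x)\<^sup>2)"
    using f g by (intro Bochner_Integration.integrable_add L2_square_integrable)
  show "(\<lambda>x. f x * g x) \<in> borel_measurable M"
    using f g by measurable
  have "\<bar>a * b\<bar> \<le> a\<^sup>2 + b\<^sup>2" for a b :: real
  proof -
    have "0 \<le> \<bar>a\<bar> * \<bar>b\<bar>"
      by simp
    then show ?thesis
      using sum_squares_bound [of "\<bar>a\<bar>" "\<bar>b\<bar>"] unfolding abs_mult power2_abs by linarith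
  qed
  then show "AE x in M. norm (f x * g x) \<le> norm ((f x)\<^sup>2 + (g x)\<^sup>2)"
    by simp
qed

lemma L2_zero [simp]: "(\<lambda>x. 0) \<in> L2 M"
  by (simp add: L2_def)

lemma L2_add [intro]:
  assumes f: "f \<in> L2 M" and g: "g \<in> L2 M"
  shows "(\<lambda>x. f x + g x) \<in> L2 M"
proof -
  have "integrable M (\<lambda>x. (f x)\<^sup>2 + (g x)\<^sup>2 + 2 * (f x * g x))"
    using f g by (intro Bochner_Integration.integrable_add L2_square_integrable integrable_mult_right
        L2_mult_integrable)
  moreover have "(\<lambda>x. (f x + g x)\<^sup>2) = (\<lambda>x. (f x)\<^sup>2 + (g x)\<^sup>2 + 2 * (f x * g x))"
    by (auto simp: power2_sum)
  moreover have "(\<lambda>x. f x + g x) \<in> borel_measurable M"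
    using f g by measurable
  ultimately show ?thesis
    by (simp add: L2_def)
qed

lemma L2_scale [intro]: "f \<in> L2 M \<Longrightarrow> (\<lambda>x. c * f x) \<in> L2 M"
  by (auto simp: L2_def power_mult_distrib)

lemma L2_diff [intro]: "f \<in> L2 M \<Longrightarrow> g \<in> L2 M \<Longrightarrow> (\<lambda>x. f x - g x) \<in> L2 M"
  using L2_add [of f M "\<lambda>x. - 1 * g x"] L2_scale [of g M "- 1"] by simp

lemma L2_bound:
  assumes "g \<in> L2 M" and [measurable]: "f \<in> borel_measurable M"
    and "\<And>x. \<bar>f x\<bar> \<le> \<bar>g x\<bar>"
  shows "f \<in> L2 M"
proof -
  have "integrable M (\<lambda>x. (f x)\<^sup>2)"
    by (rule Bochner_Integration.integrable_bound [OF L2_square_integrable [OF assms(1)]])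
      (use assms(3) in \<open>auto simp: abs_le_square_iff\<close>)
  then show ?thesis
    by (simp add: L2_def)
qed

lemma indicator_L2_iff:
  assumes A: "A \<in> sets M"
  shows "indicator A \<in> L2 M \<longleftrightarrow> emeasure M A < \<infinity>"
proof -
  have "(\<lambda>x. (indicator A x)\<^sup>2) = (indicator A :: 'a \<Rightarrow> real)"
    by (auto simp: indicator_def)
  moreover have "A \<inter> space M = A"
    using sets.sets_into_space [OF A] by blast
  ultimately show ?thesis
    using A by (simp add: L2_def integrable_indicator_iff)
qed

lemma l2_inner_commute: "l2_inner M f g = l2_inner M g f"
  by (simp add: l2_inner_def mult.commute)

lemma l2_inner_zero [simp]: "l2_inner M (\<lambda>x. 0) g = 0" "l2_inner M g (\<lambda>x. 0) = 0"
  by (simp_all add: l2_inner_def)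

lemma l2_inner_add_left:
  "f \<in> L2 M \<Longrightarrow> g \<in> L2 M \<Longrightarrow> h \<in> L2 M \<Longrightarrow>
    l2_inner M (\<lambda>x. f x + g x) h = l2_inner M f h + l2_inner M g h"
  by (simp add: l2_inner_def distrib_right L2_mult_integrable)

lemma l2_inner_diff_left:
  "f \<in> L2 M \<Longrightarrow> g \<in> L2 M \<Longrightarrow> h \<in> L2 M \<Longrightarrow>
    l2_inner M (\<lambda>x. f x - g x) h = l2_inner M f h - l2_inner M g h"
  by (simp add: l2_inner_def left_diff_distrib L2_mult_integrable)

lemma l2_inner_scale_left: "l2_inner M (\<lambda>x. c * f x) h = c * l2_inner M f h"
  by (simp add: l2_inner_def mult.assoc)

lemma l2_inner_add_right:
  "f \<in> L2 M \<Longrightarrow> g \<in> L2 M \<Longrightarrow> h \<in> L2 M \<Longrightarrow>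
    l2_inner M h (\<lambda>x. f x + g x) = l2_inner M h f + l2_inner M h g"
  by (simp add: l2_inner_commute [of M h] l2_inner_add_left)

lemma l2_inner_diff_right:
  "f \<in> L2 M \<Longrightarrow> g \<in> L2 M \<Longrightarrow> h \<in> L2 M \<Longrightarrow>
    l2_inner M h (\<lambda>x. f x - g x) = l2_inner M h f - l2_inner M h g"
  by (simp add: l2_inner_commute [of M h] l2_inner_diff_left)

lemma l2_inner_scale_right: "l2_inner M h (\<lambda>x. c * f x) = c * l2_inner M h f"
  by (simp add: l2_inner_commute [of M h] l2_inner_scale_left)

lemmas l2_inner_linear =
  l2_inner_add_left l2_inner_diff_left l2_inner_scale_left
  l2_inner_add_right l2_inner_diff_right l2_inner_scale_right
  L2_add L2_diff L2_scale

lemma l2_inner_self_nonneg [simp]: "0 \<le> l2_inner M f f"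
  by (simp add: l2_inner_def)

lemma l2_norm_nonneg [simp]: "0 \<le> l2_norm M f"
  by (simp add: l2_norm_def)

lemma l2_norm_power2: "(l2_norm M f)\<^sup>2 = l2_inner M f f"
  by (simp add: l2_norm_def)

lemma l2_inner_power2_le:
  assumes f: "f \<in> L2 M" and g: "g \<in> L2 M"
  shows "(l2_inner M f g)\<^sup>2 \<le> l2_inner M f f * l2_inner M g g"
proof (rule discriminant_le_zero)
  fix t
  have "0 \<le> l2_inner M (\<lambda>x. f x + t * g x) (\<lambda>x. f x + t * g x)"
    by simp
  also have "\<dots> = l2_inner M f f + 2 * t * l2_inner M f g + t\<^sup>2 * l2_inner M g g"
    using f g by (simp add: l2_inner_linear l2_inner_commute [of M g f] algebra_simps power2_eq_square)
  finally show "0 \<le> \<dots>" .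
qed simp

lemma l2_inner_abs_le:
  assumes "f \<in> L2 M" and "g \<in> L2 M"
  shows "\<bar>l2_inner M f g\<bar> \<le> l2_norm M f * l2_norm M g"
proof -
  have "\<bar>l2_inner M f g\<bar> = sqrt ((l2_inner M f g)\<^sup>2)"
    by simp
  also have "\<dots> \<le> sqrt (l2_inner M f f * l2_inner M g g)"
    by (rule real_sqrt_le_mono) (rule l2_inner_power2_le [OF assms])
  finally show ?thesis
    by (simp add: real_sqrt_mult l2_norm_def)
qed

lemma l2_norm_triangle:
  assumes f: "f \<in> L2 M" and g: "g \<in> L2 M"
  shows "l2_norm M (\<lambda>x. f x + g x) \<le> l2_norm M f + l2_norm M g"
proof (rule power2_le_imp_le)
  have "l2_inner M f g \<le> l2_norm M f * l2_norm M g"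
    using l2_inner_abs_le [OF f g] by simp
  then show "(l2_norm M (\<lambda>x. f x + g x))\<^sup>2 \<le> (l2_norm M f + l2_norm M g)\<^sup>2"
    using f g by (simp add: l2_norm_power2 power2_sum l2_inner_linear l2_inner_commute [of M g f])
qed simp

lemma l2_norm_scale: "l2_norm M (\<lambda>x. c * f x) = \<bar>c\<bar> * l2_norm M f"
  by (simp add: l2_norm_def l2_inner_scale_left l2_inner_scale_right real_sqrt_mult
      flip: power2_eq_square mult.assoc)

lemma l2_norm_uminus: "l2_norm M (\<lambda>x. - f x) = l2_norm M f"
  using l2_norm_scale [of M "- 1" f] by simp

lemma l2_norm_diff_commute: "l2_norm M (\<lambda>x. f x - g x) = l2_norm M (\<lambda>x. g x - f x)"
  using l2_norm_uminus [of M "\<lambda>x. f x - g x"] by simp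

lemma l2_norm_triangle3:
  assumes "f \<in> L2 M" and "g \<in> L2 M" and "h \<in> L2 M"
  shows "l2_norm M (\<lambda>x. f x - h x) \<le> l2_norm M (\<lambda>x. f x - g x) + l2_norm M (\<lambda>x. g x - h x)"
  using l2_norm_triangle [of "\<lambda>x. f x - g x" M "\<lambda>x. g x - h x"] assms by (simp add: L2_diff)

lemma l2_inner_self_eq_0_AE:
  assumes "f \<in> L2 M" and "l2_inner M f f = 0"
  shows "AE x in M. f x = 0"
proof -
  have "(LINT x|M. (f x)\<^sup>2) = 0"
    using assms(2) by (simp add: l2_inner_def power2_eq_square)
  then show ?thesis
    using integral_nonneg_eq_0_iff_AE [OF L2_square_integrable [OF assms(1)]] by simp
qed

lemma l2_inner_cong_AE:
  assumes [measurable]: "f \<in> borel_measurable M" "f' \<in> borel_measurable M" "g \<in> borel_measurable M"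
    and "AE x in M. f x = f' x"
  shows "l2_inner M f g = l2_inner M f' g"
  unfolding l2_inner_def by (rule integral_cong_AE) (use assms in auto)

lemma l2_inner_eq_0_left:
  assumes "f \<in> L2 M" and "g \<in> L2 M" and "l2_inner M f f = 0"
  shows "l2_inner M f g = 0"
  using l2_inner_power2_le [OF assms(1,2)] assms(3) by simp

text \<open>The difference h = f - g is orthogonal to \<open>D\<close>. Approximating h itself by d
  in \<open>D\<close> gives |h|^2 = (h, h - d) \<le> |h| \<epsilon>, hence |h| \<le>
  \<epsilon>.\<close>

lemma L2_eq_AE_dense:
  assumes f: "f \<in> L2 M" and g: "g \<in> L2 M" and D: "D \<subseteq> L2 M"
    and dense: "\<And>h \<epsilon>. h \<in> L2 M \<Longrightarrow> 0 < \<epsilon> \<Longrightarrow> \<exists>d\<in>D. l2_norm M (\<lambda>x. h x - d x) < \<epsilon>"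
    and eq: "\<And>d. d \<in> D \<Longrightarrow> l2_inner M f d = l2_inner M g d"
  shows "AE x in M. f x = g x"
proof -
  define h where "h = (\<lambda>x. f x - g x)"
  have h: "h \<in> L2 M"
    unfolding h_def using f g by (rule L2_diff)
  have "l2_norm M h \<le> \<epsilon>" if \<epsilon>: "0 < \<epsilon>" for \<epsilon>
  proof -
    obtain d where d: "d \<in> D" "l2_norm M (\<lambda>x. h x - d x) < \<epsilon>"
      using dense [OF h \<epsilon>] by blast
    then have dL: "d \<in> L2 M"
      using D by blast
    have "l2_inner M h d = 0"
      unfolding h_def using f g dL eq [OF d(1)] by (simp add: l2_inner_linear)
    then have "(l2_norm M h)\<^sup>2 = l2_inner M h (\<lambda>x. h x - d x)"
      using h dL by (simp add: l2_norm_power2 l2_inner_linear)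
    also have "\<dots> \<le> l2_norm M h * l2_norm M (\<lambda>x. h x - d x)"
      using l2_inner_abs_le [OF h L2_diff [OF h dL]] by simp
    also have "\<dots> \<le> l2_norm M h * \<epsilon>"
      using d(2) by (intro mult_left_mono) auto
    finally have "l2_norm M h * l2_norm M h \<le> l2_norm M h * \<epsilon>"
      by (simp add: power2_eq_square)
    then show ?thesis
      using \<epsilon> by (cases "l2_norm M h = 0") (auto simp: mult_le_cancel_left)
  qed
  then have "l2_norm M h \<le> 0"
    by (rule field_le_epsilon) simp
  then have "l2_inner M h h = 0"
    using l2_norm_nonneg [of M h] l2_norm_power2 [of M h] by simp
  from l2_inner_self_eq_0_AE [OF h this] show ?thesis
    by (simp add: h_def)
qed

section \<open>Spectral resolutions\<close>

locale resolution =
  fixes M :: "'a measure" and E :: "real \<Rightarrow> ('a \<Rightarrow> real) \<Rightarrow> ('a \<Rightarrow> real)"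
  assumes resolution: "resolution_of_identity M E"
begin

lemma projection: "orthogonal_projection M (E t)"
  using resolution by (simp add: resolution_of_identity_def)

lemma in_L2 [simp]: "f \<in> L2 M \<Longrightarrow> E t f \<in> L2 M"
  using projection by (simp add: orthogonal_projection_def)

lemma symmetric: "f \<in> L2 M \<Longrightarrow> g \<in> L2 M \<Longrightarrow> l2_inner M (E t f) g = l2_inner M f (E t g)"
  using projection by (simp add: orthogonal_projection_def)

text \<open>The almost-everywhere identity of the definition is recast as one between inner
  products. From here on everything is tested weakly; linearity of \<open>E t\<close> enters only by
  moving it to the other argument with \<open>symmetric\<close>.\<close>

lemma compose:
  assumes "s \<le> t" and "f \<in> L2 M" and "g \<in> L2 M"
  shows "l2_inner M (E s f) (E t g) = l2_inner M (E s f) g"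
proof -
  have "AE x in M. E s (E t g) x = E s g x"
    using resolution assms by (simp add: resolution_of_identity_def)
  then have "l2_inner M (E s (E t g)) f = l2_inner M (E s g) f"
    by (intro l2_inner_cong_AE L2_measurable) (use assms in simp_all)
  then show ?thesis
    using assms by (simp add: symmetric l2_inner_commute [of M f])
qed

lemma idempotent:
  "f \<in> L2 M \<Longrightarrow> g \<in> L2 M \<Longrightarrow> l2_inner M (E t f) (E t g) = l2_inner M (E t f) g"
  by (rule compose) simp_all

lemma apply_twice:
  "f \<in> L2 M \<Longrightarrow> g \<in> L2 M \<Longrightarrow> l2_inner M f (E t (E t g)) = l2_inner M f (E t g)"
  by (metis idempotent in_L2 symmetric)

lemma inner_diff_self:
  "f \<in> L2 M \<Longrightarrow> l2_inner M (\<lambda>x. f x - E t f x) (\<lambda>x. f x - E t f x) = l2_inner M f f - l2_inner M (E t f) f"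
  by (simp add: l2_inner_linear idempotent l2_inner_commute [of M f "E t f"])

lemma form_le: "f \<in> L2 M \<Longrightarrow> l2_inner M (E t f) f \<le> l2_inner M f f"
  using inner_diff_self [of f t] l2_inner_self_nonneg [of M "\<lambda>x. f x - E t f x"] by simp

lemma form_mono:
  assumes "s \<le> t" and f: "f \<in> L2 M"
  shows "l2_inner M (E s f) f \<le> l2_inner M (E t f) f"
proof -
  have "l2_inner M (\<lambda>x. E t f x - E s f x) (\<lambda>x. E t f x - E s f x) =
      l2_inner M (E t f) f - l2_inner M (E s f) f"
    using assms by (simp add: l2_inner_linear idempotent compose l2_inner_commute [of M "E t f" "E s f"])
  then show ?thesis
    using l2_inner_self_nonneg [of M "\<lambda>x. E t f x - E s f x"] by simp
qed

lemma form_right_continuous: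
  assumes f: "f \<in> L2 M"
  shows "continuous (at_right s) (\<lambda>t. l2_inner M (E t f) f)"
proof -
  have lim: "((\<lambda>t. l2_norm M (\<lambda>x. E t f x - E s f x) * l2_norm M f) \<longlongrightarrow> 0 * l2_norm M f) (at_right s)"
    by (intro tendsto_mult tendsto_const)
      (use resolution f in \<open>simp add: resolution_of_identity_def\<close>)
  have bound: "norm (l2_inner M (E t f) f - l2_inner M (E s f) f)
      \<le> l2_norm M (\<lambda>x. E t f x - E s f x) * l2_norm M f" for t
    using l2_inner_abs_le [of "\<lambda>x. E t f x - E s f x" M f] f by (simp add: l2_inner_linear)
  have "((\<lambda>t. l2_inner M (E t f) f - l2_inner M (E s f) f) \<longlongrightarrow> 0) (at_right s)"
    by (rule Lim_null_comparison [OF always_eventually [OF allI [OF bound]]]) (use lim in simp)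
  then show ?thesis
    by (simp add: continuous_within LIM_zero_iff)
qed

lemma form_at_bot:
  assumes f: "f \<in> L2 M"
  shows "((\<lambda>t. l2_inner M (E t f) f) \<longlongrightarrow> 0) at_bot"
proof -
  have "((\<lambda>t. (l2_norm M (E t f))\<^sup>2) \<longlongrightarrow> 0\<^sup>2) at_bot"
    by (intro tendsto_power) (use resolution f in \<open>simp add: resolution_of_identity_def\<close>)
  then show ?thesis
    using f by (simp add: l2_norm_power2 idempotent)
qed

lemma form_at_top:
  assumes f: "f \<in> L2 M"
  shows "((\<lambda>t. l2_inner M (E t f) f) \<longlongrightarrow> l2_inner M f f) at_top"
proof -
  have "((\<lambda>t. l2_inner M f f - (l2_norm M (\<lambda>x. E t f x - f x))\<^sup>2) \<longlongrightarrow> l2_inner M f f - 0\<^sup>2) at_top"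
    by (intro tendsto_power tendsto_diff tendsto_const)
      (use resolution f in \<open>simp add: resolution_of_identity_def\<close>)
  then show ?thesis
    using f by (simp add: l2_norm_diff_commute [of M _ f] l2_norm_power2 inner_diff_self)
qed

lemma sets_distribution [simp, measurable_cong]: "sets (spectral_distribution M E f) = sets borel"
  and space_distribution [simp]: "space (spectral_distribution M E f) = UNIV"
  by (simp_all add: spectral_distribution_def)

text \<open>For f in L2 the form \<open>l2_inner M (E t f) f\<close> is increasing and
  right-continuous with limits 0 and \<open>l2_inner M f f\<close>, hence the distribution function
  of a finite measure. Below, masses of half-lines are read off from it.\<close>

lemma
  assumes f: "f \<in> L2 M"
  shows emeasure_distribution_UNIV: "emeasure (spectral_distribution M E f) UNIV = ennreal (l2_inner M f f)"
    and emeasure_distribution_atMost: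
      "emeasure (spectral_distribution M E f) {..t} = ennreal (l2_inner M (E t f) f)"
    and finite_distribution: "finite_measure (spectral_distribution M E f)"
proof -
  note hyps = form_mono [OF _ f] form_right_continuous [OF f] form_at_bot [OF f]
  show *: "emeasure (spectral_distribution M E f) UNIV = ennreal (l2_inner M f f)"
    unfolding spectral_distribution_def
    by (rule interval_measure_UNIV [OF hyps form_at_top [OF f]]) auto
  show "emeasure (spectral_distribution M E f) {..t} = ennreal (l2_inner M (E t f) f)"
    unfolding spectral_distribution_def
    by (rule emeasure_interval_measure_Iic [OF hyps]) auto
  show "finite_measure (spectral_distribution M E f)"
    by (rule finite_measureI) (simp add: *)
qed

lemma measure_distribution_UNIV:
  "f \<in> L2 M \<Longrightarrow> measure (spectral_distribution M E f) UNIV = l2_inner M f f"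
  by (simp add: measure_def emeasure_distribution_UNIV)

lemma emeasure_distribution_greaterThan:
  assumes f: "f \<in> L2 M"
  shows "emeasure (spectral_distribution M E f) {t<..} = ennreal (l2_inner M f f - l2_inner M (E t f) f)"
proof -
  interpret finite_measure "spectral_distribution M E f"
    by (rule finite_distribution [OF f])
  have "0 \<le> l2_inner M (E t f) f"
    using idempotent [OF f f, of t] l2_inner_self_nonneg [of M "E t f"] by simp
  moreover have "UNIV - {..t} = {t<..}"
    by auto
  ultimately show ?thesis
    using emeasure_compl [of "{..t}" "spectral_distribution M E f"] f
    by (simp add: emeasure_distribution_UNIV emeasure_distribution_atMost ennreal_minus)
qed

text \<open>The fixed space is described weakly, because \<open>E s f\<close> and f agree only up to
  null sets; sums then stay inside by symmetry of \<open>E s\<close> alone.\<close>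

definition ran :: "real \<Rightarrow> ('a \<Rightarrow> real) set" where
  "ran s = {f \<in> L2 M. \<forall>g\<in>L2 M. l2_inner M (E s f) g = l2_inner M f g}"

definition ker :: "real \<Rightarrow> ('a \<Rightarrow> real) set" where
  "ker s = {f \<in> L2 M. \<forall>g\<in>L2 M. l2_inner M (E s f) g = 0}"

lemma ran_add: "f \<in> ran s \<Longrightarrow> g \<in> ran s \<Longrightarrow> (\<lambda>x. f x + g x) \<in> ran s"
  by (auto simp: ran_def symmetric l2_inner_linear)

lemma ker_add: "f \<in> ker s \<Longrightarrow> g \<in> ker s \<Longrightarrow> (\<lambda>x. f x + g x) \<in> ker s"
  by (auto simp: ker_def symmetric l2_inner_linear)

lemma zero_ran: "(\<lambda>x. 0) \<in> ran s"
  by (auto simp: ran_def symmetric)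

lemma zero_ker: "(\<lambda>x. 0) \<in> ker s"
  by (auto simp: ker_def symmetric)

lemma apply_in_ran: "f \<in> L2 M \<Longrightarrow> E s f \<in> ran s"
  by (auto simp: ran_def symmetric apply_twice)

lemma diff_in_ker: "f \<in> L2 M \<Longrightarrow> (\<lambda>x. f x - E s f x) \<in> ker s"
  by (auto simp: ker_def symmetric l2_inner_linear apply_twice)

lemma form_ran:
  assumes "f \<in> ran s" and "s \<le> t"
  shows "l2_inner M (E t f) f = l2_inner M f f"
proof (rule antisym)
  have f: "f \<in> L2 M"
    using assms(1) by (simp add: ran_def)
  show "l2_inner M (E t f) f \<le> l2_inner M f f"
    by (rule form_le [OF f])
  show "l2_inner M f f \<le> l2_inner M (E t f) f"
    using form_mono [OF assms(2) f] assms(1) f by (simp add: ran_def)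
qed

lemma form_ker:
  assumes "f \<in> ker s" and "t \<le> s"
  shows "l2_inner M (E t f) f = 0"
proof (rule antisym)
  have f: "f \<in> L2 M"
    using assms(1) by (simp add: ker_def)
  show "l2_inner M (E t f) f \<le> 0"
    using form_mono [OF assms(2) f] assms(1) f by (simp add: ker_def)
  show "0 \<le> l2_inner M (E t f) f"
    using idempotent [OF f f, of t] l2_inner_self_nonneg [of M "E t f"] by simp
qed

lemma inner_ran_ker_0:
  assumes "f \<in> ran s" and "h \<in> ker s"
  shows "l2_inner M f h = 0"
proof -
  have "l2_inner M f h = l2_inner M (E s f) h"
    using assms by (auto simp: ran_def ker_def)
  also have "\<dots> = l2_inner M (E s h) f"
    using assms by (auto simp: ran_def ker_def symmetric l2_inner_commute [of M f])
  finally show ?thesis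
    using assms by (auto simp: ran_def ker_def)
qed

text \<open>For t \<le> s, \<open>E t\<close> factors through \<open>E s\<close> and annihilates h;
  for t > s it fixes f, which is orthogonal to h. The mixed form thus vanishes for every t, the
  input for showing that A is block diagonal.\<close>

lemma form_ran_ker_0:
  assumes f: "f \<in> ran s" and h: "h \<in> ker s"
  shows "l2_inner M (E t f) h = 0"
proof -
  have L: "f \<in> L2 M" "h \<in> L2 M"
    using f h by (auto simp: ran_def ker_def)
  show ?thesis
  proof (cases "t \<le> s")
    case True
    have "l2_inner M (E t f) h = l2_inner M (E t f) (E s h)"
      using compose [OF True L] by simp
    also have "\<dots> = 0"
      using h L by (simp add: ker_def l2_inner_commute [of M "E t f"])
    finally show ?thesis .
  next
    case False
    then have "l2_inner M (E s f) (E t h) = l2_inner M (E s f) h"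
      using compose [of s t] L by simp
    then have "l2_inner M f (E t h) = l2_inner M f h"
      using f L by (simp add: ran_def)
    then show ?thesis
      using inner_ran_ker_0 [OF f h] L by (simp add: symmetric)
  qed
qed

text \<open>The distribution of f has no mass beyond s, and its total mass is
  \<open>l2_inner M f f\<close>.\<close>

lemma integral_ran_le:
  assumes f: "f \<in> ran s" and int: "integrable (spectral_distribution M E f) (\<lambda>t. t)"
  shows "(LINT t|spectral_distribution M E f. t) \<le> s * l2_inner M f f"
proof -
  have fL: "f \<in> L2 M"
    using f by (simp add: ran_def)
  interpret finite_measure "spectral_distribution M E f"
    by (rule finite_distribution [OF fL])
  have "emeasure (spectral_distribution M E f) {s<..} = 0"
    using form_ran [OF f order_refl] by (simp add: emeasure_distribution_greaterThan [OF fL])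
  then have "AE t in spectral_distribution M E f. t \<le> s"
    by (intro AE_I [of _ _ "{s<..}"]) auto
  then have "(LINT t|spectral_distribution M E f. t) \<le> (LINT t|spectral_distribution M E f. s)"
    by (intro integral_mono_AE int) auto
  then show ?thesis
    by (simp add: measure_distribution_UNIV [OF fL] mult.commute)
qed

lemma integral_ker_ge:
  assumes f: "f \<in> ker s" and int: "integrable (spectral_distribution M E f) (\<lambda>t. t)"
  shows "s * l2_inner M f f \<le> (LINT t|spectral_distribution M E f. t)"
proof -
  have fL: "f \<in> L2 M"
    using f by (simp add: ker_def)
  interpret finite_measure "spectral_distribution M E f"
    by (rule finite_distribution [OF fL])
  have "emeasure (spectral_distribution M E f) {..s} = 0"
    using form_ker [OF f order_refl] by (simp add: emeasure_distribution_atMost [OF fL])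
  then have "AE t in spectral_distribution M E f. s \<le> t"
    by (intro AE_I [of _ _ "{..s}"]) auto
  then have "(LINT t|spectral_distribution M E f. s) \<le> (LINT t|spectral_distribution M E f. t)"
    by (intro integral_mono_AE int) auto
  then show ?thesis
    by (simp add: measure_distribution_UNIV [OF fL] mult.commute)
qed

end

section \<open>Powers of a nonnegative operator on its spectral subspaces\<close>

locale nonneg_spectral_resolution = resolution M E for M :: "'a measure" and E +
  fixes A :: "('a \<Rightarrow> real) \<Rightarrow> 'a \<Rightarrow> real"
  assumes spectral: "is_spectral_resolution_of M A E"
    and nonneg: "f \<in> L2 M \<Longrightarrow> 0 \<le> l2_inner M (A f) f"
begin

lemma A_in_L2 [simp]: "f \<in> L2 M \<Longrightarrow> A f \<in> L2 M"
  using spectral by (simp add: is_spectral_resolution_of_def spectral_integral_def)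

lemma integrable_distribution:
  assumes f: "f \<in> L2 M"
  shows "integrable (spectral_distribution M E f) (\<lambda>t. t)"
proof -
  interpret finite_measure "spectral_distribution M E f"
    by (rule finite_distribution [OF f])
  show ?thesis
    by (rule square_integrable_imp_integrable)
      (use spectral f in \<open>auto simp: is_spectral_resolution_of_def spectral_integral_def spectral_domain_def\<close>)
qed

lemma polarization:
  assumes "f \<in> L2 M" and "h \<in> L2 M"
  shows "l2_inner M (A f) h =
      ((LINT t|spectral_distribution M E (\<lambda>x. f x + h x). t) -
       (LINT t|spectral_distribution M E (\<lambda>x. f x - h x). t)) / 4"
proof -
  have "h \<in> spectral_domain M E (\<lambda>t. t)"
    using spectral assms by (simp add: is_spectral_resolution_of_def spectral_integral_def)
  then show ?thesis
    using spectral assms by (simp add: is_spectral_resolution_of_def spectral_integral_def)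
qed

text \<open>The polarized expression is symmetric in f and h: distributions depend on a quadratic
  form, so f - h and h - f have the same one.\<close>

lemma A_symmetric:
  assumes f: "f \<in> L2 M" and h: "h \<in> L2 M"
  shows "l2_inner M (A f) h = l2_inner M f (A h)"
proof -
  have "l2_inner M (E t (\<lambda>x. f x - h x)) (\<lambda>x. f x - h x) = l2_inner M (E t (\<lambda>x. h x - f x)) (\<lambda>x. h x - f x)" for t
    using f h by (simp add: l2_inner_linear symmetric)
  then have "spectral_distribution M E (\<lambda>x. f x - h x) = spectral_distribution M E (\<lambda>x. h x - f x)"
    by (simp add: spectral_distribution_def)
  moreover have "(\<lambda>x. f x + h x) = (\<lambda>x. h x + f x)"
    by (simp add: add.commute)
  ultimately have "l2_inner M (A f) h = l2_inner M (A h) f"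
    using f h by (simp add: polarization)
  then show ?thesis
    by (simp add: l2_inner_commute)
qed

text \<open>The zero function lies in both range and kernel, so the two bounds meet. It occurs as f
  - f when polarization is applied with h = f; the remaining term f + f accounts for the factor 4 in
  the form bounds below.\<close>

lemma integral_distribution_zero: "(LINT t|spectral_distribution M E (\<lambda>x. 0). t) = 0"
  using integral_ran_le [OF zero_ran integrable_distribution, of 0]
    integral_ker_ge [OF zero_ker integrable_distribution, of 0] by simp

lemma A_form_ran_le:
  assumes f: "f \<in> ran s"
  shows "l2_inner M (A f) f \<le> s * l2_inner M f f"
proof -
  have fL: "f \<in> L2 M"
    using f by (simp add: ran_def)
  have "4 * l2_inner M (A f) f = (LINT t|spectral_distribution M E (\<lambda>x. f x + f x). t)"
    using fL by (simp add: polarization integral_distribution_zero)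
  also have "\<dots> \<le> s * l2_inner M (\<lambda>x. f x + f x) (\<lambda>x. f x + f x)"
    using fL by (intro integral_ran_le ran_add f integrable_distribution L2_add)
  finally show ?thesis
    using fL by (simp add: l2_inner_linear)
qed

lemma A_form_ker_ge:
  assumes f: "f \<in> ker s"
  shows "s * l2_inner M f f \<le> l2_inner M (A f) f"
proof -
  have fL: "f \<in> L2 M"
    using f by (simp add: ker_def)
  have "s * l2_inner M (\<lambda>x. f x + f x) (\<lambda>x. f x + f x) \<le> (LINT t|spectral_distribution M E (\<lambda>x. f x + f x). t)"
    using fL by (intro integral_ker_ge ker_add f integrable_distribution L2_add)
  also have "\<dots> = 4 * l2_inner M (A f) f"
    using fL by (simp add: polarization integral_distribution_zero)
  finally show ?thesis
    using fL by (simp add: l2_inner_linear)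
qed

text \<open>All mixed terms vanish, so f + h and f - h have the same distribution and the polarized
  difference is 0. Consequently A preserves both range and kernel.\<close>

lemma A_ran_ker_0:
  assumes f: "f \<in> ran s" and h: "h \<in> ker s"
  shows "l2_inner M (A f) h = 0"
proof -
  have L: "f \<in> L2 M" "h \<in> L2 M"
    using f h by (auto simp: ran_def ker_def)
  have "l2_inner M (E t h) f = 0" for t
    using form_ran_ker_0 [OF f h, of t] L by (simp add: symmetric l2_inner_commute [of M f])
  then have "l2_inner M (E t (\<lambda>x. f x + h x)) (\<lambda>x. f x + h x) = l2_inner M (E t (\<lambda>x. f x - h x)) (\<lambda>x. f x - h x)" for t
    using form_ran_ker_0 [OF f h, of t] L by (simp add: l2_inner_linear symmetric)
  then have "spectral_distribution M E (\<lambda>x. f x + h x) = spectral_distribution M E (\<lambda>x. f x - h x)"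
    by (simp add: spectral_distribution_def)
  then show ?thesis
    using L by (simp add: polarization)
qed

lemma A_ran: "f \<in> ran s \<Longrightarrow> A f \<in> ran s"
proof -
  assume f: "f \<in> ran s"
  then have fL: "f \<in> L2 M"
    by (simp add: ran_def)
  have "l2_inner M (E s (A f)) g = l2_inner M (A f) g" if g: "g \<in> L2 M" for g
    using A_ran_ker_0 [OF f diff_in_ker [OF g]] fL g by (simp add: l2_inner_linear symmetric)
  then show ?thesis
    using fL by (simp add: ran_def)
qed

lemma A_ker: "f \<in> ker s \<Longrightarrow> A f \<in> ker s"
proof -
  assume f: "f \<in> ker s"
  then have fL: "f \<in> L2 M"
    by (simp add: ker_def)
  have "l2_inner M (E s (A f)) g = 0" if g: "g \<in> L2 M" for g
    using A_ran_ker_0 [OF apply_in_ran [OF g] f] fL g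
    by (simp add: symmetric A_symmetric l2_inner_commute [of M "E s g"])
  then show ?thesis
    using fL by (simp add: ker_def)
qed

text \<open>Cauchy-Schwarz for the semidefinite form (A f, g), applied to f and A f, gives |A f|^4
  \<le> (A f, f) (A A f, A f) \<le> s |f|^2 s |A f|^2, since A f stays in the range; one factor |A
  f|^2 cancels. This is where nonnegativity of A is essential: a bound on the form from above alone
  would not bound the norm.\<close>

lemma A_norm_ran_le:
  assumes f: "f \<in> ran s"
  shows "l2_inner M (A f) (A f) \<le> s\<^sup>2 * l2_inner M f f"
proof (cases "l2_inner M (A f) (A f) = 0")
  case False
  define N where "N = l2_inner M (A f) (A f)"
  have N: "0 < N"
    using False l2_inner_self_nonneg [of M "A f"] unfolding N_def by linarith
  have fL: "f \<in> L2 M"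
    using f by (simp add: ran_def)
  have "N\<^sup>2 \<le> l2_inner M (A f) f * l2_inner M (A (A f)) (A f)"
  proof (rule discriminant_le_zero)
    fix t
    let ?g = "\<lambda>x. f x + t * A f x"
    have "0 \<le> l2_inner M (A ?g) ?g"
      using fL by (intro nonneg L2_add L2_scale) simp_all
    also have "l2_inner M (A ?g) ?g = l2_inner M (A ?g) f + t * l2_inner M (A ?g) (A f)"
      using fL by (simp add: l2_inner_linear)
    also have "l2_inner M (A ?g) h = l2_inner M (A f) h + t * l2_inner M (A (A f)) h" if "h \<in> L2 M" for h
      using fL that by (simp add: A_symmetric l2_inner_linear)
    then have "l2_inner M (A ?g) f + t * l2_inner M (A ?g) (A f) =
        l2_inner M (A f) f + 2 * t * N + t\<^sup>2 * l2_inner M (A (A f)) (A f)"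
      using fL A_symmetric [of "A f" f] by (simp add: N_def algebra_simps power2_eq_square)
    finally show "0 \<le> \<dots>" .
  qed (use fL nonneg in simp)
  also have "\<dots> \<le> (s * l2_inner M f f) * (s * N)"
    unfolding N_def
    by (intro mult_mono A_form_ran_le A_ran f nonneg order_trans [OF nonneg A_form_ran_le [OF f]])
      (use fL in simp_all)
  finally have "N * N \<le> (s\<^sup>2 * l2_inner M f f) * N"
    by (simp add: power2_eq_square algebra_simps)
  then show ?thesis
    using N by (simp add: N_def)
qed simp

text \<open>Ordinary Cauchy-Schwarz suffices in this direction: s |f|^2 \<le> (A f, f) \<le> |A f|
  |f|.\<close>

lemma A_norm_ker_ge:
  assumes f: "f \<in> ker s" and "0 \<le> s"
  shows "s\<^sup>2 * l2_inner M f f \<le> l2_inner M (A f) (A f)"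
proof (cases "l2_inner M f f = 0")
  case False
  then have N: "0 < l2_inner M f f"
    using l2_inner_self_nonneg [of M f] by linarith
  have fL: "f \<in> L2 M"
    using f by (simp add: ker_def)
  have "(s * l2_inner M f f)\<^sup>2 \<le> (l2_inner M (A f) f)\<^sup>2"
    using assms by (intro power_mono A_form_ker_ge) auto
  also have "\<dots> \<le> l2_inner M (A f) (A f) * l2_inner M f f"
    using fL by (intro l2_inner_power2_le) simp_all
  finally have "(s\<^sup>2 * l2_inner M f f) * l2_inner M f f \<le> l2_inner M (A f) (A f) * l2_inner M f f"
    by (simp add: power2_eq_square algebra_simps)
  then show ?thesis
    using N by simp
qed simp

lemma A_power_ran: "f \<in> ran s \<Longrightarrow> (A ^^ n) f \<in> ran s"
  by (induction n) (auto intro: A_ran)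

lemma A_power_ker: "f \<in> ker s \<Longrightarrow> (A ^^ n) f \<in> ker s"
  by (induction n) (auto intro: A_ker)

lemma A_power_L2 [simp]: "f \<in> L2 M \<Longrightarrow> (A ^^ n) f \<in> L2 M"
  by (induction n) auto

lemma A_power_symmetric:
  "f \<in> L2 M \<Longrightarrow> h \<in> L2 M \<Longrightarrow> l2_inner M ((A ^^ n) f) h = l2_inner M f ((A ^^ n) h)"
proof (induction n arbitrary: h)
  case (Suc n)
  then have "l2_inner M ((A ^^ Suc n) f) h = l2_inner M f ((A ^^ n) (A h))"
    by (simp add: A_symmetric)
  then show ?case
    by (simp add: funpow_swap1)
qed simp

lemma A_power_norm_ran_le:
  assumes "f \<in> ran s"
  shows "l2_inner M ((A ^^ n) f) ((A ^^ n) f) \<le> (s\<^sup>2) ^ n * l2_inner M f f"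
proof (induction n)
  case (Suc n)
  have "l2_inner M ((A ^^ Suc n) f) ((A ^^ Suc n) f) \<le> s\<^sup>2 * l2_inner M ((A ^^ n) f) ((A ^^ n) f)"
    using A_norm_ran_le [OF A_power_ran [OF assms]] by simp
  also have "\<dots> \<le> s\<^sup>2 * ((s\<^sup>2) ^ n * l2_inner M f f)"
    by (intro mult_left_mono Suc) simp
  finally show ?case
    by (simp add: mult.assoc)
qed simp

lemma A_power_norm_ker_ge:
  assumes "f \<in> ker s" and "0 \<le> s"
  shows "(s\<^sup>2) ^ n * l2_inner M f f \<le> l2_inner M ((A ^^ n) f) ((A ^^ n) f)"
proof (induction n)
  case (Suc n)
  have "s\<^sup>2 * ((s\<^sup>2) ^ n * l2_inner M f f) \<le> s\<^sup>2 * l2_inner M ((A ^^ n) f) ((A ^^ n) f)"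
    by (intro mult_left_mono Suc) simp
  also have "\<dots> \<le> l2_inner M ((A ^^ Suc n) f) ((A ^^ Suc n) f)"
    using A_norm_ker_ge [OF A_power_ker [OF assms(1)] assms(2)] by simp
  finally show ?case
    by (simp add: mult.assoc)
qed simp

text \<open>\<open>A\<close> commutes with the projection \<open>I - E t\<close>, so this projection does not increase the norm of
  \<open>(A ^^ n) f\<close>.\<close>

lemma A_power_norm_diff_le:
  fixes f t
  assumes f: "f \<in> L2 M"
  defines "g \<equiv> \<lambda>x. f x - E t f x"
  shows "l2_inner M ((A ^^ n) g) ((A ^^ n) g) \<le> l2_inner M ((A ^^ n) f) ((A ^^ n) f)"
proof -
  have g: "g \<in> ker t"
    unfolding g_def by (rule diff_in_ker [OF f])
  then have gL: "g \<in> L2 M"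
    by (simp add: ker_def)
  define X where "X = l2_inner M ((A ^^ n) g) ((A ^^ n) g)"
  have "l2_inner M ((A ^^ n) f) ((A ^^ n) g) = l2_inner M f ((A ^^ n) ((A ^^ n) g))"
    using f gL by (simp add: A_power_symmetric)
  also have "f = (\<lambda>x. g x + E t f x)"
    by (simp add: g_def)
  then have "l2_inner M f ((A ^^ n) ((A ^^ n) g)) = l2_inner M (\<lambda>x. g x + E t f x) ((A ^^ n) ((A ^^ n) g))"
    by simp
  also have "\<dots> = X + l2_inner M ((A ^^ n) (E t f)) ((A ^^ n) g)"
    using f gL by (simp add: X_def A_power_symmetric l2_inner_linear)
  \<comment> \<open>Powers of A keep \<open>E t f\<close> in the range and g in the kernel of
    \<open>E t\<close>, and these are orthogonal.\<close>
  also have "l2_inner M ((A ^^ n) (E t f)) ((A ^^ n) g) = 0"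
    by (intro inner_ran_ker_0 [of _ t] A_power_ran A_power_ker apply_in_ran f g)
  finally have "X\<^sup>2 = (l2_inner M ((A ^^ n) f) ((A ^^ n) g))\<^sup>2"
    by simp
  also have "\<dots> \<le> l2_inner M ((A ^^ n) f) ((A ^^ n) f) * X"
    unfolding X_def using f gL by (intro l2_inner_power2_le) simp_all
  finally have *: "X * X \<le> l2_inner M ((A ^^ n) f) ((A ^^ n) f) * X"
    by (simp add: power2_eq_square)
  have "0 \<le> X"
    by (simp add: X_def)
  then have "X \<le> l2_inner M ((A ^^ n) f) ((A ^^ n) f)"
    using * by (cases "X = 0") auto
  then show ?thesis
    by (simp add: X_def)
qed

end

text \<open>The range of \<open>E s\<close> consists of those \<open>f\<close> for which \<open>(A ^^ n) f\<close> grows at most like \<open>s ^ n\<close>, a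
  condition that does not mention \<open>E\<close>.\<close>

lemma spectral_projection_range_subset:
  assumes E: "nonneg_spectral_resolution M E A" and E': "nonneg_spectral_resolution M E' A"
    and f: "f \<in> resolution.ran M E s"
  shows "f \<in> resolution.ran M E' s"
proof -
  interpret E: nonneg_spectral_resolution M E A by fact
  interpret E': nonneg_spectral_resolution M E' A by fact
  have fL: "f \<in> L2 M"
    using f by (simp add: E.ran_def)
  have zero: "l2_inner M (\<lambda>x. f x - E' t f x) (\<lambda>x. f x - E' t f x) = 0" if s: "0 \<le> s" and t: "s < t" for t
  proof -
    define g where "g = (\<lambda>x. f x - E' t f x)"
    have g: "g \<in> E'.ker t"
      unfolding g_def by (rule E'.diff_in_ker [OF fL])
    \<comment> \<open>On the kernel of \<open>E' t\<close> the powers grow at least like t^n, on the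
      range of \<open>E s\<close> at most like s^n. Strict inequality s < t makes the quotient tend
      to 0.\<close>
    have "l2_inner M g g \<le> (s\<^sup>2 / t\<^sup>2) ^ n * l2_inner M f f" for n
    proof -
      have "(t\<^sup>2) ^ n * l2_inner M g g \<le> l2_inner M ((A ^^ n) g) ((A ^^ n) g)"
        using s t by (intro E'.A_power_norm_ker_ge g) simp
      also have "\<dots> \<le> l2_inner M ((A ^^ n) f) ((A ^^ n) f)"
        unfolding g_def by (rule E'.A_power_norm_diff_le [OF fL])
      also have "\<dots> \<le> (s\<^sup>2) ^ n * l2_inner M f f"
        by (rule E.A_power_norm_ran_le [OF f])
      finally show ?thesis
        using s t by (simp add: power_divide field_simps)
    qed
    moreover have "(\<lambda>n. (s\<^sup>2 / t\<^sup>2) ^ n * l2_inner M f f) \<longlonglongrightarrow> 0 * l2_inner M f f"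
      using s t by (intro tendsto_mult tendsto_const LIMSEQ_realpow_zero) (auto simp: power_strict_mono)
    ultimately have "l2_inner M g g \<le> 0"
      by (intro LIMSEQ_le_const) auto
    then show ?thesis
      using l2_inner_self_nonneg [of M g] unfolding g_def by linarith
  qed
  have "l2_inner M (E' s f) h = l2_inner M f h" if h: "h \<in> L2 M" for h
  proof (cases "0 \<le> s")
    case True
    \<comment> \<open>Only levels t > s have been treated; right-continuity of \<open>E'\<close>
      brings the identity down to s.\<close>
    have "eventually (\<lambda>t. l2_inner M (E' t f) f = l2_inner M f f) (at_right s)"
      using zero [OF True] fL by (auto simp: E'.inner_diff_self eventually_at_filter)
    then have "((\<lambda>t. l2_inner M (E' t f) f) \<longlongrightarrow> l2_inner M f f) (at_right s)"
      by (rule tendsto_eventually)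
    moreover have "((\<lambda>t. l2_inner M (E' t f) f) \<longlongrightarrow> l2_inner M (E' s f) f) (at_right s)"
      using E'.form_right_continuous [OF fL, of s] by (simp add: continuous_within)
    ultimately have "l2_inner M (E' s f) f = l2_inner M f f"
      by (intro tendsto_unique [OF trivial_limit_at_right_real])
    then have "l2_inner M (\<lambda>x. f x - E' s f x) (\<lambda>x. f x - E' s f x) = 0"
      using fL by (simp add: E'.inner_diff_self)
    then have "l2_inner M (\<lambda>x. f x - E' s f x) h = 0"
      using fL h l2_inner_eq_0_left [OF L2_diff [OF fL E'.in_L2 [OF fL]] h] by blast
    then show ?thesis
      using fL h by (simp add: l2_inner_linear)
  next
    case False
    \<comment> \<open>Below 0 the range is trivial, because A is nonnegative.\<close>
    have "0 \<le> s * l2_inner M f f"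
      using E.A_form_ran_le [OF f] E.nonneg [OF fL] by simp
    then have "l2_inner M f f = 0"
      using False l2_inner_self_nonneg [of M f] by (simp add: zero_le_mult_iff)
    then show ?thesis
      using fL h l2_inner_eq_0_left [OF fL] by (simp add: E'.symmetric)
  qed
  then show ?thesis
    using fL by (simp add: E'.ran_def)
qed

text \<open>Symmetric projections with the same range coincide: E = E' E and E' = E E', and the
  adjoint of E' E is E E'.\<close>

lemma spectral_projection_unique:
  assumes E: "nonneg_spectral_resolution M E A" and E': "nonneg_spectral_resolution M E' A"
    and f: "f \<in> L2 M" and g: "g \<in> L2 M"
  shows "l2_inner M (E s f) g = l2_inner M (E' s f) g"
proof -
  interpret E: nonneg_spectral_resolution M E A by fact
  interpret E': nonneg_spectral_resolution M E' A by fact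
  have "l2_inner M (E s f) g = l2_inner M (E' s (E s f)) g"
    using spectral_projection_range_subset [OF E E' E.apply_in_ran [OF f]] g by (simp add: E'.ran_def)
  also have "\<dots> = l2_inner M (E s (E' s g)) f"
    using f g by (simp add: E.symmetric E'.symmetric l2_inner_commute [of M "E s (E' s g)"])
  also have "\<dots> = l2_inner M (E' s g) f"
    using spectral_projection_range_subset [OF E' E E'.apply_in_ran [OF g]] f by (simp add: E.ran_def)
  finally show ?thesis
    using f g by (simp add: E'.symmetric l2_inner_commute [of M "E' s g"])
qed

section \<open>Transfer of the functional calculus to an explicit resolution\<close>

lemma spectral_distribution_unique:
  assumes "nonneg_spectral_resolution M E A" and "nonneg_spectral_resolution M E' A" and "f \<in> L2 M"
  shows "spectral_distribution M E f = spectral_distribution M E' f"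
proof -
  have "l2_inner M (E t f) f = l2_inner M (E' t f) f" for t
    by (rule spectral_projection_unique [OF assms(1,2,3,3)])
  then show ?thesis
    by (simp only: spectral_distribution_def)
qed

lemma spectral_domain_unique:
  assumes "nonneg_spectral_resolution M E A" and "nonneg_spectral_resolution M E' A"
  shows "spectral_domain M E \<phi> = spectral_domain M E' \<phi>"
proof -
  have "f \<in> spectral_domain M E \<phi> \<longleftrightarrow> f \<in> spectral_domain M E' \<phi>" for f
  proof (cases "f \<in> L2 M")
    case True
    show ?thesis
      unfolding spectral_domain_def mem_Collect_eq spectral_distribution_unique [OF assms True] ..
  qed (simp add: spectral_domain_def)
  then show ?thesis
    by blast
qed

lemma spectral_integral_unique:
  assumes "nonneg_spectral_resolution M E A" and "nonneg_spectral_resolution M E' A"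
  shows "spectral_integral M E \<phi> f g \<longleftrightarrow> spectral_integral M E' \<phi> f g"
proof -
  have L: "spectral_domain M E' \<phi> \<subseteq> L2 M"
    by (auto simp: spectral_domain_def)
  have *: "spectral_distribution M E (\<lambda>x. f x + h x) = spectral_distribution M E' (\<lambda>x. f x + h x)"
      "spectral_distribution M E (\<lambda>x. f x - h x) = spectral_distribution M E' (\<lambda>x. f x - h x)"
    if "f \<in> spectral_domain M E' \<phi>" "h \<in> spectral_domain M E' \<phi>" for h
    using that L by (auto intro!: spectral_distribution_unique [OF assms])
  show ?thesis
    unfolding spectral_integral_def spectral_domain_unique [OF assms] using * by auto
qed

text \<open>Any explicit resolution of A witnesses that the choice in
  \<open>spectral_resolution\<close> is made from a nonempty set.\<close>

lemma nonneg_spectral_resolution_spectral_resolution: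
  assumes "nonneg_spectral_resolution M E A"
  shows "nonneg_spectral_resolution M (spectral_resolution M A) A"
proof -
  interpret nonneg_spectral_resolution M E A by fact
  have "is_spectral_resolution_of M A (spectral_resolution M A)"
    unfolding spectral_resolution_def by (rule someI [of "is_spectral_resolution_of M A", OF spectral])
  then show ?thesis
    by unfold_locales (auto simp: is_spectral_resolution_of_def nonneg)
qed

lemma calculus_domain_eq:
  assumes "nonneg_spectral_resolution M E A"
  shows "calculus_domain M \<phi> A = spectral_domain M E \<phi>"
  unfolding calculus_domain_def
  by (rule spectral_domain_unique [OF nonneg_spectral_resolution_spectral_resolution [OF assms] assms])

text \<open>Two admissible images of f have the same pairings with the domain, in particular with
  the dense set \<open>D\<close>. This is as much as can be said of the chosen value, which is fixed
  only up to null sets.\<close>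

lemma calculus_op_AE_eq:
  assumes E: "nonneg_spectral_resolution M E A"
    and g: "spectral_integral M E \<phi> f g"
    and D: "D \<subseteq> spectral_domain M E \<phi>"
    and dense: "\<And>h \<epsilon>. h \<in> L2 M \<Longrightarrow> 0 < \<epsilon> \<Longrightarrow> \<exists>d\<in>D. l2_norm M (\<lambda>x. h x - d x) < \<epsilon>"
  shows "AE x in M. calculus_op M \<phi> A f x = g x"
proof -
  have iff: "spectral_integral M (spectral_resolution M A) \<phi> f g' \<longleftrightarrow> spectral_integral M E \<phi> f g'" for g'
    by (rule spectral_integral_unique [OF nonneg_spectral_resolution_spectral_resolution [OF E] E])
  have op: "spectral_integral M E \<phi> f (calculus_op M \<phi> A f)"
    unfolding calculus_op_def iff by (rule someI [of "spectral_integral M E \<phi> f", OF g])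
  show ?thesis
  proof (rule L2_eq_AE_dense [OF _ _ _ dense])
    show "calculus_op M \<phi> A f \<in> L2 M" "g \<in> L2 M"
      using op g by (auto simp: spectral_integral_def)
    show "D \<subseteq> L2 M"
      using D by (auto simp: spectral_domain_def)
    show "l2_inner M (calculus_op M \<phi> A f) d = l2_inner M g d" if "d \<in> D" for d
    proof -
      have d: "d \<in> spectral_domain M E \<phi>"
        using D that by blast
      have "l2_inner M g' d =
          ((LINT t|spectral_distribution M E (\<lambda>x. f x + d x). \<phi> t) -
           (LINT t|spectral_distribution M E (\<lambda>x. f x - d x). \<phi> t)) / 4"
        if "spectral_integral M E \<phi> f g'" for g'
        using that d unfolding spectral_integral_def by blast
      from this [OF op] this [OF g] show ?thesis
        by simp
    qed
  qed
qed

section \<open>Integrals of square-integrable functions\<close>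

definition lborel_on :: "real \<Rightarrow> real \<Rightarrow> real measure" where
  "lborel_on a b = density lborel (indicator {a<..<b})"

lemma sets_lborel_on [simp, measurable_cong]: "sets (lborel_on a b) = sets borel"
  and space_lborel_on [simp]: "space (lborel_on a b) = UNIV"
  by (simp_all add: lborel_on_def)

lemma AE_lborel_on: "AE t in lborel_on a b. a < t \<and> t < b"
  unfolding lborel_on_def by (subst AE_density) (auto simp: indicator_def)

lemma emeasure_lborel_on:
  assumes "A \<in> sets borel"
  shows "emeasure (lborel_on a b) A = emeasure lborel ({a<..<b} \<inter> A)"
  using assms unfolding lborel_on_def
  by (subst emeasure_density) (auto simp: ac_simps simp flip: indicator_inter_arith)

lemma finite_lborel_on: "finite_measure (lborel_on a b)"
proof (rule finite_measureI)
  show "emeasure (lborel_on a b) (space (lborel_on a b)) \<noteq> \<infinity>"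
    by (cases "a \<le> b") (simp_all add: emeasure_lborel_on)
qed

lemma nn_integral_lborel_on:
  assumes "f \<in> borel_measurable borel"
  shows "(\<integral>\<^sup>+t. f t \<partial>lborel_on a b) = (\<integral>\<^sup>+t. indicator {a<..<b} t * f t \<partial>lborel)"
  using assms unfolding lborel_on_def by (subst nn_integral_density) auto

lemma integral_lborel_on:
  fixes f :: "real \<Rightarrow> real"
  assumes "f \<in> borel_measurable borel"
  shows "(LINT t|lborel_on a b. f t) = (LINT t|lborel. indicator {a<..<b} t * f t)"
proof -
  have "lborel_on a b = density lborel (\<lambda>t. ennreal (indicator {a<..<b} t))"
    by (simp add: lborel_on_def ennreal_indicator)
  then show ?thesis
    using assms by (simp add: integral_density)
qed

text \<open>Cauchy-Schwarz against the constant 1. If f is not integrable, the Bochner integral is 0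
  by convention, so the bound holds unconditionally.\<close>

lemma power2_integral_le:
  fixes f :: "'b \<Rightarrow> real"
  assumes [measurable]: "f \<in> borel_measurable N"
  shows "ennreal ((LINT t|N. f t)\<^sup>2) \<le> emeasure N (space N) * (\<integral>\<^sup>+t. ennreal ((f t)\<^sup>2) \<partial>N)"
proof (cases "integrable N f")
  case True
  have "ennreal ((LINT t|N. f t)\<^sup>2) = (ennreal (norm (LINT t|N. f t)))\<^sup>2"
    by (simp add: ennreal_power)
  also have "\<dots> \<le> (\<integral>\<^sup>+t. ennreal (norm (f t)) * 1 \<partial>N)\<^sup>2"
    using integral_norm_bound_ennreal [OF True] by (intro power_mono) auto
  also have "\<dots> \<le> (\<integral>\<^sup>+t. ennreal (norm (f t)) ^ 2 \<partial>N) * (\<integral>\<^sup>+t. 1 ^ 2 \<partial>N)"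
    by (rule Cauchy_Schwarz_nn_integral) simp_all
  finally show ?thesis
    by (simp add: ennreal_power mult.commute)
qed (simp add: not_integrable_integral_eq)

lemma nn_integral_power2_L2: "f \<in> L2 M \<Longrightarrow> (\<integral>\<^sup>+x. ennreal ((f x)\<^sup>2) \<partial>M) = ennreal (l2_inner M f f)"
  using nn_integral_eq_integral [OF L2_square_integrable] by (simp add: l2_inner_def power2_eq_square)

lemma L2I_nn_integral:
  assumes [measurable]: "f \<in> borel_measurable M" and "(\<integral>\<^sup>+x. ennreal ((f x)\<^sup>2) \<partial>M) < \<infinity>"
  shows "f \<in> L2 M"
  using assms by (auto simp: L2_def integrable_iff_bounded)

text \<open>A pointwise integral of a bounded family in L2 is also its weak integral. Cauchy-Schwarz
  over the finite measure \<open>N\<close> and Tonelli put it into L2; \<open>T t x * h x\<close> is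
  dominated by the sum of the squares, which is integrable on the product, so Fubini
  applies.\<close>

lemma
  fixes T :: "'b \<Rightarrow> 'a \<Rightarrow> real"
  assumes N: "finite_measure N" and M: "sigma_finite_measure M"
    and T [measurable]: "case_prod T \<in> borel_measurable (N \<Otimes>\<^sub>M M)"
    and bound: "AE t in N. T t \<in> L2 M \<and> l2_inner M (T t) (T t) \<le> C"
  shows L2_integral: "(\<lambda>x. LINT t|N. T t x) \<in> L2 M"
    and integrable_l2_inner: "h \<in> L2 M \<Longrightarrow> integrable N (\<lambda>t. l2_inner M (T t) h)"
    and l2_inner_integral:
      "h \<in> L2 M \<Longrightarrow> l2_inner M (\<lambda>x. LINT t|N. T t x) h = (LINT t|N. l2_inner M (T t) h)"
proof -
  interpret N: finite_measure N by fact
  interpret M: sigma_finite_measure M by fact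
  interpret NM: pair_sigma_finite N M ..
  interpret MN: pair_sigma_finite M N ..
  have T' [measurable]: "(\<lambda>(x, t). T t x) \<in> borel_measurable (M \<Otimes>\<^sub>M N)"
    by measurable
  have sq: "(\<integral>\<^sup>+t. (\<integral>\<^sup>+x. ennreal ((T t x)\<^sup>2) \<partial>M) \<partial>N) \<le> ennreal C * emeasure N (space N)"
  proof -
    have "(\<integral>\<^sup>+t. (\<integral>\<^sup>+x. ennreal ((T t x)\<^sup>2) \<partial>M) \<partial>N) \<le> (\<integral>\<^sup>+t. ennreal C \<partial>N)"
      using bound by (intro nn_integral_mono_AE) (auto simp: nn_integral_power2_L2 ennreal_leI)
    then show ?thesis
      by simp
  qed
  have Nfin: "emeasure N (space N) < top"
    using N.emeasure_finite [of "space N"] unfolding infinity_ennreal_def top.not_eq_extremum .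
  have fin: "ennreal C * emeasure N (space N) < \<infinity>"
    using Nfin by (simp add: ennreal_mult_less_top)
  show "(\<lambda>x. LINT t|N. T t x) \<in> L2 M"
  proof (rule L2I_nn_integral)
    show "(\<lambda>x. LINT t|N. T t x) \<in> borel_measurable M"
      using T' by (rule N.borel_measurable_lebesgue_integral)
    have "(\<integral>\<^sup>+x. ennreal ((LINT t|N. T t x)\<^sup>2) \<partial>M)
        \<le> (\<integral>\<^sup>+x. emeasure N (space N) * (\<integral>\<^sup>+t. ennreal ((T t x)\<^sup>2) \<partial>N) \<partial>M)"
      by (intro nn_integral_mono power2_integral_le) measurable
    also have "\<dots> = emeasure N (space N) * (\<integral>\<^sup>+x. (\<integral>\<^sup>+t. ennreal ((T t x)\<^sup>2) \<partial>N) \<partial>M)"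
      by (intro nn_integral_cmult) measurable
    also have "(\<integral>\<^sup>+x. (\<integral>\<^sup>+t. ennreal ((T t x)\<^sup>2) \<partial>N) \<partial>M) = (\<integral>\<^sup>+t. (\<integral>\<^sup>+x. ennreal ((T t x)\<^sup>2) \<partial>M) \<partial>N)"
      using NM.Fubini' [of "\<lambda>t x. ennreal ((T t x)\<^sup>2)"] by measurable
    also have "emeasure N (space N) * \<dots> \<le> emeasure N (space N) * (ennreal C * emeasure N (space N))"
      by (intro mult_left_mono sq) simp
    also have "\<dots> < \<infinity>"
      using fin Nfin by (simp add: ennreal_mult_less_top)
    finally show "(\<integral>\<^sup>+x. ennreal ((LINT t|N. T t x)\<^sup>2) \<partial>M) < \<infinity>" .
  qed
  assume h: "h \<in> L2 M"
  then have [measurable]: "h \<in> borel_measurable M"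
    by (rule L2_measurable)
  have int: "integrable (N \<Otimes>\<^sub>M M) (\<lambda>(t, x). T t x * h x)"
  proof (rule integrableI_bounded)
    have le: "ennreal (norm (a * b)) \<le> ennreal (a\<^sup>2) + ennreal (b\<^sup>2)" for a b :: real
    proof -
      have "0 \<le> \<bar>a\<bar> * \<bar>b\<bar>"
        by simp
      then have "\<bar>a\<bar> * \<bar>b\<bar> \<le> a\<^sup>2 + b\<^sup>2"
        using sum_squares_bound [of "\<bar>a\<bar>" "\<bar>b\<bar>"] unfolding power2_abs by linarith
      then show ?thesis
        by (simp add: abs_mult ennreal_leI flip: ennreal_plus)
    qed
    have "(\<integral>\<^sup>+z. norm (case z of (t, x) \<Rightarrow> T t x * h x) \<partial>(N \<Otimes>\<^sub>M M))
        = (\<integral>\<^sup>+t. (\<integral>\<^sup>+x. norm (T t x * h x) \<partial>M) \<partial>N)"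
      by (subst M.nn_integral_fst [symmetric]) auto
    also have "\<dots> \<le> (\<integral>\<^sup>+t. (\<integral>\<^sup>+x. ennreal ((T t x)\<^sup>2) + ennreal ((h x)\<^sup>2) \<partial>M) \<partial>N)"
      by (intro nn_integral_mono le)
    also have "\<dots> = (\<integral>\<^sup>+t. (\<integral>\<^sup>+x. ennreal ((T t x)\<^sup>2) \<partial>M) + ennreal (l2_inner M h h) \<partial>N)"
    proof (intro nn_integral_cong)
      fix t assume [measurable]: "t \<in> space N"
      have [measurable]: "T t \<in> borel_measurable M"
        by measurable
      show "(\<integral>\<^sup>+x. ennreal ((T t x)\<^sup>2) + ennreal ((h x)\<^sup>2) \<partial>M)
          = (\<integral>\<^sup>+x. ennreal ((T t x)\<^sup>2) \<partial>M) + ennreal (l2_inner M h h)"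
        by (simp add: nn_integral_add nn_integral_power2_L2 [OF h])
    qed
    also have "\<dots> = (\<integral>\<^sup>+t. (\<integral>\<^sup>+x. ennreal ((T t x)\<^sup>2) \<partial>M) \<partial>N) + ennreal (l2_inner M h h) * emeasure N (space N)"
      by (subst nn_integral_add) auto
    also have "\<dots> \<le> ennreal C * emeasure N (space N) + ennreal (l2_inner M h h) * emeasure N (space N)"
      by (intro add_right_mono sq)
    also have "\<dots> < \<infinity>"
      using fin Nfin by (simp add: ennreal_mult_less_top)
    finally show "(\<integral>\<^sup>+z. norm (case z of (t, x) \<Rightarrow> T t x * h x) \<partial>(N \<Otimes>\<^sub>M M)) < \<infinity>" .
  qed measurable
  show "integrable N (\<lambda>t. l2_inner M (T t) h)"
    using NM.integrable_fst [OF int] by (simp add: l2_inner_def)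
  show "l2_inner M (\<lambda>x. LINT t|N. T t x) h = (LINT t|N. l2_inner M (T t) h)"
    using NM.Fubini_integral [OF int] by (simp add: l2_inner_def)
qed

section \<open>Averages over the balls of an ultra-metric\<close>

text \<open>Only u and the measure matter for the spectral analysis, so topology is left out at this
  level; of it just positivity and finiteness of the ball masses remain.\<close>

locale ultrametric_measure = sigma_finite_measure M for M :: "'a measure" +
  fixes u :: "'a \<Rightarrow> 'a \<Rightarrow> real"
  assumes space_UNIV: "space M = UNIV"
    and u_measurable: "case_prod u \<in> borel_measurable (M \<Otimes>\<^sub>M M)"
    and u_refl [simp]: "u x x = 0"
    and u_commute: "u x y = u y x"
    and u_ultra: "u x z \<le> max (u x y) (u y z)"
    and ball_positive: "0 < t \<Longrightarrow> t < 1 \<Longrightarrow> 0 < emeasure M {y. u x y \<le> t}"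
    and ball_finite: "0 < t \<Longrightarrow> t < 1 \<Longrightarrow> emeasure M {y. u x y \<le> t} < \<infinity>"
begin

lemma measurable_u [measurable (raw)]:
  assumes "f \<in> measurable N M" and "g \<in> measurable N M"
  shows "(\<lambda>z. u (f z) (g z)) \<in> borel_measurable N"
  using measurable_compose [OF measurable_Pair [OF assms] u_measurable] by simp

lemma measurable_u_left [measurable]: "u x \<in> borel_measurable M"
  by (rule measurable_u [of "\<lambda>_. x" M "\<lambda>y. y"]) (auto simp: space_UNIV)

lemma sets_ball [measurable]: "{y. u x y \<le> t} \<in> sets M"
proof -
  have "{y \<in> space M. u x y \<le> t} \<in> sets M"
    by measurable
  then show ?thesis
    by (simp add: space_UNIV)
qed

text \<open>Every point of a ball is a centre of it. Symmetry of \<open>avg_kernel\<close> and the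
  projection property of \<open>avg\<close> both come from this.\<close>

lemma ball_eq: "u x y \<le> t \<Longrightarrow> u x z \<le> t \<longleftrightarrow> u y z \<le> t"
  using u_ultra [of x z y] u_ultra [of y z x] u_commute [of x y] by auto

definition vol :: "real \<Rightarrow> 'a \<Rightarrow> real" where
  "vol t x = measure M {y. u x y \<le> t}"

definition avg_kernel :: "real \<Rightarrow> 'a \<Rightarrow> 'a \<Rightarrow> real" where
  "avg_kernel t x y = (if u x y \<le> t then 1 / vol t x else 0)"

definition avg :: "real \<Rightarrow> ('a \<Rightarrow> real) \<Rightarrow> 'a \<Rightarrow> real" where
  "avg t f x = (LINT y|M. avg_kernel t x y * f y)"

lemma emeasure_ball: "0 < t \<Longrightarrow> t < 1 \<Longrightarrow> emeasure M {y. u x y \<le> t} = ennreal (vol t x)"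
  using ball_finite [of t x] by (simp add: vol_def emeasure_eq_ennreal_measure less_top)

lemma vol_positive: "0 < t \<Longrightarrow> t < 1 \<Longrightarrow> 0 < vol t x"
  using ball_positive [of t x] by (simp add: emeasure_ball)

lemma vol_mono: "s \<le> t \<Longrightarrow> 0 < t \<Longrightarrow> t < 1 \<Longrightarrow> vol s x \<le> vol t x"
  unfolding vol_def using ball_finite [of t x]
  by (intro measure_mono_fmeasurable) (auto simp: fmeasurable_def)

text \<open>As an integral depending on parameters, the volume is jointly measurable in radius and
  centre; Fubini over the radius needs this.\<close>

lemma vol_eq_integral: "vol t x = (LINT y|M. (if u x y \<le> t then 1 else 0 :: real))"
proof -
  have "(LINT y|M. (if u x y \<le> t then 1 else 0 :: real)) = (LINT y|M. indicator {y. u x y \<le> t} y)"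
    by (intro Bochner_Integration.integral_cong) (auto simp: indicator_def)
  then show ?thesis
    by (simp add: vol_def space_UNIV)
qed

lemma measurable_vol [measurable (raw)]:
  assumes [measurable]: "f \<in> borel_measurable N" "g \<in> measurable N M"
  shows "(\<lambda>z. vol (f z) (g z)) \<in> borel_measurable N"
  unfolding vol_eq_integral by (rule borel_measurable_lebesgue_integral) measurable

lemma measurable_avg_kernel [measurable (raw)]:
  assumes [measurable]: "f \<in> borel_measurable N" "g \<in> measurable N M" "h \<in> measurable N M"
  shows "(\<lambda>z. avg_kernel (f z) (g z) (h z)) \<in> borel_measurable N"
  unfolding avg_kernel_def by measurable

lemma measurable_avg [measurable (raw)]:
  assumes [measurable]: "f \<in> borel_measurable N" "g \<in> measurable N M" "h \<in> borel_measurable M"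
  shows "(\<lambda>z. avg (f z) h (g z)) \<in> borel_measurable N"
  unfolding avg_def by (rule borel_measurable_lebesgue_integral) measurable

lemma measurable_avg_right [measurable]:
  assumes "h \<in> borel_measurable M"
  shows "avg t h \<in> borel_measurable M"
  by (rule measurable_avg [of "\<lambda>_. t" M "\<lambda>x. x"]) (auto simp: assms)

lemma measurable_avg_kernel_right [measurable]: "avg_kernel t x \<in> borel_measurable M"
  by (rule measurable_avg_kernel [of "\<lambda>_. t" M "\<lambda>_. x" "\<lambda>y. y"]) (auto simp: space_UNIV)

lemma measurable_avg_kernel_left [measurable]: "(\<lambda>x. avg_kernel t x y) \<in> borel_measurable M"
  by (rule measurable_avg_kernel [of "\<lambda>_. t" M "\<lambda>x. x" "\<lambda>_. y"]) (auto simp: space_UNIV)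

lemma avg_kernel_nonneg [simp]: "0 \<le> avg_kernel t x y"
  by (simp add: avg_kernel_def vol_def)

lemma avg_kernel_cong: "u x y \<le> t \<Longrightarrow> avg_kernel t x = avg_kernel t y"
  by (auto simp: avg_kernel_def vol_def fun_eq_iff ball_eq [of x y])

lemma avg_kernel_commute: "avg_kernel t x y = avg_kernel t y x"
proof (cases "u x y \<le> t")
  case True
  then have "vol t x = vol t y"
    by (simp add: vol_def ball_eq [of x y])
  then show ?thesis
    using True by (simp add: avg_kernel_def u_commute [of x y])
qed (simp add: avg_kernel_def u_commute [of x y])

lemma avg_cong: "u x y \<le> t \<Longrightarrow> avg t f x = avg t f y"
  by (simp add: avg_def avg_kernel_cong)

section \<open>Averaging as a symmetric contraction of L2\<close>

context
  fixes t :: real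
  assumes t: "0 < t" "t < 1"
begin

lemma avg_kernel_eq: "avg_kernel t x y = indicator {y. u x y \<le> t} y / vol t x"
  by (simp add: avg_kernel_def)

lemma integrable_avg_kernel: "integrable M (avg_kernel t x)"
  and integral_avg_kernel: "(LINT y|M. avg_kernel t x y) = 1"
proof -
  have "integrable M (indicator {y. u x y \<le> t} :: 'a \<Rightarrow> real)"
    using ball_finite [OF t, of x] by (intro integrable_real_indicator) auto
  then show "integrable M (avg_kernel t x)"
    unfolding avg_kernel_eq [abs_def] by simp
  show "(LINT y|M. avg_kernel t x y) = 1"
    using vol_positive [OF t, of x] unfolding avg_kernel_eq by (simp add: space_UNIV vol_def)
qed

lemma nn_integral_avg_kernel: "(\<integral>\<^sup>+y. ennreal (avg_kernel t x y) \<partial>M) = 1"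
  using nn_integral_eq_integral [OF integrable_avg_kernel, of x] by (simp add: integral_avg_kernel)

lemma nn_integral_avg_kernel_left: "(\<integral>\<^sup>+x. ennreal (avg_kernel t x y) \<partial>M) = 1"
  using nn_integral_avg_kernel [of y] by (simp add: avg_kernel_commute [of t _ y])

lemma avg_kernel_L2: "avg_kernel t x \<in> L2 M"
proof -
  have "(\<lambda>y. (avg_kernel t x y)\<^sup>2) = (\<lambda>y. avg_kernel t x y / vol t x)"
    by (auto simp: avg_kernel_def power2_eq_square)
  then show ?thesis
    using integrable_avg_kernel [of x] by (simp add: L2_def)
qed

lemma integrable_avg_kernel_mult: "f \<in> L2 M \<Longrightarrow> integrable M (\<lambda>y. avg_kernel t x y * f y)"
  by (rule L2_mult_integrable [OF avg_kernel_L2])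

lemma avg_add: "f \<in> L2 M \<Longrightarrow> g \<in> L2 M \<Longrightarrow> avg t (\<lambda>x. f x + g x) x = avg t f x + avg t g x"
  by (simp add: avg_def distrib_left integrable_avg_kernel_mult)

lemma avg_diff: "f \<in> L2 M \<Longrightarrow> g \<in> L2 M \<Longrightarrow> avg t (\<lambda>x. f x - g x) x = avg t f x - avg t g x"
  by (simp add: avg_def right_diff_distrib integrable_avg_kernel_mult)

lemma avg_const_on_ball:
  assumes "\<And>y. u x y \<le> t \<Longrightarrow> f y = f x"
  shows "avg t f x = f x"
proof -
  have "avg t f x = (LINT y|M. avg_kernel t x y * f x)"
    unfolding avg_def by (intro Bochner_Integration.integral_cong) (auto simp: avg_kernel_def assms)
  then show ?thesis
    by (simp add: integral_avg_kernel)
qed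

lemma integrable_avg_kernel_power2:
  assumes f: "f \<in> L2 M"
  shows "integrable M (\<lambda>y. avg_kernel t x y * (f y)\<^sup>2)"
proof (rule Bochner_Integration.integrable_bound)
  show "integrable M (\<lambda>y. (f y)\<^sup>2 / vol t x)"
    using L2_square_integrable [OF f] by simp
  show "(\<lambda>y. avg_kernel t x y * (f y)\<^sup>2) \<in> borel_measurable M"
    using f by measurable
  show "AE y in M. norm (avg_kernel t x y * (f y)\<^sup>2) \<le> norm ((f y)\<^sup>2 / vol t x)"
    by (auto simp: avg_kernel_def)
qed

text \<open>The variance of f with respect to the probability density \<open>avg_kernel t x\<close>
  is nonnegative.\<close>

lemma avg_power2_le:
  assumes f: "f \<in> L2 M"
  shows "(avg t f x)\<^sup>2 \<le> (LINT y|M. avg_kernel t x y * (f y)\<^sup>2)"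
proof -
  have "0 \<le> (LINT y|M. avg_kernel t x y * (f y - avg t f x)\<^sup>2)"
    by simp
  also have "\<dots> = (LINT y|M. avg_kernel t x y * (f y)\<^sup>2 - 2 * avg t f x * (avg_kernel t x y * f y)
      + (avg t f x)\<^sup>2 * avg_kernel t x y)"
    by (intro Bochner_Integration.integral_cong) (auto simp: power2_diff algebra_simps)
  also have "\<dots> = (LINT y|M. avg_kernel t x y * (f y)\<^sup>2) - 2 * avg t f x * avg t f x + (avg t f x)\<^sup>2"
    using f by (simp add: integrable_avg_kernel_power2 integrable_avg_kernel_mult integrable_avg_kernel
        integral_avg_kernel avg_def)
  finally show ?thesis
    by (simp add: power2_eq_square)
qed

text \<open>Tonelli, since the kernel has mass 1 in either variable by symmetry.\<close>

lemma nn_integral_avg_le: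
  assumes f: "f \<in> L2 M"
  shows "(\<integral>\<^sup>+x. ennreal ((avg t f x)\<^sup>2) \<partial>M) \<le> ennreal (l2_inner M f f)"
proof -
  interpret MM: pair_sigma_finite M M ..
  note [measurable] = L2_measurable [OF f]
  have "(\<integral>\<^sup>+x. ennreal ((avg t f x)\<^sup>2) \<partial>M) \<le> (\<integral>\<^sup>+x. (\<integral>\<^sup>+y. ennreal (avg_kernel t x y * (f y)\<^sup>2) \<partial>M) \<partial>M)"
    using nn_integral_eq_integral [OF integrable_avg_kernel_power2 [OF f]]
    by (intro nn_integral_mono) (simp add: ennreal_leI avg_power2_le [OF f])
  also have "\<dots> = (\<integral>\<^sup>+y. (\<integral>\<^sup>+x. ennreal (avg_kernel t x y * (f y)\<^sup>2) \<partial>M) \<partial>M)"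
    by (rule MM.Fubini') measurable
  also have "\<dots> = (\<integral>\<^sup>+y. ennreal ((f y)\<^sup>2) \<partial>M)"
  proof (intro nn_integral_cong)
    fix y
    have "(\<integral>\<^sup>+x. ennreal (avg_kernel t x y * (f y)\<^sup>2) \<partial>M) = (\<integral>\<^sup>+x. ennreal (avg_kernel t x y) * ennreal ((f y)\<^sup>2) \<partial>M)"
      by (simp add: ennreal_mult)
    also have "\<dots> = ennreal ((f y)\<^sup>2)"
      by (subst nn_integral_multc) (simp_all add: nn_integral_avg_kernel_left)
    finally show "(\<integral>\<^sup>+x. ennreal (avg_kernel t x y * (f y)\<^sup>2) \<partial>M) = ennreal ((f y)\<^sup>2)" .
  qed
  finally show ?thesis
    by (simp add: nn_integral_power2_L2 [OF f])
qed

lemma avg_L2: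
  assumes f: "f \<in> L2 M"
  shows "avg t f \<in> L2 M"
proof (rule L2I_nn_integral)
  show "avg t f \<in> borel_measurable M"
    using f by measurable
  show "(\<integral>\<^sup>+x. ennreal ((avg t f x)\<^sup>2) \<partial>M) < \<infinity>"
    using nn_integral_avg_le [OF f] by (rule le_less_trans) simp
qed

lemma avg_contraction: "f \<in> L2 M \<Longrightarrow> l2_inner M (avg t f) (avg t f) \<le> l2_inner M f f"
  using nn_integral_avg_le [of f] nn_integral_power2_L2 [OF avg_L2, of f] by simp

text \<open>Fubini for a symmetric kernel. The bound |k a b| \<le> k a^2 + k b^2 and the unit masses
  in both variables show that the integrand is integrable on the product.\<close>

lemma avg_symmetric:
  assumes f: "f \<in> L2 M" and g: "g \<in> L2 M"
  shows "l2_inner M (avg t f) g = l2_inner M f (avg t g)"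
proof -
  interpret MM: pair_sigma_finite M M ..
  note [measurable] = L2_measurable [OF f] L2_measurable [OF g]
  have le: "ennreal (norm (k * a * b)) \<le> ennreal k * ennreal (a\<^sup>2) + ennreal k * ennreal (b\<^sup>2)"
    if k: "0 \<le> k" for a b k :: real
  proof -
    have "0 \<le> \<bar>a\<bar> * \<bar>b\<bar>"
      by simp
    then have "\<bar>a\<bar> * \<bar>b\<bar> \<le> a\<^sup>2 + b\<^sup>2"
      using sum_squares_bound [of "\<bar>a\<bar>" "\<bar>b\<bar>"] unfolding power2_abs by linarith
    then have "k * (\<bar>a\<bar> * \<bar>b\<bar>) \<le> k * (a\<^sup>2 + b\<^sup>2)"
      using k by (intro mult_left_mono)
    then have "\<bar>k * a * b\<bar> \<le> k * a\<^sup>2 + k * b\<^sup>2"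
      using k by (simp add: abs_mult algebra_simps)
    then show ?thesis
      using k by (simp add: ennreal_leI flip: ennreal_plus ennreal_mult)
  qed
  have int: "integrable (M \<Otimes>\<^sub>M M) (\<lambda>(x, y). avg_kernel t x y * f y * g x)"
  proof (rule integrableI_bounded)
    have "(\<integral>\<^sup>+z. norm (case z of (x, y) \<Rightarrow> avg_kernel t x y * f y * g x) \<partial>(M \<Otimes>\<^sub>M M))
        = (\<integral>\<^sup>+x. (\<integral>\<^sup>+y. norm (avg_kernel t x y * f y * g x) \<partial>M) \<partial>M)"
      using nn_integral_fst [of "\<lambda>z. norm (case z of (x, y) \<Rightarrow> avg_kernel t x y * f y * g x)" M] by simp
    also have "\<dots> \<le> (\<integral>\<^sup>+x. (\<integral>\<^sup>+y. ennreal (avg_kernel t x y) * ennreal ((f y)\<^sup>2)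
        + ennreal (avg_kernel t x y) * ennreal ((g x)\<^sup>2) \<partial>M) \<partial>M)"
      by (intro nn_integral_mono le) simp
    also have "\<dots> = (\<integral>\<^sup>+x. (\<integral>\<^sup>+y. ennreal (avg_kernel t x y) * ennreal ((f y)\<^sup>2) \<partial>M) + ennreal ((g x)\<^sup>2) \<partial>M)"
      by (simp add: nn_integral_add nn_integral_multc nn_integral_avg_kernel)
    also have "\<dots> = (\<integral>\<^sup>+x. (\<integral>\<^sup>+y. ennreal (avg_kernel t x y) * ennreal ((f y)\<^sup>2) \<partial>M) \<partial>M) + ennreal (l2_inner M g g)"
      by (subst nn_integral_add) (auto simp: nn_integral_power2_L2 [OF g])
    also have "(\<integral>\<^sup>+x. (\<integral>\<^sup>+y. ennreal (avg_kernel t x y) * ennreal ((f y)\<^sup>2) \<partial>M) \<partial>M)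
        = (\<integral>\<^sup>+y. (\<integral>\<^sup>+x. ennreal (avg_kernel t x y) * ennreal ((f y)\<^sup>2) \<partial>M) \<partial>M)"
      by (rule MM.Fubini') measurable
    also have "\<dots> = (\<integral>\<^sup>+y. ennreal ((f y)\<^sup>2) \<partial>M)"
      by (subst nn_integral_multc) (simp_all add: nn_integral_avg_kernel_left)
    also have "\<dots> = ennreal (l2_inner M f f)"
      by (rule nn_integral_power2_L2 [OF f])
    finally show "(\<integral>\<^sup>+z. norm (case z of (x, y) \<Rightarrow> avg_kernel t x y * f y * g x) \<partial>(M \<Otimes>\<^sub>M M)) < \<infinity>"
      by (simp add: le_less_trans)
  qed measurable
  have "l2_inner M (avg t f) g = (LINT x|M. (LINT y|M. avg_kernel t x y * f y * g x))"
    by (simp add: l2_inner_def avg_def)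
  also have "\<dots> = (LINT y|M. (LINT x|M. avg_kernel t x y * f y * g x))"
    by (rule MM.Fubini_integral [OF int, symmetric])
  also have "\<dots> = (LINT y|M. f y * (LINT x|M. avg_kernel t y x * g x))"
    by (simp add: avg_kernel_commute [of t _ y for y] mult.assoc mult.left_commute
        flip: Bochner_Integration.integral_mult_right_zero)
  finally show ?thesis
    by (simp add: l2_inner_def avg_def)
qed

end

text \<open>An average over balls of radius t is constant on them, hence on the smaller balls of
  radius s.\<close>

lemma avg_avg:
  assumes "0 < s" and "s \<le> t" and "t < 1"
  shows "avg s (avg t f) x = avg t f x"
proof (rule avg_const_on_ball)
  show "avg t f y = avg t f x" if "u x y \<le> s" for y
    using that \<open>s \<le> t\<close> by (intro avg_cong [symmetric]) simp
qed (use assms in simp_all)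

lemma avg_avg':
  assumes "0 < s" and "s \<le> t" and "t < 1" and f: "f \<in> L2 M" and g: "g \<in> L2 M"
  shows "l2_inner M (avg s f) (avg t g) = l2_inner M f (avg t g)"
proof -
  have "avg s (avg t g) = avg t g"
    using avg_avg [OF assms(1-3)] by blast
  then show ?thesis
    using avg_symmetric [of s f "avg t g"] avg_L2 [of t g] assms by simp
qed

subsection \<open>The spectral projections\<close>

definition locally_constant :: "('a \<Rightarrow> real) set" where
  "locally_constant = {f \<in> L2 M. \<exists>t>0. t < 1 \<and> (\<forall>x y. u x y \<le> t \<longrightarrow> f x = f y)}"

text \<open>The complement of the averages, completed by 0 and the identity because the spectrum
  lies in [0,1]. A jump at 1 is possible: constants are eigenfunctions with eigenvalue 1 when the
  total mass is finite.\<close>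

definition spec :: "real \<Rightarrow> ('a \<Rightarrow> real) \<Rightarrow> 'a \<Rightarrow> real" where
  "spec t f = (if t \<le> 0 then (\<lambda>x. 0) else if t < 1 then (\<lambda>x. f x - avg t f x) else f)"

lemma spec_L2: "f \<in> L2 M \<Longrightarrow> spec t f \<in> L2 M"
  by (simp add: spec_def L2_diff avg_L2)

lemma spec_symmetric: "f \<in> L2 M \<Longrightarrow> g \<in> L2 M \<Longrightarrow> l2_inner M (spec t f) g = l2_inner M f (spec t g)"
  by (simp add: spec_def l2_inner_linear avg_L2 avg_symmetric)

lemma spec_spec:
  assumes "s \<le> t" and f: "f \<in> L2 M"
  shows "spec s (spec t f) x = spec s f x"
proof -
  consider "s \<le> 0" | "0 < s" "t < 1" | "0 < s" "1 \<le> t"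
    by linarith
  then show ?thesis
  proof cases
    case 2
    then show ?thesis
      using assms by (simp add: spec_def avg_diff avg_L2 avg_avg)
  qed (use assms in \<open>auto simp: spec_def\<close>)
qed

lemma l2_inner_avg_self:
  assumes "0 < t" and "t < 1" and "f \<in> L2 M"
  shows "l2_inner M (avg t f) (avg t f) = l2_inner M (avg t f) f"
  using avg_avg' [of t t f f] assms by (simp add: avg_symmetric)

lemma l2_inner_diff_avg:
  assumes t: "0 < t" "t < 1" and f: "f \<in> L2 M"
  shows "l2_inner M (\<lambda>x. f x - avg t f x) (\<lambda>x. f x - avg t f x) = l2_inner M f f - l2_inner M (avg t f) f"
  using assms by (simp add: l2_inner_linear avg_L2 l2_inner_avg_self l2_inner_commute [of M f "avg t f"])

lemma l2_norm_diff_avg_le: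
  assumes t: "0 < t" "t < 1" and f: "f \<in> L2 M"
  shows "l2_norm M (\<lambda>x. f x - avg t f x) \<le> l2_norm M f"
  unfolding l2_norm_def l2_inner_diff_avg [OF assms] l2_inner_avg_self [OF assms, symmetric] by simp

text \<open>Dominated convergence: the non-strict balls of radius \<open>S n\<close> decrease to the
  ball of radius s, and all lie in the one of radius \<open>S 0\<close>. Applied to f and to the
  constant 1, it gives numerator and denominator of the average.\<close>

lemma integral_over_ball_tendsto:
  fixes S :: "nat \<Rightarrow> real"
  assumes S: "\<And>n. s < S n" "decseq S" "S \<longlonglongrightarrow> s" and pos: "0 < s" "S 0 < 1"
    and g [measurable]: "g \<in> borel_measurable M" and int: "integrable M (\<lambda>y. avg_kernel (S 0) x y * g y)"
  shows "(\<lambda>n. LINT y|M. (if u x y \<le> S n then g y else 0)) \<longlonglongrightarrow> (LINT y|M. (if u x y \<le> s then g y else 0))"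
proof (rule integral_dominated_convergence)
  have "0 < S 0"
    using S(1) [of 0] pos by linarith
  then have "vol (S 0) x * (avg_kernel (S 0) x y * g y) = (if u x y \<le> S 0 then g y else 0)" for y
    using vol_positive [of "S 0" x] pos by (simp add: avg_kernel_def)
  then show "integrable M (\<lambda>y. norm (if u x y \<le> S 0 then g y else 0))"
    using integrable_norm [OF integrable_mult_right [OF int, of "vol (S 0) x"]] by simp
  show "AE y in M. norm (if u x y \<le> S n then g y else 0) \<le> norm (if u x y \<le> S 0 then g y else 0)" for n
    using decseqD [OF S(2), of 0 n] by auto
  have "(\<lambda>n. if u x y \<le> S n then g y else 0) \<longlonglongrightarrow> (if u x y \<le> s then g y else 0)" for y
  proof (cases "u x y \<le> s")
    case True
    then have "u x y \<le> S n" for n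
      using S(1) [of n] by simp
    then show ?thesis
      using True by simp
  next
    case False
    then have "eventually (\<lambda>n. S n < u x y) sequentially"
      using S(3) by (intro order_tendstoD) auto
    then have "eventually (\<lambda>n. (if u x y \<le> S n then g y else 0) = (if u x y \<le> s then g y else 0)) sequentially"
      by eventually_elim (use False in auto)
    then show ?thesis
      by (rule tendsto_eventually)
  qed
  then show "AE y in M. (\<lambda>n. if u x y \<le> S n then g y else 0) \<longlonglongrightarrow> (if u x y \<le> s then g y else 0)"
    by simp
qed measurable

lemma avg_tendsto:
  fixes S :: "nat \<Rightarrow> real"
  assumes S: "\<And>n. s < S n" "decseq S" "S \<longlonglongrightarrow> s" and pos: "0 < s" "S 0 < 1" and f: "f \<in> L2 M"
  shows "(\<lambda>n. avg (S n) f x) \<longlonglongrightarrow> avg s f x"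
proof -
  have S0: "0 < S 0"
    using S(1) [of 0] pos by linarith
  have avg_eq: "avg t f x = (LINT y|M. (if u x y \<le> t then f y else 0)) / (LINT y|M. (if u x y \<le> t then 1 else 0))" for t
  proof -
    have "avg t f x = (LINT y|M. (if u x y \<le> t then f y else 0) / vol t x)"
      unfolding avg_def by (intro Bochner_Integration.integral_cong) (auto simp: avg_kernel_def)
    then show ?thesis
      by (simp add: vol_eq_integral)
  qed
  have "(LINT y|M. (if u x y \<le> s then 1 else 0 :: real)) \<noteq> 0"
    using vol_positive [of s x] S(1) [of 0] pos by (simp add: vol_eq_integral)
  then show ?thesis
    unfolding avg_eq
    by (intro tendsto_divide integral_over_ball_tendsto S pos)
      (use f S0 pos in \<open>auto simp: integrable_avg_kernel_mult integrable_avg_kernel L2_measurable\<close>)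
qed

text \<open>The averages converge pointwise, and their norms increase, so by Fatou's lemma the norms
  converge as well.\<close>

lemma avg_right_continuous:
  assumes s: "0 < s" "s < 1" and f: "f \<in> L2 M"
  shows "((\<lambda>t. l2_norm M (\<lambda>x. avg s f x - avg t f x)) \<longlongrightarrow> 0) (at_right s)"
proof (rule tendsto_at_right_sequentially [OF s(2)])
  fix S :: "nat \<Rightarrow> real"
  assume S: "\<And>n. s < S n" "\<And>n. S n < 1" "decseq S" "S \<longlonglongrightarrow> s"
  have S0: "0 < S n" for n
    using S(1) [of n] s by linarith
  define a where "a t = l2_inner M (avg t f) (avg t f)" for t
  \<comment> \<open>Pythagoras: \<open>avg s\<close> fixes \<open>avg (S n) f\<close>, so the
    squared distance is a difference of squared norms.\<close>
  have diff: "l2_inner M (\<lambda>x. avg s f x - avg (S n) f x) (\<lambda>x. avg s f x - avg (S n) f x) = a s - a (S n)" for n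
  proof -
    have "l2_inner M (avg s f) (avg (S n) f) = a (S n)"
      unfolding a_def
      using avg_avg' [OF s(1) less_imp_le [OF S(1)] S(2) f f, of n]
        avg_avg' [OF S0 order_refl S(2) f f, of n] by simp
    then show ?thesis
      using f s S0 S(2) by (simp add: l2_inner_linear avg_L2 a_def l2_inner_commute [of M "avg (S n) f" "avg s f"])
  qed
  have le: "a (S n) \<le> a s" for n
    using diff [of n] l2_inner_self_nonneg [of M "\<lambda>x. avg s f x - avg (S n) f x"] by linarith
  have nn: "ennreal (a t) = (\<integral>\<^sup>+x. ennreal ((avg t f x)\<^sup>2) \<partial>M)" if "0 < t" "t < 1" for t
    unfolding a_def using nn_integral_power2_L2 [OF avg_L2 [OF that f]] by simp
  have "(\<lambda>n. ennreal (a (S n))) \<longlonglongrightarrow> ennreal (a s)"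
  proof (rule tendsto_iff_Liminf_eq_Limsup [THEN iffD2])
    have "ennreal (a s) = (\<integral>\<^sup>+x. liminf (\<lambda>n. ennreal ((avg (S n) f x)\<^sup>2)) \<partial>M)"
      unfolding nn [OF s]
    proof (intro nn_integral_cong)
      fix x
      have "(\<lambda>n. ennreal ((avg (S n) f x)\<^sup>2)) \<longlonglongrightarrow> ennreal ((avg s f x)\<^sup>2)"
        by (intro tendsto_ennrealI tendsto_power avg_tendsto S s f)
      then show "ennreal ((avg s f x)\<^sup>2) = liminf (\<lambda>n. ennreal ((avg (S n) f x)\<^sup>2))"
        by (intro lim_imp_Liminf [symmetric]) simp_all
    qed
    also have "\<dots> \<le> liminf (\<lambda>n. ennreal (a (S n)))"
      unfolding nn [OF S0 S(2)] by (rule nn_integral_liminf) (use f in measurable)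
    finally have 1: "ennreal (a s) \<le> liminf (\<lambda>n. ennreal (a (S n)))" .
    have 2: "limsup (\<lambda>n. ennreal (a (S n))) \<le> ennreal (a s)"
      by (intro Limsup_bounded always_eventually allI ennreal_leI le)
    have 3: "liminf (\<lambda>n. ennreal (a (S n))) \<le> limsup (\<lambda>n. ennreal (a (S n)))"
      by (rule Liminf_le_Limsup) simp
    from 1 2 3 show "liminf (\<lambda>n. ennreal (a (S n))) = ennreal (a s) \<and> limsup (\<lambda>n. ennreal (a (S n))) = ennreal (a s)"
      by (meson antisym order_trans)
  qed simp
  then have "(\<lambda>n. a (S n)) \<longlonglongrightarrow> a s"
    by (rule tendsto_ennrealD) (simp_all add: a_def)
  then have "(\<lambda>n. sqrt (a s - a (S n))) \<longlonglongrightarrow> sqrt (a s - a s)"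
    by (intro tendsto_real_sqrt tendsto_diff tendsto_const)
  then show "(\<lambda>n. l2_norm M (\<lambda>x. avg s f x - avg (S n) f x)) \<longlonglongrightarrow> 0"
    by (simp add: l2_norm_def diff)
qed

end

text \<open>Density is a separate layer because its proof uses the topology, through regularity of
  the measure.\<close>

locale dense_ultrametric_measure = ultrametric_measure M u for M :: "'a measure" and u +
  assumes dense: "h \<in> L2 M \<Longrightarrow> 0 < \<epsilon> \<Longrightarrow> \<exists>d\<in>locally_constant. l2_norm M (\<lambda>x. h x - d x) < \<epsilon>"
begin

text \<open>If d is constant on balls of radius t0, then I - A_t annihilates d for t < t0, so f -
  A_t f = (I - A_t) (f - d), and I - A_t does not increase norms.\<close>

lemma avg_tendsto_identity:
  assumes f: "f \<in> L2 M"
  shows "((\<lambda>t. l2_norm M (\<lambda>x. f x - avg t f x)) \<longlongrightarrow> 0) (at_right 0)"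
proof (rule tendstoI)
  fix \<epsilon> :: real assume "0 < \<epsilon>"
  then obtain d where d: "d \<in> locally_constant" "l2_norm M (\<lambda>x. f x - d x) < \<epsilon>"
    using dense [OF f] by blast
  then obtain t0 where t0: "0 < t0" "t0 < 1" and const: "\<And>x y. u x y \<le> t0 \<Longrightarrow> d x = d y"
    and dL: "d \<in> L2 M"
    unfolding locally_constant_def by blast
  have "l2_norm M (\<lambda>x. f x - avg t f x) < \<epsilon>" if t: "0 < t" "t < t0" for t
  proof -
    have t1: "t < 1"
      using t t0 by simp
    have "avg t d x = d x" for x
      using const [of x] t by (intro avg_const_on_ball [OF t(1) t1]) (metis less_imp_le order_trans)
    then have "(\<lambda>x. f x - avg t f x) = (\<lambda>x. (f x - d x) - avg t (\<lambda>x. f x - d x) x)"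
      using f dL t t1 by (simp add: avg_diff)
    then show ?thesis
      using l2_norm_diff_avg_le [OF t(1) t1 L2_diff [OF f dL]] d(2) by simp
  qed
  then show "eventually (\<lambda>t. dist (l2_norm M (\<lambda>x. f x - avg t f x)) 0 < \<epsilon>) (at_right 0)"
    using t0(1) by (auto simp: eventually_at_right)
qed

lemma resolution_spec: "resolution_of_identity M spec"
  unfolding resolution_of_identity_def
proof (intro conjI allI ballI impI)
  show "orthogonal_projection M (spec t)" for t
    unfolding orthogonal_projection_def by (simp add: spec_L2 spec_symmetric spec_spec)
  show "AE x in M. spec s (spec t f) x = spec s f x" if "s \<le> t" "f \<in> L2 M" for s t f
    using spec_spec [OF that] by simp
  show "((\<lambda>t. l2_norm M (spec t f)) \<longlongrightarrow> 0) at_bot" for f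
  proof (rule tendsto_eventually)
    show "eventually (\<lambda>t. l2_norm M (spec t f) = 0) at_bot"
      using eventually_le_at_bot [of "0 :: real"]
      by eventually_elim (simp add: spec_def l2_norm_def)
  qed
  show "((\<lambda>t. l2_norm M (\<lambda>x. spec t f x - f x)) \<longlongrightarrow> 0) at_top" for f
  proof (rule tendsto_eventually)
    show "eventually (\<lambda>t. l2_norm M (\<lambda>x. spec t f x - f x) = 0) at_top"
      using eventually_ge_at_top [of "1 :: real"]
      by eventually_elim (simp add: spec_def l2_norm_def)
  qed
  show "((\<lambda>t. l2_norm M (\<lambda>x. spec t f x - spec s f x)) \<longlongrightarrow> 0) (at_right s)" if f: "f \<in> L2 M" for f s
  proof -
    consider "s < 0" | "s = 0" | "0 < s" "s < 1" | "1 \<le> s"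
      by linarith
    then show ?thesis
    proof cases
      case 1
      then have "eventually (\<lambda>t. t < 0) (at_right s)"
        by (auto simp: eventually_at_right)
      then have "eventually (\<lambda>t. l2_norm M (\<lambda>x. spec t f x - spec s f x) = 0) (at_right s)"
        by eventually_elim (use 1 in \<open>simp add: spec_def l2_norm_def\<close>)
      then show ?thesis
        by (rule tendsto_eventually)
    next
      \<comment> \<open>At 0 right-continuity is not a matter of shrinking balls to a ball: it says
        that averages over small balls tend to f, which is density.\<close>
      case 2
      have "eventually (\<lambda>t. t \<in> {0<..<1}) (at_right (0 :: real))"
        by (rule eventually_at_right_real) simp
      then have "eventually (\<lambda>t. l2_norm M (\<lambda>x. f x - avg t f x) = l2_norm M (\<lambda>x. spec t f x - spec s f x)) (at_right 0)"
        by eventually_elim (use 2 in \<open>simp add: spec_def\<close>)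
      with avg_tendsto_identity [OF f] show ?thesis
        unfolding 2 by (rule Lim_transform_eventually)
    next
      case 3
      have "eventually (\<lambda>t. t \<in> {s<..<1}) (at_right s)"
        using 3 by (intro eventually_at_right_real)
      then have "eventually (\<lambda>t. l2_norm M (\<lambda>x. avg s f x - avg t f x) = l2_norm M (\<lambda>x. spec t f x - spec s f x)) (at_right s)"
        by eventually_elim (use 3 in \<open>simp add: spec_def\<close>)
      with avg_right_continuous [OF 3 f] show ?thesis
        by (rule Lim_transform_eventually)
    next
      case 4
      have "eventually (\<lambda>t. s < t) (at_right s)"
        by (simp add: eventually_at_filter)
      then have "eventually (\<lambda>t. l2_norm M (\<lambda>x. spec t f x - spec s f x) = 0) (at_right s)"
        by eventually_elim (use 4 in \<open>simp add: spec_def l2_norm_def\<close>)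
      then show ?thesis
        by (rule tendsto_eventually)
    qed
  qed
qed

sublocale spec: resolution M spec
  by unfold_locales (rule resolution_spec)

text \<open>\<open>spec 0\<close> vanishes and \<open>spec 1\<close> is the identity. Absence of
  mass at 0 is the triviality of the kernel of P; the logarithm is evaluated at positive t
  only.\<close>

lemma AE_distribution_spec:
  assumes g: "g \<in> L2 M"
  shows "AE t in spectral_distribution M spec g. 0 < t \<and> t \<le> 1"
proof -
  have "AE t in spectral_distribution M spec g. 0 < t"
    by (rule AE_I [of _ _ "{..0}"]) (auto simp: spec.emeasure_distribution_atMost [OF g] spec_def)
  moreover have "AE t in spectral_distribution M spec g. t \<le> 1"
    by (rule AE_I [of _ _ "{1<..}"]) (auto simp: spec.emeasure_distribution_greaterThan [OF g] spec_def)
  ultimately show ?thesis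
    by eventually_elim simp
qed

section \<open>The quadratic form of the integrated averages\<close>

lemma measurable_l2_inner_avg [measurable]:
  assumes [measurable]: "f \<in> borel_measurable M" "g \<in> borel_measurable M"
  shows "(\<lambda>t. l2_inner M (avg t f) g) \<in> borel_measurable borel"
  unfolding l2_inner_def by (rule borel_measurable_lebesgue_integral) measurable

lemma measurable_l2_inner_spec:
  assumes g: "g \<in> L2 M"
  shows "(\<lambda>t. l2_inner M (spec t g) g) \<in> borel_measurable borel"
  by (rule borel_measurable_mono) (simp add: mono_def spec.form_mono [OF _ g])

text \<open>Layer cake: t is the length of \<open>{0<..<t}\<close>. After Tonelli the inner integral
  is the mass of \<open>{s<..}\<close>, which is the form of \<open>avg s\<close> for s < 1 and 0
  for s \<ge> 1.\<close>

lemma nn_integral_distribution_spec: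
  assumes g: "g \<in> L2 M"
  shows "(\<integral>\<^sup>+t. ennreal t \<partial>spectral_distribution M spec g) = (\<integral>\<^sup>+t. ennreal (l2_inner M (avg t g) g) \<partial>lborel_on 0 1)"
proof -
  define \<nu> where "\<nu> = spectral_distribution M spec g"
  interpret \<nu>: finite_measure \<nu>
    unfolding \<nu>_def by (rule spec.finite_distribution [OF g])
  interpret pair_sigma_finite \<nu> lborel ..
  note [measurable] = L2_measurable [OF g]
  have [measurable_cong]: "sets \<nu> = sets borel"
    by (simp add: \<nu>_def)
  have "(\<integral>\<^sup>+t. ennreal t \<partial>\<nu>) = (\<integral>\<^sup>+t. (\<integral>\<^sup>+s. (if 0 < s \<and> s < t then 1 else 0) \<partial>lborel) \<partial>\<nu>)"
  proof (rule nn_integral_cong_AE)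
    show "AE t in \<nu>. ennreal t = (\<integral>\<^sup>+s. (if 0 < s \<and> s < t then 1 else 0) \<partial>lborel)"
      using AE_distribution_spec [OF g] unfolding \<nu>_def
    proof eventually_elim
      fix t :: real assume t: "0 < t \<and> t \<le> 1"
      have "(\<integral>\<^sup>+s. (if 0 < s \<and> s < t then 1 else 0) \<partial>lborel) = (\<integral>\<^sup>+s. indicator {0<..<t} s \<partial>lborel)"
        by (intro nn_integral_cong) (auto simp: indicator_def)
      then show "ennreal t = (\<integral>\<^sup>+s. (if 0 < s \<and> s < t then 1 else 0) \<partial>lborel)"
        using t by simp
    qed
  qed
  also have "\<dots> = (\<integral>\<^sup>+s. (\<integral>\<^sup>+t. (if 0 < s \<and> s < t then 1 else 0) \<partial>\<nu>) \<partial>lborel)"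
    by (rule Fubini' [symmetric]) measurable
  also have "\<dots> = (\<integral>\<^sup>+s. indicator {0<..<1} s * ennreal (l2_inner M (avg s g) g) \<partial>lborel)"
  proof (intro nn_integral_cong)
    fix s :: real
    show "(\<integral>\<^sup>+t. (if 0 < s \<and> s < t then 1 else 0) \<partial>\<nu>) = indicator {0<..<1} s * ennreal (l2_inner M (avg s g) g)"
    proof (cases "0 < s")
      case True
      have "(\<integral>\<^sup>+t. (if 0 < s \<and> s < t then 1 else 0) \<partial>\<nu>) = (\<integral>\<^sup>+t. indicator {s<..} t \<partial>\<nu>)"
        using True by (intro nn_integral_cong) (auto simp: indicator_def)
      also have "\<dots> = ennreal (l2_inner M g g - l2_inner M (spec s g) g)"
        unfolding \<nu>_def by (simp add: spec.emeasure_distribution_greaterThan [OF g])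
      also have "\<dots> = indicator {0<..<1} s * ennreal (l2_inner M (avg s g) g)"
        using True g by (auto simp: spec_def l2_inner_linear avg_L2)
      finally show ?thesis .
    qed simp
  qed
  also have "\<dots> = (\<integral>\<^sup>+t. ennreal (l2_inner M (avg t g) g) \<partial>lborel_on 0 1)"
    by (rule nn_integral_lborel_on [symmetric]) measurable
  finally show ?thesis
    by (simp add: \<nu>_def)
qed

lemma integral_distribution_spec:
  assumes g: "g \<in> L2 M"
  shows "(LINT t|spectral_distribution M spec g. t) = (LINT t|lborel_on 0 1. l2_inner M (avg t g) g)"
proof -
  note [measurable] = L2_measurable [OF g]
  have "AE t in spectral_distribution M spec g. 0 \<le> t"
    using AE_distribution_spec [OF g] by eventually_elim simp
  then have 1: "(LINT t|spectral_distribution M spec g. t) = enn2real (\<integral>\<^sup>+t. ennreal t \<partial>spectral_distribution M spec g)"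
    by (intro integral_eq_nn_integral) simp_all
  have "AE t in lborel_on 0 1. 0 \<le> l2_inner M (avg t g) g"
    using AE_lborel_on by eventually_elim (use g in \<open>simp add: l2_inner_avg_self [symmetric]\<close>)
  then have 2: "(LINT t|lborel_on 0 1. l2_inner M (avg t g) g)
      = enn2real (\<integral>\<^sup>+t. ennreal (l2_inner M (avg t g) g) \<partial>lborel_on 0 1)"
    by (intro integral_eq_nn_integral) simp_all
  show ?thesis
    unfolding 1 2 nn_integral_distribution_spec [OF g] ..
qed

text \<open>The operator \<open>\<integral> avg t dt\<close> over the unit interval has spectral resolution \<open>spec\<close>, by partial
  integration of \<open>\<integral> t d(spec t)\<close>.\<close>

lemma nonneg_spectral_resolution_spec:
  assumes A: "\<And>f. f \<in> L2 M \<Longrightarrow> A f = (\<lambda>x. LINT t|lborel_on 0 1. avg t f x)"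
  shows "nonneg_spectral_resolution M spec A"
proof -
  have meas: "case_prod (\<lambda>t. avg t f) \<in> borel_measurable (lborel_on 0 1 \<Otimes>\<^sub>M M)" if "f \<in> L2 M" for f
  proof -
    note [measurable] = L2_measurable [OF that]
    show ?thesis
      by measurable
  qed
  have bound: "AE t in lborel_on 0 1. avg t f \<in> L2 M \<and> l2_inner M (avg t f) (avg t f) \<le> l2_inner M f f"
    if "f \<in> L2 M" for f
    using AE_lborel_on by eventually_elim (use that in \<open>simp add: avg_L2 avg_contraction\<close>)
  note L2_integral = L2_integral [OF finite_lborel_on sigma_finite_measure_axioms meas bound]
    and l2_inner_integral = l2_inner_integral [OF finite_lborel_on sigma_finite_measure_axioms meas bound]
    and integrable_l2_inner = integrable_l2_inner [OF finite_lborel_on sigma_finite_measure_axioms meas bound]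
  have AL2: "A f \<in> L2 M" if "f \<in> L2 M" for f
    unfolding A [OF that] by (rule L2_integral [OF that that])
  have inner: "l2_inner M (A f) h = (LINT t|lborel_on 0 1. l2_inner M (avg t f) h)"
    if "f \<in> L2 M" "h \<in> L2 M" for f h
    unfolding A [OF that(1)] by (rule l2_inner_integral [OF that(1,1,2)])
  have int: "integrable (lborel_on 0 1) (\<lambda>t. l2_inner M (avg t f) h)" if "f \<in> L2 M" "h \<in> L2 M" for f h
    by (rule integrable_l2_inner [OF that(1,1,2)])
  have dom: "f \<in> spectral_domain M spec (\<lambda>t. t)" if f: "f \<in> L2 M" for f
  proof -
    interpret \<nu>: finite_measure "spectral_distribution M spec f"
      by (rule spec.finite_distribution [OF f])
    have "AE t in spectral_distribution M spec f. norm (t\<^sup>2) \<le> 1"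
      using AE_distribution_spec [OF f] by eventually_elim (simp add: power_le_one)
    then have "integrable (spectral_distribution M spec f) (\<lambda>t. t\<^sup>2)"
      by (rule \<nu>.integrable_const_bound) simp
    then show ?thesis
      using f by (simp add: spectral_domain_def)
  qed
  have "spectral_integral M spec (\<lambda>t. t) f (A f)" if f: "f \<in> L2 M" for f
    unfolding spectral_integral_def
  proof (intro conjI ballI dom f AL2)
    fix h assume "h \<in> spectral_domain M spec (\<lambda>t. t)"
    then have h: "h \<in> L2 M"
      by (simp add: spectral_domain_def)
    have "(LINT t|spectral_distribution M spec (\<lambda>x. f x + h x). t) - (LINT t|spectral_distribution M spec (\<lambda>x. f x - h x). t)
        = (LINT t|lborel_on 0 1. l2_inner M (avg t (\<lambda>x. f x + h x)) (\<lambda>x. f x + h x)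
            - l2_inner M (avg t (\<lambda>x. f x - h x)) (\<lambda>x. f x - h x))"
      using f h int by (simp add: integral_distribution_spec L2_add L2_diff)
    \<comment> \<open>Polarization of the symmetric form of \<open>avg t\<close>, under the
      integral.\<close>
    also have "\<dots> = (LINT t|lborel_on 0 1. 4 * l2_inner M (avg t f) h)"
    proof (rule integral_cong_AE)
      show "AE t in lborel_on 0 1. l2_inner M (avg t (\<lambda>x. f x + h x)) (\<lambda>x. f x + h x)
            - l2_inner M (avg t (\<lambda>x. f x - h x)) (\<lambda>x. f x - h x) = 4 * l2_inner M (avg t f) h"
        using AE_lborel_on
      proof eventually_elim
        fix t :: real assume t: "0 < t \<and> t < 1"
        have "l2_inner M (avg t h) f = l2_inner M (avg t f) h"
          using t f h by (simp add: avg_symmetric l2_inner_commute [of M h])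
        moreover have "avg t (\<lambda>x. f x + h x) = (\<lambda>x. avg t f x + avg t h x)"
            "avg t (\<lambda>x. f x - h x) = (\<lambda>x. avg t f x - avg t h x)"
          using t f h by (auto simp: avg_add avg_diff)
        ultimately show "l2_inner M (avg t (\<lambda>x. f x + h x)) (\<lambda>x. f x + h x)
            - l2_inner M (avg t (\<lambda>x. f x - h x)) (\<lambda>x. f x - h x) = 4 * l2_inner M (avg t f) h"
          using t f h by (simp add: l2_inner_linear avg_L2)
      qed
    qed (use f h in measurable)
    also have "\<dots> = 4 * l2_inner M (A f) h"
      by (simp add: inner [OF f h])
    finally show "l2_inner M (A f) h = ((LINT t|spectral_distribution M spec (\<lambda>x. f x + h x). t) -
           (LINT t|spectral_distribution M spec (\<lambda>x. f x - h x). t)) / 4"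
      by simp
  qed
  then have "is_spectral_resolution_of M A spec"
    by (simp add: is_spectral_resolution_of_def resolution_spec)
  moreover have "0 \<le> l2_inner M (A f) f" if f: "f \<in> L2 M" for f
  proof -
    have "AE t in lborel_on 0 1. 0 \<le> l2_inner M (avg t f) f"
      using AE_lborel_on by eventually_elim (use f in \<open>simp add: l2_inner_avg_self [symmetric]\<close>)
    then show ?thesis
      unfolding inner [OF f f] by (rule integral_nonneg_AE)
  qed
  ultimately show ?thesis
    by unfold_locales
qed

subsection \<open>The logarithm\<close>

definition log_form :: "('a \<Rightarrow> real) \<Rightarrow> real \<Rightarrow> real" where
  "log_form g \<tau> = indicator {0<..} \<tau> * l2_inner M (spec (exp (- \<tau>)) g) g"

lemma log_form_nonneg: "g \<in> L2 M \<Longrightarrow> 0 \<le> log_form g \<tau>"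
  using spec.idempotent [of g g "exp (- \<tau>)"] l2_inner_self_nonneg [of M "spec (exp (- \<tau>)) g"]
  by (simp add: log_form_def indicator_def)

lemma measurable_log_form: "g \<in> L2 M \<Longrightarrow> log_form g \<in> borel_measurable borel"
  unfolding log_form_def using measurable_compose [OF _ measurable_l2_inner_spec, of "\<lambda>\<tau>. exp (- \<tau>)" borel g]
  by measurable

text \<open>Layer cake with the non-strict condition \<open>t \<le> exp (- \<tau>)\<close>, so that
  Tonelli produces the mass of \<open>{..exp (- \<tau>)}\<close>, which is the form of
  \<open>spec\<close> itself. Both sides may be infinite.\<close>

lemma nn_integral_ln_distribution_spec:
  assumes g: "g \<in> L2 M"
  shows "(\<integral>\<^sup>+t. ennreal (ln (1 / t)) \<partial>spectral_distribution M spec g) = (\<integral>\<^sup>+\<tau>. ennreal (log_form g \<tau>) \<partial>lborel)"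
proof -
  define \<nu> where "\<nu> = spectral_distribution M spec g"
  interpret \<nu>: finite_measure \<nu>
    unfolding \<nu>_def by (rule spec.finite_distribution [OF g])
  interpret pair_sigma_finite \<nu> lborel ..
  have [measurable_cong]: "sets \<nu> = sets borel"
    by (simp add: \<nu>_def)
  have "(\<integral>\<^sup>+t. ennreal (ln (1 / t)) \<partial>\<nu>) = (\<integral>\<^sup>+t. (\<integral>\<^sup>+\<tau>. (if 0 < \<tau> \<and> t \<le> exp (- \<tau>) then 1 else 0) \<partial>lborel) \<partial>\<nu>)"
  proof (rule nn_integral_cong_AE)
    show "AE t in \<nu>. ennreal (ln (1 / t)) = (\<integral>\<^sup>+\<tau>. (if 0 < \<tau> \<and> t \<le> exp (- \<tau>) then 1 else 0) \<partial>lborel)"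
      using AE_distribution_spec [OF g] unfolding \<nu>_def
    proof eventually_elim
      fix t :: real assume t: "0 < t \<and> t \<le> 1"
      have "t \<le> exp (- \<tau>) \<longleftrightarrow> \<tau> \<le> ln (1 / t)" for \<tau>
      proof -
        have "t \<le> exp (- \<tau>) \<longleftrightarrow> ln t \<le> - \<tau>"
          using t by (metis exp_le_cancel_iff exp_ln)
        then show ?thesis
          using t by (auto simp: ln_div)
      qed
      then have "(\<integral>\<^sup>+\<tau>. (if 0 < \<tau> \<and> t \<le> exp (- \<tau>) then 1 else 0) \<partial>lborel) = (\<integral>\<^sup>+\<tau>. indicator {0<..ln (1 / t)} \<tau> \<partial>lborel)"
        by (intro nn_integral_cong) (auto simp: indicator_def)
      also have "\<dots> = ennreal (ln (1 / t))"
        using t by simp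
      finally show "ennreal (ln (1 / t)) = (\<integral>\<^sup>+\<tau>. (if 0 < \<tau> \<and> t \<le> exp (- \<tau>) then 1 else 0) \<partial>lborel)"
        by simp
    qed
  qed
  also have "\<dots> = (\<integral>\<^sup>+\<tau>. (\<integral>\<^sup>+t. (if 0 < \<tau> \<and> t \<le> exp (- \<tau>) then 1 else 0) \<partial>\<nu>) \<partial>lborel)"
    by (rule Fubini' [symmetric]) measurable
  also have "\<dots> = (\<integral>\<^sup>+\<tau>. ennreal (log_form g \<tau>) \<partial>lborel)"
  proof (intro nn_integral_cong)
    fix \<tau> :: real
    show "(\<integral>\<^sup>+t. (if 0 < \<tau> \<and> t \<le> exp (- \<tau>) then 1 else 0) \<partial>\<nu>) = ennreal (log_form g \<tau>)"
    proof (cases "0 < \<tau>")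
      case True
      have "(\<integral>\<^sup>+t. (if 0 < \<tau> \<and> t \<le> exp (- \<tau>) then 1 else 0) \<partial>\<nu>) = (\<integral>\<^sup>+t. indicator {..exp (- \<tau>)} t \<partial>\<nu>)"
        using True by (intro nn_integral_cong) (auto simp: indicator_def)
      also have "\<dots> = ennreal (log_form g \<tau>)"
        using True unfolding \<nu>_def by (simp add: spec.emeasure_distribution_atMost [OF g] log_form_def)
      finally show ?thesis .
    qed (simp add: log_form_def)
  qed
  finally show ?thesis
    by (simp add: \<nu>_def)
qed

lemma ln_nonneg_distribution_spec:
  assumes "g \<in> L2 M"
  shows "AE t in spectral_distribution M spec g. 0 \<le> ln (1 / t)"
  using AE_distribution_spec [OF assms] by eventually_elim simp

lemma integral_ln_distribution_spec:
  assumes g: "g \<in> L2 M"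
  shows "(LINT t|spectral_distribution M spec g. ln (1 / t)) = (LINT \<tau>|lborel. log_form g \<tau>)"
proof -
  have 1: "(LINT t|spectral_distribution M spec g. ln (1 / t))
      = enn2real (\<integral>\<^sup>+t. ennreal (ln (1 / t)) \<partial>spectral_distribution M spec g)"
    by (intro integral_eq_nn_integral ln_nonneg_distribution_spec g) measurable
  have 2: "(LINT \<tau>|lborel. log_form g \<tau>) = enn2real (\<integral>\<^sup>+\<tau>. ennreal (log_form g \<tau>) \<partial>lborel)"
    using measurable_log_form [OF g]
    by (intro integral_eq_nn_integral AE_I2 log_form_nonneg g) simp
  show ?thesis
    unfolding 1 2 nn_integral_ln_distribution_spec [OF g] ..
qed

text \<open>The operator domain lies in the form domain: on a finite measure square-integrability
  implies integrability.\<close>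

lemma integrable_log_form:
  assumes "g \<in> spectral_domain M spec (\<lambda>t. ln (1 / t))"
  shows "integrable lborel (log_form g)"
proof -
  have g: "g \<in> L2 M" and sq: "integrable (spectral_distribution M spec g) (\<lambda>t. (ln (1 / t))\<^sup>2)"
    using assms by (auto simp: spectral_domain_def)
  interpret \<nu>: finite_measure "spectral_distribution M spec g"
    by (rule spec.finite_distribution [OF g])
  have "integrable (spectral_distribution M spec g) (\<lambda>t. ln (1 / t))"
    by (rule \<nu>.square_integrable_imp_integrable [OF _ sq]) measurable
  then have "(\<integral>\<^sup>+t. ennreal (ln (1 / t)) \<partial>spectral_distribution M spec g) < \<infinity>"
    using nn_integral_eq_integral [OF _ ln_nonneg_distribution_spec [OF g]] by simp
  then have "(\<integral>\<^sup>+\<tau>. ennreal (log_form g \<tau>) \<partial>lborel) < \<infinity>"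
    by (simp add: nn_integral_ln_distribution_spec [OF g])
  then show ?thesis
    using measurable_log_form [OF g] by (intro integrableI_nonneg AE_I2 log_form_nonneg g) simp_all
qed

text \<open>An f constant on balls of radius t0 is fixed by \<open>avg t0\<close>, so its
  distribution lives on t0 < t \<le> 1, where the logarithm is bounded.\<close>

lemma locally_constant_subset_domain: "locally_constant \<subseteq> spectral_domain M spec (\<lambda>t. ln (1 / t))"
proof
  fix f assume "f \<in> locally_constant"
  then obtain t0 where f: "f \<in> L2 M" and t0: "0 < t0" "t0 < 1"
    and const: "\<And>x y. u x y \<le> t0 \<Longrightarrow> f x = f y"
    unfolding locally_constant_def by blast
  interpret \<nu>: finite_measure "spectral_distribution M spec f"
    by (rule spec.finite_distribution [OF f])
  have "avg t0 f x = f x" for x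
    using const [of x] by (intro avg_const_on_ball t0) metis
  then have "spec t0 f = (\<lambda>x. 0)"
    using t0 by (simp add: spec_def)
  then have "AE t in spectral_distribution M spec f. t0 < t"
    by (intro AE_I [of _ _ "{..t0}"]) (auto simp: spec.emeasure_distribution_atMost [OF f])
  with AE_distribution_spec [OF f]
  have "AE t in spectral_distribution M spec f. norm ((ln (1 / t))\<^sup>2) \<le> (ln (1 / t0))\<^sup>2"
  proof eventually_elim
    fix t assume t: "0 < t \<and> t \<le> 1" "t0 < t"
    have "0 \<le> ln (1 / t)" "ln (1 / t) \<le> ln (1 / t0)"
      using t t0 by (auto simp: ln_div)
    then show "norm ((ln (1 / t))\<^sup>2) \<le> (ln (1 / t0))\<^sup>2"
      by simp
  qed
  then have "integrable (spectral_distribution M spec f) (\<lambda>t. (ln (1 / t))\<^sup>2)"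
    by (rule \<nu>.integrable_const_bound) measurable
  then show "f \<in> spectral_domain M spec (\<lambda>t. ln (1 / t))"
    using f by (simp add: spectral_domain_def)
qed

section \<open>The logarithm on functions constant on balls of radius exp (-T)\<close>

context
  fixes f :: "'a \<Rightarrow> real" and T :: real
  assumes f: "f \<in> L2 M" and T: "0 < T" and const: "\<And>x y. u x y \<le> exp (- T) \<Longrightarrow> f x = f y"
begin

lemma in_domain: "f \<in> spectral_domain M spec (\<lambda>t. ln (1 / t))"
proof -
  have "f \<in> locally_constant"
    unfolding locally_constant_def using f T const by (auto intro!: exI [of _ "exp (- T)"])
  then show ?thesis
    using locally_constant_subset_domain by blast
qed

lemma avg_exp_eq: "T \<le> \<tau> \<Longrightarrow> avg (exp (- \<tau>)) f x = f x"
proof (rule avg_const_on_ball)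
  show "f y = f x" if "T \<le> \<tau>" "u x y \<le> exp (- \<tau>)" for y
    using that by (intro const [symmetric]) (simp add: order_trans [of _ "exp (- \<tau>)"])
qed (use T in auto)

text \<open>\<open>ln (1 / t)\<close> is the length of the interval of all \<open>\<tau> > 0\<close> with \<open>t \<le> exp (- \<tau>)\<close>, so that
  \<open>\<integral> ln (1 / t) d(spec t)\<close> equals \<open>\<integral> spec (exp (- \<tau>)) d\<tau>\<close>.\<close>

lemma spectral_integral_ln_spec:
  "spectral_integral M spec (\<lambda>t. ln (1 / t)) f (\<lambda>x. LINT \<tau>|lborel_on 0 T. f x - avg (exp (- \<tau>)) f x)"
  unfolding spectral_integral_def
proof (intro conjI ballI)
  define G where "G x = (LINT \<tau>|lborel_on 0 T. f x - avg (exp (- \<tau>)) f x)" for x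
  note [measurable] = L2_measurable [OF f]
  have meas: "case_prod (\<lambda>\<tau> x. f x - avg (exp (- \<tau>)) f x) \<in> borel_measurable (lborel_on 0 T \<Otimes>\<^sub>M M)"
    by measurable
  have bound: "AE \<tau> in lborel_on 0 T. (\<lambda>x. f x - avg (exp (- \<tau>)) f x) \<in> L2 M \<and>
      l2_inner M (\<lambda>x. f x - avg (exp (- \<tau>)) f x) (\<lambda>x. f x - avg (exp (- \<tau>)) f x) \<le> l2_inner M f f"
    using AE_lborel_on
  proof eventually_elim
    fix \<tau> assume "0 < \<tau> \<and> \<tau> < T"
    then show "(\<lambda>x. f x - avg (exp (- \<tau>)) f x) \<in> L2 M \<and>
      l2_inner M (\<lambda>x. f x - avg (exp (- \<tau>)) f x) (\<lambda>x. f x - avg (exp (- \<tau>)) f x) \<le> l2_inner M f f"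
      using f by (simp add: L2_diff avg_L2 l2_inner_diff_avg flip: l2_inner_avg_self)
  qed
  note hyps = finite_lborel_on sigma_finite_measure_axioms meas bound
  show "f \<in> spectral_domain M spec (\<lambda>t. ln (1 / t))"
    by (rule in_domain)
  show "(\<lambda>x. LINT \<tau>|lborel_on 0 T. f x - avg (exp (- \<tau>)) f x) \<in> L2 M"
    by (rule L2_integral [OF hyps])
  fix h assume hdom: "h \<in> spectral_domain M spec (\<lambda>t. ln (1 / t))"
  then have h: "h \<in> L2 M"
    by (simp add: spectral_domain_def)
  define c where "c \<tau> = l2_inner M (\<lambda>x. f x - avg (exp (- \<tau>)) f x) h" for \<tau>
  have [measurable]: "c \<in> borel_measurable borel"
    using borel_measurable_integrable [OF integrable_l2_inner [OF hyps h]] by (simp add: c_def [abs_def] cong: measurable_cong_sets)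
  have inner: "l2_inner M G h = (LINT \<tau>|lborel. indicator {0<..<T} \<tau> * c \<tau>)"
    unfolding G_def by (simp add: l2_inner_integral [OF hyps h] integral_lborel_on flip: c_def)
  \<comment> \<open>For \<tau> \<ge> T the average fixes f. The half-line thus shrinks to a bounded
    interval, whatever h is.\<close>
  have cross: "indicator {0<..} \<tau> * l2_inner M (spec (exp (- \<tau>)) f) h = indicator {0<..<T} \<tau> * c \<tau>" for \<tau>
  proof (cases "0 < \<tau> \<and> T \<le> \<tau>")
    case True
    then have "spec (exp (- \<tau>)) f = (\<lambda>x. 0)"
      by (simp add: spec_def avg_exp_eq)
    then show ?thesis
      using True by simp
  qed (auto simp: indicator_def spec_def c_def)
  have expand: "log_form (\<lambda>x. f x + h x) \<tau> = log_form f \<tau> + log_form h \<tau> + 2 * (indicator {0<..<T} \<tau> * c \<tau>)"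
      "log_form (\<lambda>x. f x - h x) \<tau> = log_form f \<tau> + log_form h \<tau> - 2 * (indicator {0<..<T} \<tau> * c \<tau>)" for \<tau>
  proof -
    have "l2_inner M (spec t h) f = l2_inner M (spec t f) h" for t
      using f h by (simp add: spec.symmetric l2_inner_commute [of M h])
    moreover have add: "l2_inner M (spec t (\<lambda>x. f x + h x)) g = l2_inner M (spec t f) g + l2_inner M (spec t h) g"
      and diff: "l2_inner M (spec t (\<lambda>x. f x - h x)) g = l2_inner M (spec t f) g - l2_inner M (spec t h) g"
      if "g \<in> L2 M" for t g
      using f h that by (simp_all add: spec.symmetric l2_inner_linear)
    ultimately show "log_form (\<lambda>x. f x + h x) \<tau> = log_form f \<tau> + log_form h \<tau> + 2 * (indicator {0<..<T} \<tau> * c \<tau>)"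
      "log_form (\<lambda>x. f x - h x) \<tau> = log_form f \<tau> + log_form h \<tau> - 2 * (indicator {0<..<T} \<tau> * c \<tau>)"
      unfolding cross [symmetric] log_form_def using f h
      by (simp_all add: add diff l2_inner_linear algebra_simps)
  qed
  have fi: "integrable lborel (log_form f)" and hi: "integrable lborel (log_form h)"
    by (intro integrable_log_form in_domain hdom)+
  \<comment> \<open>Nonnegativity of the forms at f + h and f - h bounds the cross term by the two
    diagonal ones, which are integrable as f and h lie in the domain.\<close>
  have ci: "integrable lborel (\<lambda>\<tau>. indicator {0<..<T} \<tau> * c \<tau>)"
  proof (rule Bochner_Integration.integrable_bound)
    show "integrable lborel (\<lambda>\<tau>. log_form f \<tau> + log_form h \<tau>)"
      using fi hi by simp
    have "\<bar>indicator {0<..<T} \<tau> * c \<tau>\<bar> \<le> log_form f \<tau> + log_form h \<tau>" for \<tau>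
      using expand [of \<tau>] log_form_nonneg [OF L2_add [OF f h], of \<tau>] log_form_nonneg [OF L2_diff [OF f h], of \<tau>]
        log_form_nonneg [OF f, of \<tau>] log_form_nonneg [OF h, of \<tau>] by linarith
    then show "AE \<tau> in lborel. norm (indicator {0<..<T} \<tau> * c \<tau>) \<le> norm (log_form f \<tau> + log_form h \<tau>)"
      by (intro AE_I2) (use order_trans abs_ge_self in fastforce)
  qed measurable
  have "(LINT t|spectral_distribution M spec (\<lambda>x. f x + h x). ln (1 / t))
      = (LINT \<tau>|lborel. log_form f \<tau>) + (LINT \<tau>|lborel. log_form h \<tau>) + 2 * l2_inner M G h"
    unfolding inner using fi hi ci f h by (simp add: integral_ln_distribution_spec L2_add expand)
  moreover have "(LINT t|spectral_distribution M spec (\<lambda>x. f x - h x). ln (1 / t))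
      = (LINT \<tau>|lborel. log_form f \<tau>) + (LINT \<tau>|lborel. log_form h \<tau>) - 2 * l2_inner M G h"
    unfolding inner using fi hi ci f h by (simp add: integral_ln_distribution_spec L2_diff expand)
  ultimately show "l2_inner M (\<lambda>x. LINT \<tau>|lborel_on 0 T. f x - avg (exp (- \<tau>)) f x) h =
      ((LINT t|spectral_distribution M spec (\<lambda>x. f x + h x). ln (1 / t)) -
       (LINT t|spectral_distribution M spec (\<lambda>x. f x - h x). ln (1 / t))) / 4"
    by (simp add: G_def [abs_def])
qed

text \<open>Fubini for \<open>(f x - f y) * avg_kernel (exp (- \<tau>)) x y\<close>: integrating in
  y first gives f - avg f at x, as the kernel has mass 1; integrating in \<tau> first gives the
  truncated jump kernel. This holds at every x.\<close>

lemma
  shows integrable_jump: "integrable M (\<lambda>y. (f x - f y) * (LINT \<tau>|lborel_on 0 T. avg_kernel (exp (- \<tau>)) x y))"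
    and integral_jump: "(LINT y|M. (f x - f y) * (LINT \<tau>|lborel_on 0 T. avg_kernel (exp (- \<tau>)) x y)) =
      (LINT \<tau>|lborel_on 0 T. f x - avg (exp (- \<tau>)) f x)"
proof -
  interpret N: finite_measure "lborel_on 0 T"
    by (rule finite_lborel_on)
  interpret NM: pair_sigma_finite "lborel_on 0 T" M ..
  note [measurable] = L2_measurable [OF f]
  have [measurable]: "x \<in> space M"
    by (simp add: space_UNIV)
  define W where "W \<tau> y = (f x - f y) * avg_kernel (exp (- \<tau>)) x y" for \<tau> y
  \<comment> \<open>From |d| \<le> 1 + d^2 with d = f x - f y, from d^2 \<le> 2 (f x)^2 + 2 (f y)^2,
    and from bounding the kernel in the last term by the inverse volume of the smallest ball, at
    \<tau> = T.\<close>
  define C where "C = 1 + 2 * (f x)\<^sup>2 + 2 * (l2_inner M f f / vol (exp (- T)) x)"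
  have W [measurable]: "case_prod W \<in> borel_measurable (lborel_on 0 T \<Otimes>\<^sub>M M)"
    unfolding W_def by measurable
  have C: "(\<integral>\<^sup>+y. ennreal (norm (W \<tau> y)) \<partial>M) \<le> ennreal C" if \<tau>: "0 < \<tau>" "\<tau> < T" for \<tau>
  proof -
    define k where "k = avg_kernel (exp (- \<tau>)) x"
    have v: "0 < vol (exp (- T)) x" "vol (exp (- T)) x \<le> vol (exp (- \<tau>)) x"
      using \<tau> T by (auto intro!: vol_positive vol_mono)
    have k: "k y \<le> 1 / vol (exp (- T)) x" for y
      using v by (auto simp: k_def avg_kernel_def intro!: divide_left_mono mult_pos_pos)
    have "norm (W \<tau> y) \<le> k y * (1 + 2 * (f x)\<^sup>2) + 2 * (f y)\<^sup>2 / vol (exp (- T)) x" for y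
    proof -
      have "\<bar>d\<bar> \<le> 1 + d\<^sup>2" for d :: real
        using sum_squares_bound [of 1 "\<bar>d\<bar>"] by simp
      moreover have "(f x - f y)\<^sup>2 \<le> 2 * (f x)\<^sup>2 + 2 * (f y)\<^sup>2"
        using zero_le_power2 [of "f x + f y"] by (simp add: power2_sum power2_diff)
      ultimately have "\<bar>f x - f y\<bar> \<le> 1 + 2 * (f x)\<^sup>2 + 2 * (f y)\<^sup>2"
        by (smt (verit))
      then have "norm (W \<tau> y) \<le> (1 + 2 * (f x)\<^sup>2 + 2 * (f y)\<^sup>2) * k y"
        unfolding W_def k_def by (simp add: abs_mult mult_right_mono)
      also have "\<dots> = k y * (1 + 2 * (f x)\<^sup>2) + k y * (2 * (f y)\<^sup>2)"
        by (simp add: algebra_simps)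
      also have "k y * (2 * (f y)\<^sup>2) \<le> 1 / vol (exp (- T)) x * (2 * (f y)\<^sup>2)"
        by (intro mult_right_mono k) simp
      finally show ?thesis
        by simp
    qed
    then have "(\<integral>\<^sup>+y. ennreal (norm (W \<tau> y)) \<partial>M)
        \<le> (\<integral>\<^sup>+y. ennreal (k y * (1 + 2 * (f x)\<^sup>2) + 2 * (f y)\<^sup>2 / vol (exp (- T)) x) \<partial>M)"
      by (intro nn_integral_mono ennreal_leI)
    also have "\<dots> = ennreal (LINT y|M. k y * (1 + 2 * (f x)\<^sup>2) + 2 * (f y)\<^sup>2 / vol (exp (- T)) x)"
      using \<tau> v L2_square_integrable [OF f]
      by (intro nn_integral_eq_integral AE_I2) (auto simp: k_def integrable_avg_kernel)
    also have "(LINT y|M. k y * (1 + 2 * (f x)\<^sup>2) + 2 * (f y)\<^sup>2 / vol (exp (- T)) x) = C"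
      using \<tau> L2_square_integrable [OF f]
      by (simp add: k_def C_def integrable_avg_kernel integral_avg_kernel l2_inner_def power2_eq_square)
    finally show ?thesis .
  qed
  have int: "integrable (lborel_on 0 T \<Otimes>\<^sub>M M) (case_prod W)"
  proof (rule integrableI_bounded)
    have "(\<integral>\<^sup>+z. norm (case_prod W z) \<partial>(lborel_on 0 T \<Otimes>\<^sub>M M)) = (\<integral>\<^sup>+\<tau>. (\<integral>\<^sup>+y. norm (W \<tau> y) \<partial>M) \<partial>lborel_on 0 T)"
      using nn_integral_fst [of "\<lambda>z. norm (case_prod W z)" "lborel_on 0 T"] by simp
    also have "\<dots> \<le> (\<integral>\<^sup>+\<tau>. ennreal C \<partial>lborel_on 0 T)"
    proof (rule nn_integral_mono_AE)
      show "AE \<tau> in lborel_on 0 T. (\<integral>\<^sup>+y. norm (W \<tau> y) \<partial>M) \<le> ennreal C"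
        using AE_lborel_on by eventually_elim (use C in simp)
    qed
    also have "\<dots> < \<infinity>"
      using T by (simp add: emeasure_lborel_on ennreal_mult_less_top)
    finally show "(\<integral>\<^sup>+z. norm (case_prod W z) \<partial>(lborel_on 0 T \<Otimes>\<^sub>M M)) < \<infinity>" .
  qed measurable
  have eq: "(LINT \<tau>|lborel_on 0 T. W \<tau> y) = (f x - f y) * (LINT \<tau>|lborel_on 0 T. avg_kernel (exp (- \<tau>)) x y)" for y
    by (simp add: W_def)
  show "integrable M (\<lambda>y. (f x - f y) * (LINT \<tau>|lborel_on 0 T. avg_kernel (exp (- \<tau>)) x y))"
    using NM.integrable_snd [OF int] by (simp add: eq)
  have "(LINT y|M. (f x - f y) * (LINT \<tau>|lborel_on 0 T. avg_kernel (exp (- \<tau>)) x y)) = (LINT \<tau>|lborel_on 0 T. (LINT y|M. W \<tau> y))"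
    using NM.Fubini_integral [OF int] by (simp add: eq)
  also have "\<dots> = (LINT \<tau>|lborel_on 0 T. f x - avg (exp (- \<tau>)) f x)"
  proof (rule integral_cong_AE)
    show "AE \<tau> in lborel_on 0 T. (LINT y|M. W \<tau> y) = f x - avg (exp (- \<tau>)) f x"
      using AE_lborel_on
    proof eventually_elim
      fix \<tau> assume \<tau>: "0 < \<tau> \<and> \<tau> < T"
      have "(LINT y|M. W \<tau> y) = (LINT y|M. avg_kernel (exp (- \<tau>)) x y * f x - avg_kernel (exp (- \<tau>)) x y * f y)"
        by (intro Bochner_Integration.integral_cong) (auto simp: W_def algebra_simps)
      also have "\<dots> = f x - avg (exp (- \<tau>)) f x"
        using \<tau> f by (simp add: integrable_avg_kernel integrable_avg_kernel_mult integral_avg_kernel avg_def)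
      finally show "(LINT y|M. W \<tau> y) = f x - avg (exp (- \<tau>)) f x" .
    qed
    show "(\<lambda>\<tau>. f x - avg (exp (- \<tau>)) f x) \<in> borel_measurable (lborel_on 0 T)"
      by measurable
  qed measurable
  finally show "(LINT y|M. (f x - f y) * (LINT \<tau>|lborel_on 0 T. avg_kernel (exp (- \<tau>)) x y)) =
      (LINT \<tau>|lborel_on 0 T. f x - avg (exp (- \<tau>)) f x)" .
qed

end

end

section \<open>Density of the locally constant functions\<close>

context ultrametric_measure
begin

text \<open>The closure of \<open>locally_constant\<close> in L2. The induction below uses that it
  is a closed linear subspace.\<close>

definition approximable :: "('a \<Rightarrow> real) set" where
  "approximable = {h \<in> L2 M. \<forall>\<epsilon>>0. \<exists>d\<in>locally_constant. l2_norm M (\<lambda>x. h x - d x) < \<epsilon>}"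

lemma locally_constant_L2: "d \<in> locally_constant \<Longrightarrow> d \<in> L2 M"
  by (simp add: locally_constant_def)

lemma locally_constant_zero: "(\<lambda>x. 0) \<in> locally_constant"
  by (auto simp: locally_constant_def intro!: exI [of _ "1 / 2"])

lemma locally_constant_add:
  assumes "c \<in> locally_constant" and "d \<in> locally_constant"
  shows "(\<lambda>x. c x + d x) \<in> locally_constant"
proof -
  obtain s where s: "0 < s" "s < 1" "\<And>x y. u x y \<le> s \<Longrightarrow> c x = c y"
    using assms(1) unfolding locally_constant_def by blast
  obtain t where t: "0 < t" "t < 1" "\<And>x y. u x y \<le> t \<Longrightarrow> d x = d y"
    using assms(2) unfolding locally_constant_def by blast
  have "\<forall>x y. u x y \<le> min s t \<longrightarrow> c x + d x = c y + d y"
    using s(3) t(3) by (metis min.boundedE)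
  then show ?thesis
    using assms s t unfolding locally_constant_def by (auto intro!: exI [of _ "min s t"])
qed

lemma locally_constant_scale:
  assumes "d \<in> locally_constant"
  shows "(\<lambda>x. c * d x) \<in> locally_constant"
proof -
  obtain t where t: "0 < t" "t < 1" "\<And>x y. u x y \<le> t \<Longrightarrow> d x = d y"
    using assms unfolding locally_constant_def by blast
  then have "\<forall>x y. u x y \<le> t \<longrightarrow> c * d x = c * d y"
    by metis
  then show ?thesis
    using assms t unfolding locally_constant_def by blast
qed

lemma approximable_zero: "(\<lambda>x. 0) \<in> approximable"
  using locally_constant_zero by (auto simp: approximable_def l2_norm_def intro!: bexI [of _ "\<lambda>x. 0"])

lemma approximable_limit:
  assumes h: "h \<in> L2 M" and lim: "\<And>\<epsilon>. 0 < \<epsilon> \<Longrightarrow> \<exists>g\<in>approximable. l2_norm M (\<lambda>x. h x - g x) < \<epsilon>"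
  shows "h \<in> approximable"
proof -
  have "\<exists>d\<in>locally_constant. l2_norm M (\<lambda>x. h x - d x) < \<epsilon>" if \<epsilon>: "0 < \<epsilon>" for \<epsilon>
  proof -
    obtain g where g: "g \<in> approximable" "l2_norm M (\<lambda>x. h x - g x) < \<epsilon> / 2"
      using lim [of "\<epsilon> / 2"] \<epsilon> by auto
    then obtain d where d: "d \<in> locally_constant" "l2_norm M (\<lambda>x. g x - d x) < \<epsilon> / 2"
      unfolding approximable_def using \<epsilon> half_gt_zero by blast
    have "l2_norm M (\<lambda>x. h x - d x) < \<epsilon>"
      using l2_norm_triangle3 [of h M g d] g d h by (simp add: approximable_def locally_constant_L2)
    then show ?thesis
      using d(1) by blast
  qed
  then show ?thesis
    using h by (simp add: approximable_def)
qed

lemma approximable_add: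
  assumes f: "f \<in> approximable" and g: "g \<in> approximable"
  shows "(\<lambda>x. f x + g x) \<in> approximable"
proof -
  have L: "f \<in> L2 M" "g \<in> L2 M"
    using f g by (auto simp: approximable_def)
  have "\<exists>d\<in>locally_constant. l2_norm M (\<lambda>x. f x + g x - d x) < \<epsilon>" if \<epsilon>: "0 < \<epsilon>" for \<epsilon>
  proof -
    obtain c where c: "c \<in> locally_constant" "l2_norm M (\<lambda>x. f x - c x) < \<epsilon> / 2"
      using f \<epsilon> half_gt_zero unfolding approximable_def by blast
    obtain d where d: "d \<in> locally_constant" "l2_norm M (\<lambda>x. g x - d x) < \<epsilon> / 2"
      using g \<epsilon> half_gt_zero unfolding approximable_def by blast
    have "l2_norm M (\<lambda>x. (f x - c x) + (g x - d x)) < \<epsilon>"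
      using l2_norm_triangle [of "\<lambda>x. f x - c x" M "\<lambda>x. g x - d x"] c d L
      by (simp add: L2_diff locally_constant_L2)
    then have "l2_norm M (\<lambda>x. f x + g x - (c x + d x)) < \<epsilon>"
      by (simp add: algebra_simps)
    then show ?thesis
      by (intro bexI [OF _ locally_constant_add [OF c(1) d(1)]])
  qed
  then show ?thesis
    using L by (simp add: approximable_def L2_add)
qed

lemma approximable_scale:
  assumes f: "f \<in> approximable"
  shows "(\<lambda>x. c * f x) \<in> approximable"
proof (cases "c = 0")
  case False
  have L: "f \<in> L2 M"
    using f by (simp add: approximable_def)
  have "\<exists>d\<in>locally_constant. l2_norm M (\<lambda>x. c * f x - d x) < \<epsilon>" if \<epsilon>: "0 < \<epsilon>" for \<epsilon>
  proof -
    have "0 < \<epsilon> / \<bar>c\<bar>"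
      using \<epsilon> False by simp
    then obtain d where d: "d \<in> locally_constant" "l2_norm M (\<lambda>x. f x - d x) < \<epsilon> / \<bar>c\<bar>"
      using f unfolding approximable_def by blast
    have "l2_norm M (\<lambda>x. c * (f x - d x)) < \<epsilon>"
      using d(2) False by (simp only: l2_norm_scale) (simp add: field_simps)
    then have "l2_norm M (\<lambda>x. c * f x - c * d x) < \<epsilon>"
      by (simp only: right_diff_distrib)
    then show ?thesis
      by (intro bexI [OF _ locally_constant_scale [OF d(1)]])
  qed
  then show ?thesis
    using L by (simp add: approximable_def L2_scale)
qed (simp add: approximable_zero)

text \<open>Indicators generate the nonnegative measurable functions by scaling, sums and monotone
  limits. Membership in L2 is a premise inside the induction, as the induction runs over all
  measurable functions; the pieces inherit it from the whole. Signed functions are split into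
  positive and negative parts.\<close>

lemma locally_constant_denseI:
  assumes indicator: "\<And>A. A \<in> sets M \<Longrightarrow> emeasure M A < \<infinity> \<Longrightarrow> indicator A \<in> approximable"
  shows "L2 M \<subseteq> approximable"
proof
  have nonneg: "f \<in> L2 M \<longrightarrow> f \<in> approximable" if "f \<in> borel_measurable M" "\<And>x. 0 \<le> f x" for f
    using that
  proof (induction rule: borel_measurable_induct_real)
    case (set A)
    have "emeasure M A < \<infinity>" if "(indicator A :: 'a \<Rightarrow> real) \<in> L2 M"
      using that set by (simp add: indicator_L2_iff)
    then show ?case
      using indicator [OF set] by blast
  next
    case (mult g c)
    show ?case
    proof (cases "c = 0")
      case False
      have "g \<in> L2 M" if "(\<lambda>x. c * g x) \<in> L2 M"
        using L2_scale [OF that, of "1 / c"] False by simp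
      then show ?thesis
        using mult approximable_scale by blast
    qed (simp add: approximable_zero)
  next
    case (add g h)
    have "g \<in> L2 M" "h \<in> L2 M" if "(\<lambda>x. h x + g x) \<in> L2 M"
      using add by (auto intro!: L2_bound [OF that])
    then show ?case
      using add approximable_add by blast
  next
    case (seq U)
    show ?case
    proof
      assume f: "f \<in> L2 M"
      note [measurable] = seq.hyps(1) L2_measurable [OF f]
      have le: "U i x \<le> f x" for i x
      proof (rule incseq_le)
        show "incseq (\<lambda>i. U i x)"
          using seq.hyps(3) by (auto simp: incseq_def le_fun_def)
        show "(\<lambda>i. U i x) \<longlonglongrightarrow> f x"
          using seq.hyps(4) by (simp add: space_UNIV)
      qed
      have UL: "U i \<in> L2 M" for i
        by (rule L2_bound [OF f]) (use seq.hyps(2) order_trans [OF le abs_ge_self] in auto)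
      have "(\<lambda>i. LINT x|M. (f x - U i x)\<^sup>2) \<longlonglongrightarrow> (LINT x|M. 0)"
      proof (rule integral_dominated_convergence)
        show "integrable M (\<lambda>x. (f x)\<^sup>2)"
          by (rule L2_square_integrable [OF f])
        show "AE x in M. norm ((f x - U i x)\<^sup>2) \<le> (f x)\<^sup>2" for i
          using le seq.hyps(2) by (auto intro!: AE_I2 power_mono)
        have "(\<lambda>i. (f x - U i x)\<^sup>2) \<longlonglongrightarrow> (f x - f x)\<^sup>2" for x
          using seq.hyps(4) by (intro tendsto_power tendsto_diff tendsto_const) (simp add: space_UNIV)
        then show "AE x in M. (\<lambda>i. (f x - U i x)\<^sup>2) \<longlonglongrightarrow> 0"
          by simp
      qed simp_all
      then have "(\<lambda>i. sqrt (LINT x|M. (f x - U i x)\<^sup>2)) \<longlonglongrightarrow> sqrt (LINT x|M. 0)"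
        by (rule tendsto_real_sqrt)
      then have lim: "(\<lambda>i. l2_norm M (\<lambda>x. f x - U i x)) \<longlonglongrightarrow> 0"
        by (simp add: l2_norm_def l2_inner_def power2_eq_square)
      show "f \<in> approximable"
      proof (rule approximable_limit [OF f])
        fix \<epsilon> :: real assume "0 < \<epsilon>"
        from eventually_happens [OF order_tendstoD(2) [OF lim this]]
        obtain i where "l2_norm M (\<lambda>x. f x - U i x) < \<epsilon>"
          by auto
        then show "\<exists>g\<in>approximable. l2_norm M (\<lambda>x. f x - g x) < \<epsilon>"
          using seq.IH UL by blast
      qed
    qed
  qed
  fix f assume f: "f \<in> L2 M"
  note [measurable] = L2_measurable [OF f]
  have "(\<lambda>x. max (f x) 0) \<in> approximable" "(\<lambda>x. max (- f x) 0) \<in> approximable"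
    by (rule nonneg [rule_format]; auto intro!: L2_bound [OF f])+
  then have "(\<lambda>x. max (f x) 0 + (- 1) * max (- f x) 0) \<in> approximable"
    by (intro approximable_add approximable_scale)
  moreover have "(\<lambda>x. max (f x) 0 + (- 1) * max (- f x) 0) = f"
    by (auto simp: max_def)
  ultimately show "f \<in> approximable"
    by simp
qed

end

section \<open>The substitution \<open>s = 1 / \<tau>\<close>\<close>

text \<open>The substitution is made with the increasing map s to -1/s, whose derivative 1/s^2 is
  nonnegative, and followed by a reflection.\<close>

lemma nn_integral_inverse_Icc:
  fixes h :: "real \<Rightarrow> ennreal"
  assumes [measurable]: "h \<in> borel_measurable borel" and ab: "0 < a" "a < b"
  shows "(\<integral>\<^sup>+\<tau>. h (1 / \<tau>) * indicator {1 / b..1 / a} \<tau> \<partial>lborel) =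
    (\<integral>\<^sup>+s. h s * ennreal (1 / s\<^sup>2) * indicator {a..b} s \<partial>lborel)"
proof -
  have "(\<integral>\<^sup>+z. h (- 1 / z) * indicator {- 1 / a..- 1 / b} z \<partial>lborel) =
      (\<integral>\<^sup>+s. h (- 1 / (- 1 / s)) * ennreal (1 / s\<^sup>2) * indicator {a..b} s \<partial>lborel)"
    by (rule nn_integral_substitution_aux)
      (use ab in \<open>auto intro!: derivative_eq_intros continuous_intros simp: power2_eq_square\<close>)
  also have "(\<integral>\<^sup>+z. h (- 1 / z) * indicator {- 1 / a..- 1 / b} z \<partial>lborel) =
      (\<integral>\<^sup>+\<tau>. h (1 / \<tau>) * indicator {1 / b..1 / a} \<tau> \<partial>lborel)"
    by (subst nn_integral_real_affine [of _ "- 1" 0])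
      (auto intro!: nn_integral_cong simp: indicator_def)
  finally show ?thesis
    by simp
qed

lemma nn_integral_inverse:
  fixes h :: "real \<Rightarrow> ennreal"
  assumes [measurable]: "h \<in> borel_measurable borel"
  shows "(\<integral>\<^sup>+\<tau>. h (1 / \<tau>) * indicator {0<..} \<tau> \<partial>lborel) =
    (\<integral>\<^sup>+s. h s * ennreal (1 / s\<^sup>2) * indicator {0<..} s \<partial>lborel)"
proof -
  \<comment> \<open>Compact intervals exhausting the half-line, each invariant under inversion.
    Adding 2 makes already the one for n = 0 nondegenerate.\<close>
  define I :: "nat \<Rightarrow> real set" where "I n = {1 / (real n + 2)..real n + 2}" for n
  have inc: "incseq I"
    by (auto simp: incseq_def I_def intro: order_trans frac_le)
  have UN: "(\<Union>n. I n) = {0<..}"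
  proof (intro equalityI subsetI)
    fix x :: real assume "x \<in> {0<..}"
    then have x: "0 < x"
      by simp
    obtain n where n: "max x (1 / x) \<le> real n"
      using real_arch_simple by blast
    then have "1 / x \<le> real n + 2" "x \<le> real n + 2"
      by auto
    then have "x \<in> I n"
      using x by (simp add: I_def field_simps)
    then show "x \<in> (\<Union>n. I n)"
      by blast
  next
    fix x assume "x \<in> (\<Union>n. I n)"
    then show "x \<in> {0<..}"
      by (auto simp: I_def intro: less_le_trans [rotated])
  qed
  have SUP: "(\<integral>\<^sup>+s. \<phi> s * indicator {0<..} s \<partial>lborel) = (SUP n. \<integral>\<^sup>+s. \<phi> s * indicator (I n) s \<partial>lborel)"
    if [measurable]: "\<phi> \<in> borel_measurable borel" for \<phi> :: "real \<Rightarrow> ennreal"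
  proof -
    have "range I \<subseteq> sets (density lborel \<phi>)"
      by (auto simp: I_def)
    from SUP_emeasure_incseq [OF this inc] show ?thesis
      unfolding UN by (simp add: emeasure_density I_def)
  qed
  have "(\<integral>\<^sup>+\<tau>. h (1 / \<tau>) * indicator (I n) \<tau> \<partial>lborel) = (\<integral>\<^sup>+s. h s * ennreal (1 / s\<^sup>2) * indicator (I n) s \<partial>lborel)" for n
  proof -
    have "1 / (real n + 2) < 1" "1 < real n + 2"
      by auto
    then have "1 / (real n + 2) < real n + 2"
      by linarith
    then show ?thesis
      using nn_integral_inverse_Icc [of h "1 / (real n + 2)" "real n + 2"] by (simp add: I_def)
  qed
  then show ?thesis
    by (simp add: SUP)
qed

section \<open>The intrinsic ultra-metric\<close>

locale distance_distribution =
  fixes \<sigma> :: "ennreal \<Rightarrow> real"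
  assumes ddf: "distance_distribution_function \<sigma>"
begin

lemma strict_mono: "strict_mono \<sigma>"
  using ddf by (simp add: distance_distribution_function_def)

lemma le_iff [simp]: "\<sigma> a \<le> \<sigma> b \<longleftrightarrow> a \<le> b"
  by (rule strict_mono_less_eq [OF strict_mono])

lemma less_iff [simp]: "\<sigma> a < \<sigma> b \<longleftrightarrow> a < b"
  by (rule strict_mono_less [OF strict_mono])

lemma nonneg: "0 \<le> \<sigma> a"
proof -
  have "\<sigma> a \<in> {0..1}"
    using ddf unfolding distance_distribution_function_def by blast
  then show ?thesis
    by simp
qed

lemma top: "\<sigma> top = 1"
  using ddf by (simp add: distance_distribution_function_def)

lemma ex_below:
  assumes "0 < t"
  shows "\<exists>r>0. \<sigma> (ennreal r) < t"
proof -
  have "eventually (\<lambda>a. \<sigma> a < t) (at_right 0)"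
    using ddf assms by (intro order_tendstoD) (auto simp: distance_distribution_function_def)
  then obtain b where b: "0 < b" "\<And>a. 0 < a \<Longrightarrow> a < b \<Longrightarrow> \<sigma> a < t"
    by (subst (asm) eventually_at_right [of _ "top"]) auto
  obtain a where a: "0 < a" "a < b"
    using dense [OF b(1)] by blast
  then obtain r where r: "a = ennreal r"
    using less_top_ennreal [of a] order.strict_trans2 [of a b top] by auto
  then have "0 < r" "\<sigma> (ennreal r) < t"
    using a b(2) by auto
  then show ?thesis
    by blast
qed

text \<open>Only the right limit at 0 is prescribed; a positive value at 0 would exceed some value
  further right.\<close>

lemma zero: "\<sigma> 0 = 0"
proof (rule ccontr)
  assume "\<sigma> 0 \<noteq> 0"
  then have "0 < \<sigma> 0"
    using nonneg [of 0] by simp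
  from ex_below [OF this] show False
    by auto
qed

lemma ex_above:
  assumes "t < 1"
  shows "\<exists>r\<ge>0. t < \<sigma> (ennreal r)"
proof -
  have "(\<sigma> \<longlongrightarrow> \<sigma> top) (at_left top)"
    using ddf unfolding distance_distribution_function_def by blast
  then have "eventually (\<lambda>a. t < \<sigma> a) (at_left top)"
    using assms by (intro order_tendstoD) (auto simp: top)
  then obtain b where b: "b < top" "\<And>a. b < a \<Longrightarrow> a < top \<Longrightarrow> t < \<sigma> a"
    by (subst (asm) eventually_at_left [of 0]) auto
  obtain a where a: "b < a" "a < top"
    using dense [OF b(1)] by blast
  then obtain r where "a = ennreal r" "0 \<le> r"
    using less_top_ennreal [of a] by auto
  then show ?thesis
    using a b(2) by blast
qed

lemma positive: "0 < r \<Longrightarrow> 0 < \<sigma> (ennreal r)"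
  using less_iff [of 0 "ennreal r"] by (simp add: zero)

lemma less_1: "\<sigma> (ennreal r) < 1"
  by (simp flip: top)

text \<open>The generalized inverse of \<sigma>. Negative r belong to the set as well, since
  \<open>ennreal\<close> sends them to 0.\<close>

definition quantile :: "real \<Rightarrow> real" where
  "quantile t = (if 0 < t \<and> t < 1 then Sup {r. \<sigma> (ennreal r) \<le> t} else 0)"

text \<open>Left-continuity makes the supremum attained: otherwise \<sigma> would exceed t already
  at some r below it, but the set has an element beyond r.\<close>

lemma le_quantile_iff:
  assumes t: "0 < t" "t < 1"
  shows "c \<le> quantile t \<longleftrightarrow> \<sigma> (ennreal c) \<le> t"
proof -
  define S where "S = {r. \<sigma> (ennreal r) \<le> t}"
  obtain R where R: "0 \<le> R" "t < \<sigma> (ennreal R)"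
    using ex_above [OF t(2)] by blast
  have bdd: "bdd_above S"
  proof
    fix r assume "r \<in> S"
    then have "\<sigma> (ennreal r) < \<sigma> (ennreal R)"
      unfolding S_def using R(2) by (blast intro: le_less_trans)
    then show "r \<le> R"
      by (metis ennreal_leI leD less_iff linear)
  qed
  have ne: "0 \<in> S"
    using t by (simp add: S_def zero)
  have q: "quantile t = Sup S"
    using t by (simp add: quantile_def S_def)
  have "\<sigma> (ennreal (Sup S)) \<le> t"
  proof (rule ccontr)
    assume "\<not> \<sigma> (ennreal (Sup S)) \<le> t"
    then have less: "t < \<sigma> (ennreal (Sup S))"
      by simp
    have pos: "0 < Sup S"
    proof (rule ccontr)
      assume "\<not> 0 < Sup S"
      then have "\<sigma> (ennreal (Sup S)) = 0"
        by (simp add: ennreal_neg zero)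
      then show False
        using less t by simp
    qed
    have "(\<sigma> \<longlongrightarrow> \<sigma> (ennreal (Sup S))) (at_left (ennreal (Sup S)))"
      using ddf by (simp add: distance_distribution_function_def)
    then have "eventually (\<lambda>a. t < \<sigma> a) (at_left (ennreal (Sup S)))"
      using less by (intro order_tendstoD)
    then obtain b where b: "b < ennreal (Sup S)" "\<And>a. b < a \<Longrightarrow> a < ennreal (Sup S) \<Longrightarrow> t < \<sigma> a"
      using pos by (subst (asm) eventually_at_left [of 0]) auto
    obtain a where a: "b < a" "a < ennreal (Sup S)"
      using dense [OF b(1)] by blast
    then obtain r where r: "a = ennreal r" "0 \<le> r"
      using less_top_ennreal [of a] order.strict_trans [OF a(2) ennreal_less_top] by auto
    then have "r < Sup S"
      using a by (simp add: ennreal_less_iff)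
    then obtain s where s: "s \<in> S" "r < s"
      using less_cSup_iff [OF _ bdd] ne by blast
    have "\<sigma> (ennreal r) \<le> \<sigma> (ennreal s)"
      using s(2) by (simp add: ennreal_leI)
    then show False
      using s(1) b(2) [OF a] unfolding S_def r(1) mem_Collect_eq by linarith
  qed
  then have "\<sigma> (ennreal c) \<le> t" if "c \<le> Sup S"
    using ennreal_leI [OF that] le_iff order_trans by blast
  moreover have "c \<le> Sup S" if "\<sigma> (ennreal c) \<le> t"
    using that by (intro cSup_upper bdd) (simp add: S_def)
  ultimately show ?thesis
    unfolding q by blast
qed

lemma quantile_pos:
  assumes "0 < t" and "t < 1"
  shows "0 < quantile t"
  using ex_below [OF assms(1)] le_quantile_iff [OF assms] by (metis less_imp_le less_le_trans)

lemma measurable_quantile [measurable]: "quantile \<in> borel_measurable borel"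
  unfolding borel_measurable_iff_ge
proof
  fix c
  have "{t. c \<le> quantile t} = {0<..<1} \<inter> {\<sigma> (ennreal c)..} \<union> (if c \<le> 0 then - {0<..<1} else {})"
    using le_quantile_iff by (auto simp: quantile_def)
  then show "{t \<in> space borel. c \<le> quantile t} \<in> sets borel"
    by simp
qed

text \<open>By \<open>le_quantile_iff\<close> the preimage of \<open>{a..<b}\<close> is
  \<open>{\<sigma> (ennreal a)..<\<sigma> (ennreal b)}\<close> inside the unit interval, whose
  length is the Stieltjes mass. Half-open intervals form a generator stable under
  intersection.\<close>

lemma stieltjes_eq_distr: "stieltjes \<sigma> = distr (lborel_on 0 1) borel quantile"
proof (rule measure_eqI_generator_eq)
  let ?E = "range (\<lambda>(a, b). {a..<b :: real})"
  have emeasure: "emeasure (distr (lborel_on 0 1) borel quantile) {a..<b} = emeasure (stieltjes \<sigma>) {a..<b}" for a b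
  proof (cases "a \<le> b")
    case True
    have 1: "\<sigma> (ennreal a) \<le> \<sigma> (ennreal b)" "0 \<le> \<sigma> (ennreal a)" "\<sigma> (ennreal b) < 1"
      using True by (simp_all add: ennreal_leI nonneg less_1)
    have "emeasure (distr (lborel_on 0 1) borel quantile) {a..<b} = emeasure lborel ({0<..<1} \<inter> quantile -` {a..<b})"
      using measurable_sets [OF measurable_quantile, of "{a..<b}"]
      by (simp add: emeasure_distr emeasure_lborel_on)
    also have "{0<..<1} \<inter> quantile -` {a..<b} = {0<..<1} \<inter> {\<sigma> (ennreal a)..<\<sigma> (ennreal b)}"
      using le_quantile_iff by (auto simp: not_le [symmetric])
    also have "emeasure lborel \<dots> = ennreal (\<sigma> (ennreal b) - \<sigma> (ennreal a))"
    proof (cases "\<sigma> (ennreal a) = 0")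
      case True
      then have "{0<..<1} \<inter> {\<sigma> (ennreal a)..<\<sigma> (ennreal b)} = {0<..<\<sigma> (ennreal b)}"
        using 1 by auto
      then show ?thesis
        using True 1 by simp
    next
      case False
      then have "{0<..<1} \<inter> {\<sigma> (ennreal a)..<\<sigma> (ennreal b)} = {\<sigma> (ennreal a)..<\<sigma> (ennreal b)}"
        using 1 by auto
      then show ?thesis
        using 1 by simp
    qed
    also have "\<dots> = emeasure (stieltjes \<sigma>) {a..<b}"
      using emeasure_stieltjes [OF ddf True] by simp
    finally show ?thesis .
  qed simp
  show "Int_stable ?E"
  proof (rule Int_stableI)
    fix A B assume "A \<in> ?E" "B \<in> ?E"
    then obtain a b c d where "A = {a..<b}" "B = {c..<d}"
      by auto
    then have "A \<inter> B = (\<lambda>(a, b). {a..<b}) (max a c, min b d)"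
      by auto
    then show "A \<inter> B \<in> ?E"
      by blast
  qed
  show "?E \<subseteq> Pow UNIV"
    by simp
  show "emeasure (stieltjes \<sigma>) X = emeasure (distr (lborel_on 0 1) borel quantile) X" if "X \<in> ?E" for X
    using that emeasure by auto
  have "sets borel = sigma_sets UNIV ?E"
    by (subst borel_eq_atLeastLessThan) simp
  then show "sets (stieltjes \<sigma>) = sigma_sets UNIV ?E" "sets (distr (lborel_on 0 1) borel quantile) = sigma_sets UNIV ?E"
    by (simp_all add: stieltjes_def)
  show "range (\<lambda>i::nat. {- real i..<real i}) \<subseteq> ?E"
    by auto
  show "(\<Union>i::nat. {- real i..<real i}) = UNIV"
  proof (intro equalityI subsetI UNIV_I)
    fix x :: real
    obtain i where "\<bar>x\<bar> < real i"
      using reals_Archimedean2 by blast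
    then have "x \<in> {- real i..<real i}"
      by auto
    then show "x \<in> (\<Union>i::nat. {- real i..<real i})"
      by blast
  qed
  show "emeasure (stieltjes \<sigma>) {- real i..<real i} \<noteq> \<infinity>" for i :: nat
    by (simp add: emeasure_stieltjes [OF ddf])
qed

end

section \<open>The ultra-metric space with its Radon measure\<close>

locale isotropic = distance_distribution \<sigma> for \<sigma> +
  fixes \<mu> :: "'a::{metric_space, second_countable_topology} measure"
  assumes dist_ultra: "\<And>x y z :: 'a. dist x z \<le> max (dist x y) (dist y z)"
    and compact_cball: "\<And>(x :: 'a) r. compact (cball x r)"
    and radon: "radon_measure \<mu>"
    and support: "full_support \<mu>"
begin

abbreviation udist :: "'a \<Rightarrow> 'a \<Rightarrow> real" where
  "udist x y \<equiv> \<sigma> (ennreal (dist x y))"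

lemma sets_\<mu> [simp, measurable_cong]: "sets \<mu> = sets borel"
  using radon by (simp add: radon_measure_def)

lemma space_\<mu> [simp]: "space \<mu> = UNIV"
  using sets_eq_imp_space_eq [OF sets_\<mu>] by simp

lemma udist_ball: "0 < t \<Longrightarrow> t < 1 \<Longrightarrow> {y. udist x y \<le> t} = cball x (quantile t)"
  by (auto simp: le_quantile_iff)

lemma measurable_real_\<sigma> [measurable]: "(\<lambda>r. \<sigma> (ennreal r)) \<in> borel_measurable borel"
  by (rule borel_measurable_mono) (simp add: mono_def ennreal_leI)

text \<open>Each point of the ball is a centre of it. With full support, closed balls of positive
  radius therefore have positive measure.\<close>

lemma open_cball:
  assumes "0 < r"
  shows "open (cball x r :: 'a set)"
  unfolding open_contains_ball
proof
  fix y assume y: "y \<in> cball x r"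
  have "ball y r \<subseteq> cball x r"
  proof
    fix z assume "z \<in> ball y r"
    then show "z \<in> cball x r"
      using y dist_ultra [of x z y] by auto
  qed
  then show "\<exists>e>0. ball y e \<subseteq> cball x r"
    using assms by blast
qed

sublocale ultrametric_measure \<mu> udist
proof
  show "\<exists>A. countable A \<and> A \<subseteq> sets \<mu> \<and> \<Union> A = space \<mu> \<and> (\<forall>a\<in>A. emeasure \<mu> a \<noteq> \<infinity>)"
  proof (intro exI conjI ballI)
    \<comment> \<open>Compact balls around an arbitrary point; they have finite measure and exhaust
      the space.\<close>
    let ?A = "range (\<lambda>n. cball undefined (real n) :: 'a set)"
    show "countable ?A"
      by simp
    show "?A \<subseteq> sets \<mu>"
      by auto
    have "x \<in> \<Union> ?A" for x
      using real_arch_simple [of "dist undefined x"] by auto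
    then show "\<Union> ?A = space \<mu>"
      by auto
    show "emeasure \<mu> a \<noteq> \<infinity>" if "a \<in> ?A" for a
      using that radon compact_cball by (auto simp: radon_measure_def less_top)
  qed
  show "space \<mu> = UNIV"
    by simp
  show "(\<lambda>(x, y). udist x y) \<in> borel_measurable (\<mu> \<Otimes>\<^sub>M \<mu>)"
    by measurable
  show "udist x x = 0" for x
    by (simp add: zero)
  show "udist x y = udist y x" for x y
    by (simp add: dist_commute)
  show "udist x z \<le> max (udist x y) (udist y z)" for x y z
    using dist_ultra [of x z y] by (auto simp: le_max_iff_disj ennreal_leI)
  fix t :: real and x :: 'a assume t: "0 < t" "t < 1"
  have "cball x (quantile t) \<noteq> {}"
    using quantile_pos [OF t] by simp
  then show "0 < emeasure \<mu> {y. udist x y \<le> t}"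
    unfolding udist_ball [OF t] using support open_cball [OF quantile_pos [OF t], of x]
    unfolding full_support_def by blast
  show "emeasure \<mu> {y. udist x y \<le> t} < \<infinity>"
    unfolding udist_ball [OF t] using radon compact_cball unfolding radon_measure_def by blast
qed

text \<open>A move by less than the radius does not leave an ultra-metric ball, so the smallest of
  finitely many radii serves for the union.\<close>

lemma indicator_locally_constant:
  assumes D: "finite D" "\<And>x. x \<in> D \<Longrightarrow> 0 < r x" and fin: "emeasure \<mu> (\<Union>x\<in>D. ball x (r x)) < \<infinity>"
  shows "indicator (\<Union>x\<in>D. ball x (r x)) \<in> locally_constant"
proof -
  define W where "W = (\<Union>x\<in>D. ball x (r x))"
  have W: "W \<in> sets \<mu>"
    unfolding W_def sets_\<mu> by (intro borel_open open_UN) simp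
  \<comment> \<open>The element 1 keeps the minimum defined for empty \<open>D\<close>.\<close>
  define r0 where "r0 = Min (insert 1 (r ` D))"
  have r0: "0 < r0" "\<And>x. x \<in> D \<Longrightarrow> r0 \<le> r x"
    using D by (auto simp: r0_def)
  \<comment> \<open>Halving turns the non-strict condition on \<open>udist\<close> into a distance
    strictly below r0.\<close>
  define t where "t = \<sigma> (ennreal (r0 / 2))"
  have "0 < t"
    using r0(1) by (simp add: t_def positive)
  moreover have "t < 1"
    by (simp add: t_def less_1)
  moreover have sub: "y \<in> W" if le: "udist x y \<le> t" and x: "x \<in> W" for x y
  proof -
    have "dist x y \<le> r0 / 2"
      using le r0(1) by (simp add: t_def)
    then have "dist x y < r0"
      using r0(1) by simp
    obtain z where z: "z \<in> D" "dist z x < r z"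
      using x by (auto simp: W_def)
    have "dist z y < r z"
      using dist_ultra [of z y x] z(2) r0(2) [OF z(1)] \<open>dist x y < r0\<close> by auto
    then show ?thesis
      using z(1) by (auto simp: W_def)
  qed
  then have "\<forall>x y. udist x y \<le> t \<longrightarrow> indicator W x = (indicator W y :: real)"
    by (metis dist_commute indicator_simps)
  moreover have "indicator W \<in> L2 \<mu>"
    using fin indicator_L2_iff [OF W] by (simp add: W_def)
  ultimately show ?thesis
    unfolding locally_constant_def W_def by blast
qed

text \<open>By regularity there are \<open>K \<subseteq> U\<close>, \<open>A \<subseteq> U\<close> with \<open>K\<close> compact, \<open>U\<close> open and nearly the same measure
  as \<open>A\<close>; finitely many balls cover \<open>K\<close> inside \<open>U\<close>.\<close>

lemma indicator_approximable:
  assumes A: "A \<in> sets \<mu>" and fin: "emeasure \<mu> A < \<infinity>"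
  shows "indicator A \<in> approximable"
proof -
  have "\<exists>d\<in>locally_constant. l2_norm \<mu> (\<lambda>x. indicator A x - d x) < \<epsilon>" if \<epsilon>: "0 < \<epsilon>" for \<epsilon> :: real
  proof -
    \<comment> \<open>The squared distance of the indicators of A and W is at most the measure of U
      - A plus that of U - W, each below \<delta>.\<close>
    define \<delta> where "\<delta> = \<epsilon>\<^sup>2 / 2"
    have \<delta>: "0 < \<delta>"
      using \<epsilon> by (simp add: \<delta>_def)
    have "emeasure \<mu> A = (INF U\<in>{U. open U \<and> A \<subseteq> U}. emeasure \<mu> U)"
      using radon A unfolding radon_measure_def sets_\<mu> by blast
    moreover have "emeasure \<mu> A \<noteq> \<infinity>"
      using fin by simp
    ultimately obtain U where U: "open U" "A \<subseteq> U" "emeasure \<mu> U < emeasure \<mu> A + ennreal \<delta>"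
      using INF_approx_ennreal [OF \<delta>] by blast
    have Ufin: "emeasure \<mu> U < \<infinity>"
      using U(3) fin by (metis ennreal_add_eq_top ennreal_neq_top infinity_ennreal_def less_top top.not_eq_extremum order.strict_trans)
    have SUP: "emeasure \<mu> U = (SUP K\<in>{K. compact K \<and> K \<subseteq> U}. emeasure \<mu> K)"
      using radon U(1) unfolding radon_measure_def by blast
    have ne: "{K. compact K \<and> K \<subseteq> U} \<noteq> {}"
      by (auto intro: exI [of _ "{}"])
    have "emeasure \<mu> U \<noteq> \<infinity>"
      using Ufin by simp
    from SUP_approx_ennreal [OF \<delta> ne SUP this] obtain K where K: "compact K" "K \<subseteq> U" "emeasure \<mu> U < emeasure \<mu> K + ennreal \<delta>"
      by blast
    have "\<forall>x\<in>K. \<exists>r>0. ball x r \<subseteq> U"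
      using K(2) U(1) unfolding open_contains_ball by blast
    then obtain r where r: "\<And>x. x \<in> K \<Longrightarrow> 0 < r x \<and> ball x (r x) \<subseteq> U"
      by metis
    have "K \<subseteq> (\<Union>x\<in>K. ball x (r x))"
      using r by force
    then obtain D where D: "D \<subseteq> K" "finite D" "K \<subseteq> (\<Union>x\<in>D. ball x (r x))"
      using compactE_image [OF K(1), of K "\<lambda>x. ball x (r x)"] by (metis open_ball)
    define W where "W = (\<Union>x\<in>D. ball x (r x))"
    have WU: "W \<subseteq> U" "K \<subseteq> W"
      using D r by (auto simp: W_def)
    have meas [measurable]: "U \<in> sets \<mu>" "W \<in> sets \<mu>" "K \<in> sets \<mu>" "A \<in> sets \<mu>"
      using U(1) K(1) A D(2) by (auto simp: W_def compact_imp_closed)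
    have sub: "emeasure \<mu> B < \<infinity>" if "B \<subseteq> U" for B
      using emeasure_mono [OF that meas(1)] Ufin by (rule le_less_trans)
    have fm: "B \<in> fmeasurable \<mu>" if "B \<in> sets \<mu>" "B \<subseteq> U" for B
      using that sub by (simp add: fmeasurable_def)
    have W: "indicator W \<in> locally_constant"
      unfolding W_def using D r sub [OF WU(1)] by (intro indicator_locally_constant) (auto simp: W_def)
    have eq: "emeasure \<mu> B = ennreal (measure \<mu> B)" if "B \<subseteq> U" for B
      using sub [OF that] by (simp add: emeasure_eq_ennreal_measure)
    have "ennreal (measure \<mu> U) < ennreal (measure \<mu> A + \<delta>)" "ennreal (measure \<mu> U) < ennreal (measure \<mu> K + \<delta>)"
      using U(2,3) K(2,3) \<delta> by (simp_all add: eq)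
    then have "measure \<mu> U < measure \<mu> A + \<delta>" "measure \<mu> U < measure \<mu> K + \<delta>"
      by (simp_all add: ennreal_less_iff)
    moreover have "measure \<mu> K \<le> measure \<mu> W"
      using WU meas by (intro measure_mono_fmeasurable fm) simp_all
    moreover have "measure \<mu> (U - B) = measure \<mu> U - measure \<mu> B" if "B \<in> sets \<mu>" "B \<subseteq> U" for B
      using that meas(1) by (intro measurable_measure_Diff fm) simp_all
    ultimately have small: "measure \<mu> (U - A) < \<delta>" "measure \<mu> (U - W) < \<delta>"
      using WU(1) U(2) meas by simp_all
    have int: "integrable \<mu> (indicator (U - B) :: 'a \<Rightarrow> real)" if "B \<in> sets \<mu>" for B
      using that sub [of "U - B"] meas(1) by (intro integrable_real_indicator) auto
    have "l2_inner \<mu> (\<lambda>x. indicator A x - indicator W x) (\<lambda>x. indicator A x - indicator W x)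
        \<le> (LINT x|\<mu>. indicator (U - A) x + indicator (U - W) x)"
      unfolding l2_inner_def
    proof (rule integral_mono)
      show "integrable \<mu> (\<lambda>x. indicator (U - A) x + indicator (U - W) x :: real)"
        by (intro Bochner_Integration.integrable_add int meas)
      have "indicator A \<in> L2 \<mu>"
        using A fin by (simp add: indicator_L2_iff)
      then show "integrable \<mu> (\<lambda>x. (indicator A x - indicator W x) * (indicator A x - indicator W x) :: real)"
        using locally_constant_L2 [OF W] by (intro L2_mult_integrable L2_diff)
      show "(indicator A x - indicator W x) * (indicator A x - indicator W x)
          \<le> (indicator (U - A) x + indicator (U - W) x :: real)" for x
        using WU(1) U(2) by (auto simp: indicator_def)
    qed
    also have "\<dots> = measure \<mu> (U - A) + measure \<mu> (U - W)"
      using int meas by simp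
    also have "\<dots> < \<epsilon>\<^sup>2"
      using small by (simp add: \<delta>_def)
    finally have "l2_norm \<mu> (\<lambda>x. indicator A x - indicator W x) < \<epsilon>"
      using \<epsilon> unfolding l2_norm_def by (simp add: real_less_lsqrt)
    then show ?thesis
      using W by blast
  qed
  moreover have "indicator A \<in> L2 \<mu>"
    using A fin by (simp add: indicator_L2_iff)
  ultimately show ?thesis
    by (simp add: approximable_def)
qed

sublocale dense_ultrametric_measure \<mu> udist
  by unfold_locales
    (use locally_constant_denseI [OF indicator_approximable] in \<open>auto simp: approximable_def\<close>)

section \<open>The isotropic Markov operator as an integral of averages\<close>

lemma ball_average_quantile:
  assumes t: "0 < t" "t < 1"
  shows "ball_average \<mu> (quantile t) f x = avg t f x"
proof -
  have "avg t f x = (LINT y|\<mu>. 1 / vol t x * (indicator (cball x (quantile t)) y * f y))"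
    unfolding avg_def using t by (intro Bochner_Integration.integral_cong) (auto simp: avg_kernel_eq udist_ball)
  then show ?thesis
    by (simp add: ball_average_def set_lebesgue_integral_def vol_def udist_ball [OF t])
qed

lemma isotropic_Markov_eq:
  assumes f: "f \<in> L2 \<mu>"
  shows "isotropic_Markov \<mu> \<sigma> f = (\<lambda>x. LINT t|lborel_on 0 1. avg t f x)"
proof
  fix x
  note [measurable] = L2_measurable [OF f]
  \<comment> \<open>Written with integrals depending on the parameter r, the average is visibly
    measurable in r, as the change of variables requires.\<close>
  have average_eq: "ball_average \<mu> r f x =
      1 / (LINT y|\<mu>. (if dist x y \<le> r then 1 else 0)) * (LINT y|\<mu>. (if dist x y \<le> r then f y else 0))" for r
  proof -
    have "(LINT y|\<mu>. (if dist x y \<le> r then 1 else 0 :: real)) = (LINT y|\<mu>. indicator (cball x r) y)"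
      by (intro Bochner_Integration.integral_cong) (auto simp: indicator_def)
    moreover have "(LINT y|\<mu>. (if dist x y \<le> r then f y else 0)) = (LINT y|\<mu>. indicator (cball x r) y * f y)"
      by (intro Bochner_Integration.integral_cong) (auto simp: indicator_def)
    ultimately show ?thesis
      by (simp add: ball_average_def set_lebesgue_integral_def)
  qed
  have [measurable]: "(\<lambda>r. ball_average \<mu> r f x) \<in> borel_measurable borel"
    unfolding average_eq
    by (intro borel_measurable_times borel_measurable_divide borel_measurable_const borel_measurable_lebesgue_integral) measurable
  have "isotropic_Markov \<mu> \<sigma> f x = (LINT t|lborel_on 0 1. indicator {0..} (quantile t) * ball_average \<mu> (quantile t) f x)"
    unfolding isotropic_Markov_def stieltjes_eq_distr set_lebesgue_integral_def
    by (subst integral_distr) simp_all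
  also have "\<dots> = (LINT t|lborel_on 0 1. avg t f x)"
  proof (rule integral_cong_AE)
    show "AE t in lborel_on 0 1. indicator {0..} (quantile t) * ball_average \<mu> (quantile t) f x = avg t f x"
      using AE_lborel_on
      by eventually_elim (simp add: ball_average_quantile indicator_def quantile_pos [THEN less_imp_le])
    show "(\<lambda>t. avg t f x) \<in> borel_measurable (lborel_on 0 1)"
      by (intro measurable_avg) auto
  qed measurable
  finally show "isotropic_Markov \<mu> \<sigma> f x = (LINT t|lborel_on 0 1. avg t f x)" .
qed

lemma isotropic_Markov_spectral: "nonneg_spectral_resolution \<mu> spec (isotropic_Markov \<mu> \<sigma>)"
  by (rule nonneg_spectral_resolution_spec) (rule isotropic_Markov_eq)

text \<open>Dictionary between intrinsic balls and \<open>udist\<close>-balls, from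
  \<open>dstar\<close> = 1 / ln (1 / u) off the diagonal. It translates \<open>V_union\<close> and
  the jump kernel into the language of averages.\<close>

lemma ball_star_eq:
  assumes s: "0 < s"
  shows "ball_star \<sigma> x s = {y. udist x y \<le> exp (- 1 / s)}"
proof -
  have "dstar \<sigma> x y \<le> s \<longleftrightarrow> udist x y \<le> exp (- 1 / s)" for y
  proof (cases "x = y")
    case True
    then show ?thesis
      using s by (simp add: dstar_def zero)
  next
    case False
    have u: "0 < udist x y" "udist x y < 1"
      using False by (simp_all add: less_1 positive)
    then have L: "0 < - ln (udist x y)"
      by (simp add: ln_less_zero)
    have "dstar \<sigma> x y \<le> s \<longleftrightarrow> 1 / (- ln (udist x y)) \<le> s"
      using False u by (simp add: dstar_def ln_div)
    also have "\<dots> \<longleftrightarrow> ln (udist x y) \<le> - 1 / s"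
      using L s by (simp add: field_simps)
    also have "\<dots> \<longleftrightarrow> udist x y \<le> exp (- 1 / s)"
      using u by (metis exp_le_cancel_iff exp_ln)
    finally show ?thesis .
  qed
  then show ?thesis
    by (simp add: ball_star_def)
qed

lemma inverse_emeasure_ball_star:
  assumes s: "0 < s"
  shows "1 / emeasure \<mu> (ball_star \<sigma> x s) = ennreal (1 / vol (exp (- 1 / s)) x)"
  using s vol_positive [of "exp (- 1 / s)" x] divide_ennreal [of 1 "vol (exp (- 1 / s)) x"]
  by (simp add: ball_star_eq emeasure_ball)

lemma V_union_eq: "V_union \<mu> \<sigma> = locally_constant"
proof (intro equalityI subsetI)
  fix f assume "f \<in> V_union \<mu> \<sigma>"
  then obtain r where r: "0 < r" "f \<in> L2 \<mu>" "\<And>x. f constant_on ball_star \<sigma> x r"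
    by (auto simp: V_union_def V_space_def)
  have "f x = f y" if "udist x y \<le> exp (- 1 / r)" for x y
    using r(3) [of x] that unfolding ball_star_eq [OF r(1)] constant_on_def by (auto simp: zero)
  then show "f \<in> locally_constant"
    using r by (auto simp: locally_constant_def intro!: exI [of _ "exp (- 1 / r)"])
next
  fix f assume "f \<in> locally_constant"
  then obtain t where t: "0 < t" "t < 1" "f \<in> L2 \<mu>" "\<And>x y. udist x y \<le> t \<Longrightarrow> f x = f y"
    unfolding locally_constant_def by blast
  \<comment> \<open>The solution of exp (-1/r) = t.\<close>
  define r where "r = - 1 / ln t"
  have r: "0 < r" "exp (- 1 / r) = t"
    using t by (auto simp: r_def divide_neg_neg ln_less_zero)
  have "f constant_on ball_star \<sigma> x r" for x
    unfolding ball_star_eq [OF r(1)] r(2) constant_on_def using t(4) by (metis mem_Collect_eq)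
  then show "f \<in> V_union \<mu> \<sigma>"
    using r t by (auto simp: V_union_def V_space_def)
qed

text \<open>The upper limit is built into \<open>avg_kernel\<close>, which vanishes once \<tau>
  exceeds L = 1 / \<open>dstar\<close>. The integrands differ at most at the single point \<tau> =
  L.\<close>

lemma jump_kernel_eq:
  assumes "x \<noteq> y"
  shows "jump_kernel \<mu> \<sigma> x y = (\<integral>\<^sup>+\<tau>. ennreal (avg_kernel (exp (- \<tau>)) x y) * indicator {0<..} \<tau> \<partial>lborel)"
proof -
  have u: "0 < udist x y" "udist x y < 1"
    using assms by (simp_all add: less_1 positive)
  define L where "L = - ln (udist x y)"
  have L: "0 < L"
    using u by (simp add: L_def ln_less_zero)
  have "dstar \<sigma> x y = 1 / L"
    using assms u by (simp add: dstar_def L_def ln_div)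
  then have "1 / ennreal (dstar \<sigma> x y) = ennreal L"
    using L divide_ennreal [of 1 "1 / L"] by simp
  then have "jump_kernel \<mu> \<sigma> x y = (\<integral>\<^sup>+\<tau>\<in>{0<..<L}. spectral_N \<mu> \<sigma> x \<tau> \<partial>lborel)"
    unfolding jump_kernel_def
    by (intro nn_integral_cong) (auto simp: ennreal_less_iff indicator_def)
  also have "\<dots> = (\<integral>\<^sup>+\<tau>. ennreal (avg_kernel (exp (- \<tau>)) x y) * indicator {0<..} \<tau> \<partial>lborel)"
  proof (rule nn_integral_cong_AE)
    have "AE \<tau> in lborel. \<tau> \<noteq> L"
      by (rule AE_lborel_singleton)
    then show "AE \<tau> in lborel. spectral_N \<mu> \<sigma> x \<tau> * indicator {0<..<L} \<tau> =
        ennreal (avg_kernel (exp (- \<tau>)) x y) * indicator {0<..} \<tau>"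
    proof eventually_elim
      fix \<tau> assume "\<tau> \<noteq> L"
      have "udist x y \<le> exp (- \<tau>) \<longleftrightarrow> \<tau> \<le> L"
        unfolding L_def using u by (metis exp_le_cancel_iff exp_ln le_minus_iff)
      moreover have "spectral_N \<mu> \<sigma> x \<tau> = ennreal (1 / vol (exp (- \<tau>)) x)" if "0 < \<tau>"
        using inverse_emeasure_ball_star [of "1 / \<tau>" x] that by (simp add: spectral_N_def)
      ultimately show "spectral_N \<mu> \<sigma> x \<tau> * indicator {0<..<L} \<tau> =
          ennreal (avg_kernel (exp (- \<tau>)) x y) * indicator {0<..} \<tau>"
        using \<open>\<tau> \<noteq> L\<close> by (auto simp: avg_kernel_def indicator_def)
    qed
  qed
  finally show ?thesis .
qed

text \<open>Where f x and f y differ, x and y are farther apart than exp (-T), so the kernel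
  vanishes for \<tau> \<ge> T and the truncation changes nothing. Elsewhere both sides are 0, also
  on the diagonal.\<close>

lemma jump_integrand_eq:
  assumes const: "\<And>x y. udist x y \<le> exp (- T) \<Longrightarrow> f x = f y"
  shows "jump_integrand \<mu> \<sigma> f x y = (f x - f y) * (LINT \<tau>|lborel_on 0 T. avg_kernel (exp (- \<tau>)) x y)"
proof (cases "f x = f y")
  case False
  then have far: "exp (- T) < udist x y" and "x \<noteq> y"
    using const [of x y] not_le by blast+
  have [measurable]: "(\<lambda>\<tau>. avg_kernel (exp (- \<tau>)) x y) \<in> borel_measurable borel"
    by (intro measurable_avg_kernel) auto
  have "jump_kernel \<mu> \<sigma> x y = (\<integral>\<^sup>+\<tau>. indicator {0<..<T} \<tau> * ennreal (avg_kernel (exp (- \<tau>)) x y) \<partial>lborel)"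
    unfolding jump_kernel_eq [OF \<open>x \<noteq> y\<close>]
  proof (intro nn_integral_cong)
    fix \<tau>
    have "avg_kernel (exp (- \<tau>)) x y = 0" if "T \<le> \<tau>"
    proof -
      have "exp (- \<tau>) < udist x y"
        using far that by (intro le_less_trans [OF _ far]) simp
      then show ?thesis
        by (simp add: avg_kernel_def)
    qed
    then show "ennreal (avg_kernel (exp (- \<tau>)) x y) * indicator {0<..} \<tau> =
        indicator {0<..<T} \<tau> * ennreal (avg_kernel (exp (- \<tau>)) x y)"
      by (auto simp: indicator_def)
  qed
  also have "\<dots> = (\<integral>\<^sup>+\<tau>. ennreal (avg_kernel (exp (- \<tau>)) x y) \<partial>lborel_on 0 T)"
    by (rule nn_integral_lborel_on [symmetric]) measurable
  finally have "enn2real (jump_kernel \<mu> \<sigma> x y) = (LINT \<tau>|lborel_on 0 T. avg_kernel (exp (- \<tau>)) x y)"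
    by (subst integral_eq_nn_integral) simp_all
  then show ?thesis
    using False by (simp add: jump_integrand_def)
qed (simp add: jump_integrand_def)

text \<open>The exceptional null set stems only from the choice of a representative in
  \<open>calculus_op\<close>; the jump formula for the explicit integral holds at every x.\<close>

lemma isotropic_Laplacian_AE_eq:
  assumes "f \<in> locally_constant"
  shows "AE x in \<mu>. integrable \<mu> (jump_integrand \<mu> \<sigma> f x) \<and>
    isotropic_Laplacian \<mu> \<sigma> f x = (LINT y|\<mu>. jump_integrand \<mu> \<sigma> f x y)"
proof -
  obtain t where t: "0 < t" "t < 1" and f: "f \<in> L2 \<mu>" and const: "\<And>x y. udist x y \<le> t \<Longrightarrow> f x = f y"
    using assms unfolding locally_constant_def by blast
  define T where "T = - ln t"
  have T: "0 < T" and const: "\<And>x y. udist x y \<le> exp (- T) \<Longrightarrow> f x = f y"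
    using t const by (auto simp: T_def ln_less_zero)
  have "AE x in \<mu>. isotropic_Laplacian \<mu> \<sigma> f x = (LINT \<tau>|lborel_on 0 T. f x - avg (exp (- \<tau>)) f x)"
    unfolding isotropic_Laplacian_def
    by (rule calculus_op_AE_eq [OF isotropic_Markov_spectral spectral_integral_ln_spec [OF f T const]
          locally_constant_subset_domain dense])
  then show ?thesis
  proof eventually_elim
    fix x assume "isotropic_Laplacian \<mu> \<sigma> f x = (LINT \<tau>|lborel_on 0 T. f x - avg (exp (- \<tau>)) f x)"
    then show "integrable \<mu> (jump_integrand \<mu> \<sigma> f x) \<and>
        isotropic_Laplacian \<mu> \<sigma> f x = (LINT y|\<mu>. jump_integrand \<mu> \<sigma> f x y)"
      using integrable_jump [OF f T const, of x] integral_jump [OF f T const, of x]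
      by (simp add: jump_integrand_eq [OF const] cong: Bochner_Integration.integrable_cong)
  qed
qed

text \<open>The substitution s = 1 / \<tau>, with the limit \<open>dstar\<close> moved into the
  integrand so that both integrals run over the whole half-line. On the diagonal
  \<open>1 / ennreal 0\<close> is infinite, so that case is included.\<close>

lemma jump_kernel_substitution:
  "jump_kernel \<mu> \<sigma> x y =
    (\<integral>\<^sup>+s\<in>{dstar \<sigma> x y<..}. 1 / emeasure \<mu> (ball_star \<sigma> x s) * ennreal (1 / s\<^sup>2) \<partial>lborel)"
proof -
  define d where "d = dstar \<sigma> x y"
  have d: "0 \<le> d"
  proof (cases "x = y")
    case False
    have "0 < udist x y" "udist x y < 1"
      using False by (simp_all add: less_1 positive)
    then show ?thesis
      using False by (simp add: d_def dstar_def)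
  qed (simp add: d_def dstar_def)
  define h where "h s = indicator {d<..} s * ennreal (1 / vol (exp (- 1 / s)) x)" for s
  have [measurable]: "h \<in> borel_measurable borel"
  proof -
    have "(\<lambda>s. vol (exp (- 1 / s)) x) \<in> borel_measurable borel"
      by (intro measurable_vol) auto
    then show ?thesis
      unfolding h_def by measurable
  qed
  have "jump_kernel \<mu> \<sigma> x y = (\<integral>\<^sup>+\<tau>. h (1 / \<tau>) * indicator {0<..} \<tau> \<partial>lborel)"
    unfolding jump_kernel_def
  proof (intro nn_integral_cong)
    fix \<tau> :: real
    have "spectral_N \<mu> \<sigma> x \<tau> = ennreal (1 / vol (exp (- 1 / (1 / \<tau>))) x)" if "0 < \<tau>"
      using inverse_emeasure_ball_star [of "1 / \<tau>" x] that by (simp add: spectral_N_def)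
    moreover have "ennreal \<tau> < 1 / ennreal d \<longleftrightarrow> d < 1 / \<tau>" if "0 < \<tau>"
    proof (cases "d = 0")
      case True
      then show ?thesis
        using that by (simp add: divide_ennreal_def ennreal_inverse_zero)
    next
      case False
      then have "1 / ennreal d = ennreal (1 / d)"
        using d divide_ennreal [of 1 d] by simp
      then show ?thesis
        using that False d by (simp add: ennreal_less_iff field_simps)
    qed
    ultimately show "spectral_N \<mu> \<sigma> x \<tau> * indicator {\<tau>. 0 < \<tau> \<and> ennreal \<tau> < 1 / ennreal (dstar \<sigma> x y)} \<tau> =
        h (1 / \<tau>) * indicator {0<..} \<tau>"
      by (auto simp: h_def indicator_def d_def)
  qed
  also have "\<dots> = (\<integral>\<^sup>+s. h s * ennreal (1 / s\<^sup>2) * indicator {0<..} s \<partial>lborel)"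
    by (rule nn_integral_inverse) measurable
  also have "\<dots> = (\<integral>\<^sup>+s\<in>{d<..}. 1 / emeasure \<mu> (ball_star \<sigma> x s) * ennreal (1 / s\<^sup>2) \<partial>lborel)"
    using d inverse_emeasure_ball_star [of _ x]
    by (intro nn_integral_cong) (auto simp: h_def indicator_def)
  finally show ?thesis
    by (simp add: d_def)
qed

end

theorem theorem3p12:
  fixes \<mu> :: "'a::{metric_space, second_countable_topology} measure"
    and \<sigma> :: "ennreal \<Rightarrow> real"
  assumes "\<And>x y z :: 'a. dist x z \<le> max (dist x y) (dist y z)"
    and "\<And>(x :: 'a) r. compact (cball x r)"
    and "radon_measure \<mu>"
    and "full_support \<mu>"
    and "distance_distribution_function \<sigma>"
  shows "(\<forall>f\<in>L2 \<mu>. \<forall>\<epsilon>>0. \<exists>g\<in>V_union \<mu> \<sigma>. l2_norm \<mu> (\<lambda>x. f x - g x) < \<epsilon>) \<and>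
    V_union \<mu> \<sigma> \<subseteq> dom_isotropic_Laplacian \<mu> \<sigma> \<and>
    (\<forall>f\<in>V_union \<mu> \<sigma>. AE x in \<mu>.
       integrable \<mu> (jump_integrand \<mu> \<sigma> f x) \<and>
       isotropic_Laplacian \<mu> \<sigma> f x = (LINT y|\<mu>. jump_integrand \<mu> \<sigma> f x y)) \<and>
    (\<forall>x y. jump_kernel \<mu> \<sigma> x y =
       (\<integral>\<^sup>+s\<in>{dstar \<sigma> x y<..}. 1 / emeasure \<mu> (ball_star \<sigma> x s) * ennreal (1 / s\<^sup>2) \<partial>lborel))"
proof -
  interpret isotropic \<sigma> \<mu>
    by unfold_locales (fact assms)+
  have "V_union \<mu> \<sigma> \<subseteq> dom_isotropic_Laplacian \<mu> \<sigma>"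
    unfolding V_union_eq dom_isotropic_Laplacian_def calculus_domain_eq [OF isotropic_Markov_spectral]
    by (rule locally_constant_subset_domain)
  then show ?thesis
    using dense isotropic_Laplacian_AE_eq jump_kernel_substitution unfolding V_union_eq by blast
qed

end
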